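(* Let $A$ be a basic finite-dimensional algebra over a field $\mathbb{K}$, $E$ a basic generating-cogenerating $A$-module, $\Gamma\cong\operatorname{End}_A(E)^{\mathrm{op}}$, and $1\leq k\leq\operatorname{domdim}\Gamma$. Let $E_k=(E\to Q_0\to\cdots\to Q_{k-1})\oplus DA[-k]$, where $E\to Q_0\to\cdots\to Q_{k-1}$ consists of the first $k$ terms of a minimal injective resolution of $E$, with $E$ in degree $0$, and $DA[-k]$ is the stalk complex with $DA$ in degree $k$. Let $g_k\colon Q_{k-2}\to Q_{k-1}\oplus DA$ (with $Q_{-1}:=E$) be the rightmost non-zero map in the complex $E_k$, i.e. its differential from degree $k-1$ to degree $k$. Then for every finitely generated $A$-module $M$, the intermediate extension $c_k(M)$, a module over the $k$-shifted algebra $B_k$ of $\Gamma$, is given by $$c_k(M)\cong\ker\bigl(D\operatorname{Hom}_A(M,Q_{k-1}\oplus DA)\to D\operatorname{Hom}_A(M,\operatorname{im}g_k)\bigr),$$ where the map is the dual of the map induced by the inclusion $\operatorname{im}g_k\to Q_{k-1}\oplus DA$.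
   Context: Modules are finitely generated left modules; morphisms are composed right-to-left; $D=\operatorname{Hom}_{\mathbb{K}}(-,\mathbb{K})$; $\mathcal{K}^{\mathrm{b}}(A)$ is the bounded homotopy category of $A$-modules. $E$ is generating-cogenerating if $A,DA\in\operatorname{add}E$. $\operatorname{domdim}\Gamma\geq k$ if ${}_\Gamma\Gamma$ has an injective resolution whose first $k$ terms are projective-injective. A $\Gamma$-module $T$ is $k$-tilting if $\operatorname{pdim}T\leq k$, $\operatorname{Ext}^i_\Gamma(T,T)=0$ for $i>0$, and there is an exact sequence $0\to\Gamma\to t_0\to\cdots\to t_k\to0$ with all $t_j\in\operatorname{add}T$. It is $P$-special, for $P$ projective, if $P\in\operatorname{add}T$ and there is such a sequence with $t_j\in\operatorname{add}P$ for $0\leq j\leq k-1$. Let $\Pi$ be the maximal projective-injective summand of $\Gamma$. The $k$-shifted module $T_k$ is the basic $\Pi$-special $k$-tilting module (unique up to isomorphism); it has $\Pi$ as a summand. Put $B_k=\operatorname{End}_\Gamma(T_k)^{\mathrm{op}}$ and let $e_k\in B_k$ be the idempotent given by projection onto $\Pi$. One has $e_kB_ke_k=\operatorname{End}_\Gamma(\Pi)^{\mathrm{op}}\cong A$. There is an isomorphism $B_k\cong\operatorname{End}_{\mathcal{K}^{\mathrm{b}}(A)}(E_k)^{\mathrm{op}}$ under which $e_k$ corresponds to projection onto the summand $DA[-k]$. The paper treats this as an identification, together with $e_kB_ke_k=\operatorname{End}_{\mathcal{K}^{\mathrm{b}}(A)}(DA[-k])^{\mathrm{op}}\cong A$. Under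 it, the $B_k$-action on the kernel in the claim is induced by the degree $k$ components of endomorphisms of $E_k$ (dual to postcomposition). Intermediate extension: for an algebra $B$ with idempotent $e$ and $A=eBe$, let $\ell=Be\otimes_A-$ and $r=\operatorname{Hom}_A(eB,-)$, the left and right adjoints of $N\mapsto eN$. Let $\zeta_M:\ell M\to rM$ be the canonical map corresponding to $\mathrm{id}_M$ under $\operatorname{Hom}_B(\ell M,rM)\cong\operatorname{Hom}_A(M,M)$, i.e. $be\otimes m\mapsto(eb'\mapsto eb'be\cdot m)$. Then $c(M)=\operatorname{im}\zeta_M$. The functor $c_k$ is $c$ for $(B,e)=(B_k,e_k)$. *)

theory Defs
  imports "HOL-Algebra.Module" "HOL-Algebra.QuotRing" "HOL-Algebra.Generated_Groups"
    "HOL-Algebra.Free_Abelian_Groups"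
begin

section \<open>Modules over a (not necessarily commutative) ring\<close>

text \<open>
  The record of modules of the library is used both for modules over rings and for algebras;
  an algebra over a field is a ring together with a scalar multiplication. The ring operations
  of a record that is only used as a module are irrelevant. The locale of modules of the library
  is restricted to commutative rings, so it only serves for vector spaces over the ground field.
  Submodules are represented by their carriers, and homomorphisms are extensional functions, so
  that sets of homomorphisms have the right elements.
\<close>

definition module_record ::
  "'m set \<Rightarrow> 'm \<Rightarrow> ('m \<Rightarrow> 'm \<Rightarrow> 'm) \<Rightarrow> ('r \<Rightarrow> 'm \<Rightarrow> 'm) \<Rightarrow> ('r, 'm) module" where
  "module_record S z pl sm =
     \<lparr>carrier = S, monoid.mult = undefined, one = undefined, ring.zero = z, add = pl, smult = sm\<rparr>"

locale left_module = R?: ring R + M?: abelian_group M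
  for R :: "('r, 'p) ring_scheme" (structure) and M :: "('r, 'm, 'q) module_scheme" (structure) +
  assumes smult_closed: "\<lbrakk>a \<in> carrier R; x \<in> carrier M\<rbrakk> \<Longrightarrow> a \<odot>\<^bsub>M\<^esub> x \<in> carrier M"
    and smult_l_distr: "\<lbrakk>a \<in> carrier R; b \<in> carrier R; x \<in> carrier M\<rbrakk> \<Longrightarrow>
      (a \<oplus> b) \<odot>\<^bsub>M\<^esub> x = a \<odot>\<^bsub>M\<^esub> x \<oplus>\<^bsub>M\<^esub> b \<odot>\<^bsub>M\<^esub> x"
    and smult_r_distr: "\<lbrakk>a \<in> carrier R; x \<in> carrier M; y \<in> carrier M\<rbrakk> \<Longrightarrow>
      a \<odot>\<^bsub>M\<^esub> (x \<oplus>\<^bsub>M\<^esub> y) = a \<odot>\<^bsub>M\<^esub> x \<oplus>\<^bsub>M\<^esub> a \<odot>\<^bsub>M\<^esub> y"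
    and smult_assoc: "\<lbrakk>a \<in> carrier R; b \<in> carrier R; x \<in> carrier M\<rbrakk> \<Longrightarrow>
      (a \<otimes> b) \<odot>\<^bsub>M\<^esub> x = a \<odot>\<^bsub>M\<^esub> (b \<odot>\<^bsub>M\<^esub> x)"
    and smult_one: "x \<in> carrier M \<Longrightarrow> \<one> \<odot>\<^bsub>M\<^esub> x = x"

definition finitely_generated ::
  "('r, 'p) ring_scheme \<Rightarrow> ('r, 'm, 'q) module_scheme \<Rightarrow> bool" where
  "finitely_generated R M \<longleftrightarrow>
     (\<exists>S. finite S \<and> S \<subseteq> carrier M \<and>
       (\<forall>x\<in>carrier M. \<exists>a\<in>S \<rightarrow> carrier R. x = (\<Oplus>\<^bsub>M\<^esub>s\<in>S. a s \<odot>\<^bsub>M\<^esub> s)))"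

definition fg_module :: "('r, 'p) ring_scheme \<Rightarrow> ('r, 'm, 'q) module_scheme \<Rightarrow> bool" where
  "fg_module R M \<longleftrightarrow> left_module R M \<and> finitely_generated R M"

definition mhom :: "('r, 'p) ring_scheme \<Rightarrow> ('r, 'm, 'q) module_scheme \<Rightarrow>
    ('r, 'n, 's) module_scheme \<Rightarrow> ('m \<Rightarrow> 'n) set" where
  "mhom R M N = {f \<in> carrier M \<rightarrow>\<^sub>E carrier N.
     (\<forall>x\<in>carrier M. \<forall>y\<in>carrier M. f (x \<oplus>\<^bsub>M\<^esub> y) = f x \<oplus>\<^bsub>N\<^esub> f y) \<and>
     (\<forall>r\<in>carrier R. \<forall>x\<in>carrier M. f (r \<odot>\<^bsub>M\<^esub> x) = r \<odot>\<^bsub>N\<^esub> f x)}"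

definition mod_iso :: "('r, 'p) ring_scheme \<Rightarrow> ('r, 'm, 'q) module_scheme \<Rightarrow>
    ('r, 'n, 's) module_scheme \<Rightarrow> bool" where
  "mod_iso R M N \<longleftrightarrow> (\<exists>f\<in>mhom R M N. bij_betw f (carrier M) (carrier N))"

definition zero_map :: "('r, 'm, 'q) module_scheme \<Rightarrow> ('r, 'n, 's) module_scheme \<Rightarrow> 'm \<Rightarrow> 'n" where
  "zero_map M N = (\<lambda>x\<in>carrier M. \<zero>\<^bsub>N\<^esub>)"

definition regular :: "('r, 'p) ring_scheme \<Rightarrow> ('r, 'r) module" where
  "regular R = module_record (carrier R) \<zero>\<^bsub>R\<^esub> (add R) (monoid.mult R)"

definition zero_module :: "('r, 'm) module \<Rightarrow> ('r, 'm) module" where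
  "zero_module M = M\<lparr>carrier := {\<zero>\<^bsub>M\<^esub>}\<rparr>"

definition direct_sum :: "('r, 'm) module \<Rightarrow> ('r, 'n) module \<Rightarrow> ('r, 'm \<times> 'n) module" where
  "direct_sum M N = module_record (carrier M \<times> carrier N) (\<zero>\<^bsub>M\<^esub>, \<zero>\<^bsub>N\<^esub>)
     (\<lambda>p q. (fst p \<oplus>\<^bsub>M\<^esub> fst q, snd p \<oplus>\<^bsub>N\<^esub> snd q))
     (\<lambda>r p. (r \<odot>\<^bsub>M\<^esub> fst p, r \<odot>\<^bsub>N\<^esub> snd p))"

definition module_power :: "nat \<Rightarrow> ('r, 'm) module \<Rightarrow> ('r, nat \<Rightarrow> 'm) module" where
  "module_power n M = module_record ({..<n} \<rightarrow>\<^sub>E carrier M) (\<lambda>i\<in>{..<n}. \<zero>\<^bsub>M\<^esub>)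
     (\<lambda>x y. \<lambda>i\<in>{..<n}. x i \<oplus>\<^bsub>M\<^esub> y i) (\<lambda>r x. \<lambda>i\<in>{..<n}. r \<odot>\<^bsub>M\<^esub> x i)"

definition restrict_scalars :: "('s \<Rightarrow> 'r) \<Rightarrow> ('r, 'm) module \<Rightarrow> ('s, 'm) module" where
  "restrict_scalars \<sigma> M = module_record (carrier M) \<zero>\<^bsub>M\<^esub> (add M) (\<lambda>s. smult M (\<sigma> s))"

definition internal_sum :: "('r, 'p) ring_scheme \<Rightarrow> ('r, 'm) module \<Rightarrow> 'm set \<Rightarrow> 'm set \<Rightarrow> bool" where
  "internal_sum R M U V \<longleftrightarrow> submodule U R M \<and> submodule V R M \<and>
     U \<inter> V = {\<zero>\<^bsub>M\<^esub>} \<and> U <+>\<^bsub>M\<^esub> V = carrier M"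

definition summand_projection :: "('r, 'm) module \<Rightarrow> 'm set \<Rightarrow> 'm set \<Rightarrow> 'm \<Rightarrow> 'm" where
  "summand_projection M U V = (\<lambda>x\<in>carrier M. THE u. u \<in> U \<and> (\<exists>v\<in>V. x = u \<oplus>\<^bsub>M\<^esub> v))"

definition in_add :: "('r, 'p) ring_scheme \<Rightarrow> ('r, 'n) module \<Rightarrow> ('r, 'm) module \<Rightarrow> bool" where
  "in_add R N M \<longleftrightarrow> (\<exists>n U V. internal_sum R (module_power n M) U V \<and>
     mod_iso R N ((module_power n M)\<lparr>carrier := U\<rparr>))"

definition indecomposable :: "('r, 'p) ring_scheme \<Rightarrow> ('r, 'm) module \<Rightarrow> bool" where
  "indecomposable R M \<longleftrightarrow> carrier M \<noteq> {\<zero>\<^bsub>M\<^esub>} \<and>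
     (\<forall>U V. internal_sum R M U V \<longrightarrow> U = {\<zero>\<^bsub>M\<^esub>} \<or> V = {\<zero>\<^bsub>M\<^esub>})"

text \<open>A module is basic if it is a finite direct sum of pairwise non-isomorphic indecomposable
  submodules; an algebra is basic if its regular module is.\<close>

definition basic_module :: "('r, 'p) ring_scheme \<Rightarrow> ('r, 'm) module \<Rightarrow> bool" where
  "basic_module R M \<longleftrightarrow> (\<exists>(n::nat) N.
     (\<forall>i<n. submodule (N i) R M \<and> indecomposable R (M\<lparr>carrier := N i\<rparr>)) \<and>
     (\<forall>i<n. \<forall>j<n. i \<noteq> j \<longrightarrow> \<not> mod_iso R (M\<lparr>carrier := N i\<rparr>) (M\<lparr>carrier := N j\<rparr>)) \<and>
     (\<forall>x\<in>carrier M. \<exists>!f. f \<in> (\<Pi>\<^sub>E i\<in>{..<n}. N i) \<and> x = (\<Oplus>\<^bsub>M\<^esub>i\<in>{..<n}. f i)))"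

definition essential :: "('r, 'p) ring_scheme \<Rightarrow> 'm set \<Rightarrow> ('r, 'm) module \<Rightarrow> bool" where
  "essential R U M \<longleftrightarrow> (\<forall>V. submodule V R M \<and> V \<noteq> {\<zero>\<^bsub>M\<^esub>} \<longrightarrow> U \<inter> V \<noteq> {\<zero>\<^bsub>M\<^esub>})"


section \<open>Finite-dimensional algebras\<close>

definition fd_algebra :: "'k ring \<Rightarrow> ('k, 'a) module \<Rightarrow> bool" where
  "fd_algebra K A \<longleftrightarrow> field K \<and> ring A \<and> module K A \<and> finitely_generated K A \<and>
     (\<forall>c\<in>carrier K. \<forall>x\<in>carrier A. \<forall>y\<in>carrier A.
        (c \<odot>\<^bsub>A\<^esub> x) \<otimes>\<^bsub>A\<^esub> y = c \<odot>\<^bsub>A\<^esub> (x \<otimes>\<^bsub>A\<^esub> y) \<and>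
        x \<otimes>\<^bsub>A\<^esub> (c \<odot>\<^bsub>A\<^esub> y) = c \<odot>\<^bsub>A\<^esub> (x \<otimes>\<^bsub>A\<^esub> y))"

definition algebra_isos :: "'k ring \<Rightarrow> ('k, 'a) module \<Rightarrow> ('k, 'b) module \<Rightarrow> ('a \<Rightarrow> 'b) set" where
  "algebra_isos K A B = {f \<in> ring_iso A B.
     \<forall>c\<in>carrier K. \<forall>x\<in>carrier A. f (c \<odot>\<^bsub>A\<^esub> x) = c \<odot>\<^bsub>B\<^esub> f x}"

definition opposite :: "('k, 'a) module \<Rightarrow> ('k, 'a) module" where
  "opposite A = A\<lparr>monoid.mult := \<lambda>x y. y \<otimes>\<^bsub>A\<^esub> x\<rparr>"

text \<open>Here \<open>A\<close> is an algebra, and its scalars act on modules through the multiples of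
  the unit.\<close>

definition hom_space :: "('k, 'a) module \<Rightarrow> ('a, 'm) module \<Rightarrow> ('a, 'n) module \<Rightarrow>
    ('k, 'm \<Rightarrow> 'n) module" where
  "hom_space A M N = module_record (mhom A M N) (zero_map M N)
     (\<lambda>f g. \<lambda>x\<in>carrier M. f x \<oplus>\<^bsub>N\<^esub> g x)
     (\<lambda>c f. \<lambda>x\<in>carrier M. (c \<odot>\<^bsub>A\<^esub> \<one>\<^bsub>A\<^esub>) \<odot>\<^bsub>N\<^esub> f x)"

definition end_algebra :: "('k, 'a) module \<Rightarrow> ('a, 'm) module \<Rightarrow> ('k, 'm \<Rightarrow> 'm) module" where
  "end_algebra A M = (hom_space A M M)
     \<lparr>monoid.mult := \<lambda>f g. compose (carrier M) f g, one := \<lambda>x\<in>carrier M. x\<rparr>"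

definition dual_space :: "'k ring \<Rightarrow> ('k, 'v) module \<Rightarrow> ('k, 'v \<Rightarrow> 'k) module" where
  "dual_space K V = module_record (mhom K V (regular K)) (\<lambda>x\<in>carrier V. \<zero>\<^bsub>K\<^esub>)
     (\<lambda>f g. \<lambda>x\<in>carrier V. f x \<oplus>\<^bsub>K\<^esub> g x) (\<lambda>c f. \<lambda>x\<in>carrier V. c \<otimes>\<^bsub>K\<^esub> f x)"

definition dual_map :: "('k, 'v) module \<Rightarrow> ('v \<Rightarrow> 'w) \<Rightarrow> ('w \<Rightarrow> 'k) \<Rightarrow> 'v \<Rightarrow> 'k" where
  "dual_map V f \<xi> = compose (carrier V) \<xi> f"

text \<open>The left module \<open>DA\<close>, with \<open>(a \<xi>)(x) = \<xi>(x a)\<close>.\<close>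

definition dual_algebra :: "'k ring \<Rightarrow> ('k, 'a) module \<Rightarrow> ('a, 'a \<Rightarrow> 'k) module" where
  "dual_algebra K A = module_record (carrier (dual_space K A)) (ring.zero (dual_space K A))
     (add (dual_space K A)) (\<lambda>a \<xi>. \<lambda>x\<in>carrier A. \<xi> (x \<otimes>\<^bsub>A\<^esub> a))"

definition generating_cogenerating :: "'k ring \<Rightarrow> ('k, 'a) module \<Rightarrow> ('a, 'm) module \<Rightarrow> bool" where
  "generating_cogenerating K A E \<longleftrightarrow> in_add A (regular A) E \<and> in_add A (dual_algebra K A) E"


section \<open>Homological notions\<close>

text \<open>
  Every finitely generated module over a finite-dimensional algebra over a field with element
  type \<open>'k\<close> is isomorphic to one whose carrier is contained in \<open>nat \<Rightarrow> 'k\<close>. Quantifiers over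
  finitely generated modules inside definitions therefore range over this type. All modules,
  including projective and injective ones, are understood to be finitely generated.
\<close>

definition projective :: "('k, 'a) module \<Rightarrow> ('a, 'm) module \<Rightarrow> bool" where
  "projective A P \<longleftrightarrow> fg_module A P \<and>
     (\<forall>(X :: ('a, nat \<Rightarrow> 'k) module) (Y :: ('a, nat \<Rightarrow> 'k) module) g f.
        fg_module A X \<and> fg_module A Y \<and> g \<in> mhom A X Y \<and> g ` carrier X = carrier Y \<and>
        f \<in> mhom A P Y \<longrightarrow> (\<exists>h\<in>mhom A P X. compose (carrier P) g h = f))"

definition injective :: "('k, 'a) module \<Rightarrow> ('a, 'm) module \<Rightarrow> bool" where
  "injective A I \<longleftrightarrow> fg_module A I \<and>
     (\<forall>(X :: ('a, nat \<Rightarrow> 'k) module) (Y :: ('a, nat \<Rightarrow> 'k) module) g f.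
        fg_module A X \<and> fg_module A Y \<and> g \<in> mhom A X Y \<and> inj_on g (carrier X) \<and>
        f \<in> mhom A X I \<longrightarrow> (\<exists>h\<in>mhom A Y I. compose (carrier X) h g = f))"

text \<open>Exact sequences \<open>0 \<rightarrow> X \<rightarrow> I 0 \<rightarrow> I 1 \<rightarrow> \<dots>\<close> and \<open>\<dots> \<rightarrow> P 1 \<rightarrow> P 0 \<rightarrow> X \<rightarrow> 0\<close>; finite sequences
  are those that are eventually zero.\<close>

definition coresolution :: "('k, 'a) module \<Rightarrow> ('a, 'm) module \<Rightarrow> (nat \<Rightarrow> ('a, 'n) module) \<Rightarrow>
    ('m \<Rightarrow> 'n) \<Rightarrow> (nat \<Rightarrow> 'n \<Rightarrow> 'n) \<Rightarrow> bool" where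
  "coresolution A X I \<eta> d \<longleftrightarrow> (\<forall>i. fg_module A (I i)) \<and>
     \<eta> \<in> mhom A X (I 0) \<and> inj_on \<eta> (carrier X) \<and>
     (\<forall>i. d i \<in> mhom A (I i) (I (Suc i))) \<and>
     \<eta> ` carrier X = a_kernel (I 0) (I 1) (d 0) \<and>
     (\<forall>i. d i ` carrier (I i) = a_kernel (I (Suc i)) (I (Suc (Suc i))) (d (Suc i)))"

definition resolution :: "('k, 'a) module \<Rightarrow> ('a, 'm) module \<Rightarrow> (nat \<Rightarrow> ('a, 'n) module) \<Rightarrow>
    ('n \<Rightarrow> 'm) \<Rightarrow> (nat \<Rightarrow> 'n \<Rightarrow> 'n) \<Rightarrow> bool" where
  "resolution A X P \<pi> d \<longleftrightarrow> (\<forall>i. fg_module A (P i)) \<and>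
     \<pi> \<in> mhom A (P 0) X \<and> \<pi> ` carrier (P 0) = carrier X \<and>
     (\<forall>i. d i \<in> mhom A (P (Suc i)) (P i)) \<and>
     d 0 ` carrier (P 1) = a_kernel (P 0) X \<pi> \<and>
     (\<forall>i. d (Suc i) ` carrier (P (Suc (Suc i))) = a_kernel (P (Suc i)) (P i) (d i))"

definition minimal_injective_resolution :: "('k, 'a) module \<Rightarrow> ('a, 'm) module \<Rightarrow>
    (nat \<Rightarrow> ('a, 'n) module) \<Rightarrow> ('m \<Rightarrow> 'n) \<Rightarrow> (nat \<Rightarrow> 'n \<Rightarrow> 'n) \<Rightarrow> bool" where
  "minimal_injective_resolution A X I \<eta> d \<longleftrightarrow>
     coresolution A X I \<eta> d \<and> (\<forall>i. injective A (I i)) \<and>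
     essential A (\<eta> ` carrier X) (I 0) \<and>
     (\<forall>i. essential A (d i ` carrier (I i)) (I (Suc i)))"

definition domdim_ge :: "('k, 'g) module \<Rightarrow> nat \<Rightarrow> bool" where
  "domdim_ge \<Gamma> k \<longleftrightarrow> (\<exists>(I :: nat \<Rightarrow> ('g, nat \<Rightarrow> 'k) module) \<eta> d.
     coresolution \<Gamma> (regular \<Gamma>) I \<eta> d \<and> (\<forall>i. injective \<Gamma> (I i)) \<and> (\<forall>i<k. projective \<Gamma> (I i)))"

definition pdim_le :: "('k, 'g) module \<Rightarrow> ('g, 'm) module \<Rightarrow> nat \<Rightarrow> bool" where
  "pdim_le \<Gamma> X k \<longleftrightarrow> (\<exists>(P :: nat \<Rightarrow> ('g, nat \<Rightarrow> 'k) module) \<pi> d.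
     resolution \<Gamma> X P \<pi> d \<and> (\<forall>i. projective \<Gamma> (P i)) \<and> (\<forall>i>k. carrier (P i) = {\<zero>\<^bsub>P i\<^esub>}))"

text \<open>Vanishing of \<open>Ext\<close> in degree \<open>i + 1\<close>: the cohomology of \<open>Hom(P\<^sub>\<bullet>, Y)\<close> vanishes there, for
  a projective resolution \<open>P\<^sub>\<bullet>\<close> of \<open>X\<close>.\<close>

definition Ext_Suc_zero ::
  "('k, 'g) module \<Rightarrow> nat \<Rightarrow> ('g, 'm) module \<Rightarrow> ('g, 'n) module \<Rightarrow> bool" where
  "Ext_Suc_zero \<Gamma> i X Y \<longleftrightarrow> (\<exists>(P :: nat \<Rightarrow> ('g, nat \<Rightarrow> 'k) module) \<pi> d.
     resolution \<Gamma> X P \<pi> d \<and> (\<forall>j. projective \<Gamma> (P j)) \<and>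
     (\<forall>f\<in>mhom \<Gamma> (P (Suc i)) Y.
        compose (carrier (P (Suc (Suc i)))) f (d (Suc i)) = zero_map (P (Suc (Suc i))) Y \<longrightarrow>
        (\<exists>g\<in>mhom \<Gamma> (P i) Y. f = compose (carrier (P (Suc i))) g (d i))))"

definition add_coresolution :: "('k, 'g) module \<Rightarrow> nat \<Rightarrow> ('g, 't) module \<Rightarrow>
    (nat \<Rightarrow> ('g, nat \<Rightarrow> 'k) module) \<Rightarrow> bool" where
  "add_coresolution \<Gamma> k T t \<longleftrightarrow> (\<exists>\<eta> d. coresolution \<Gamma> (regular \<Gamma>) t \<eta> d) \<and>
     (\<forall>j\<le>k. in_add \<Gamma> (t j) T) \<and> (\<forall>j>k. carrier (t j) = {\<zero>\<^bsub>t j\<^esub>})"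

definition tilting :: "('k, 'g) module \<Rightarrow> nat \<Rightarrow> ('g, 't) module \<Rightarrow> bool" where
  "tilting \<Gamma> k T \<longleftrightarrow> fg_module \<Gamma> T \<and> pdim_le \<Gamma> T k \<and> (\<forall>i. Ext_Suc_zero \<Gamma> i T T) \<and>
     (\<exists>t. add_coresolution \<Gamma> k T t)"

definition special_tilting ::
  "('k, 'g) module \<Rightarrow> nat \<Rightarrow> ('g, 'p) module \<Rightarrow> ('g, 't) module \<Rightarrow> bool" where
  "special_tilting \<Gamma> k P T \<longleftrightarrow> tilting \<Gamma> k T \<and> in_add \<Gamma> P T \<and>
     (\<exists>t. add_coresolution \<Gamma> k T t \<and> (\<forall>j<k. in_add \<Gamma> (t j) P))"

definition proj_inj_summand :: "('k, 'g) module \<Rightarrow> 'g set \<Rightarrow> bool" where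
  "proj_inj_summand \<Gamma> U \<longleftrightarrow> (\<exists>V. internal_sum \<Gamma> (regular \<Gamma>) U V) \<and>
     projective \<Gamma> ((regular \<Gamma>)\<lparr>carrier := U\<rparr>) \<and> injective \<Gamma> ((regular \<Gamma>)\<lparr>carrier := U\<rparr>)"

definition maximal_proj_inj_summand :: "('k, 'g) module \<Rightarrow> 'g set \<Rightarrow> bool" where
  "maximal_proj_inj_summand \<Gamma> U \<longleftrightarrow> proj_inj_summand \<Gamma> U \<and>
     (\<forall>U'. proj_inj_summand \<Gamma> U' \<and> U \<subseteq> U' \<longrightarrow> U' = U)"

text \<open>For \<open>W\<close> a maximal projective-injective summand of \<open>\<Gamma>\<close>: \<open>T\<close> is a \<open>k\<close>-shifted module,
  and \<open>T = U \<oplus> V\<close> exhibits \<open>W\<close>, up to isomorphism, as the summand \<open>U\<close> of it.\<close>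

definition shifted_module :: "('k, 'g) module \<Rightarrow> nat \<Rightarrow> 'g set \<Rightarrow> ('g, 't) module \<Rightarrow>
    't set \<Rightarrow> 't set \<Rightarrow> bool" where
  "shifted_module \<Gamma> k W T U V \<longleftrightarrow>
     basic_module \<Gamma> T \<and> special_tilting \<Gamma> k ((regular \<Gamma>)\<lparr>carrier := W\<rparr>) T \<and>
     internal_sum \<Gamma> T U V \<and>
     mod_iso \<Gamma> (T\<lparr>carrier := U\<rparr>) ((regular \<Gamma>)\<lparr>carrier := W\<rparr>)"


section \<open>Complexes and their endomorphisms in the homotopy category\<close>

record ('a, 'u) cochain_complex =
  cterm :: "int \<Rightarrow> ('a, 'u) module"
  cdiff :: "int \<Rightarrow> 'u \<Rightarrow> 'u"

definition stalk_complex :: "int \<Rightarrow> ('a, 'u) module \<Rightarrow> ('a, 'u) cochain_complex" where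
  "stalk_complex n N =
     (let X = (\<lambda>i. if i = n then N else zero_module N)
      in \<lparr>cterm = X, cdiff = \<lambda>i. zero_map (X i) (X (i + 1))\<rparr>)"

definition complex_sum :: "('a, 'u) cochain_complex \<Rightarrow> ('a, 'v) cochain_complex \<Rightarrow>
    ('a, 'u \<times> 'v) cochain_complex" where
  "complex_sum X Y =
     \<lparr>cterm = \<lambda>i. direct_sum (cterm X i) (cterm Y i),
      cdiff = \<lambda>i. \<lambda>p\<in>carrier (direct_sum (cterm X i) (cterm Y i)).
        (cdiff X i (fst p), cdiff Y i (snd p))\<rparr>"

definition chain_end_algebra :: "('k, 'a) module \<Rightarrow> ('a, 'u) cochain_complex \<Rightarrow>
    ('k, int \<Rightarrow> 'u \<Rightarrow> 'u) module" where
  "chain_end_algebra A X =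
     \<lparr>carrier = {f. \<forall>i. f i \<in> mhom A (cterm X i) (cterm X i) \<and>
        compose (carrier (cterm X i)) (cdiff X i) (f i) =
        compose (carrier (cterm X i)) (f (i + 1)) (cdiff X i)},
      monoid.mult = \<lambda>f g i. f i \<otimes>\<^bsub>end_algebra A (cterm X i)\<^esub> g i,
      one = \<lambda>i. \<one>\<^bsub>end_algebra A (cterm X i)\<^esub>,
      ring.zero = \<lambda>i. \<zero>\<^bsub>end_algebra A (cterm X i)\<^esub>,
      add = \<lambda>f g i. f i \<oplus>\<^bsub>end_algebra A (cterm X i)\<^esub> g i,
      smult = \<lambda>c f i. c \<odot>\<^bsub>end_algebra A (cterm X i)\<^esub> f i\<rparr>"

definition null_homotopic :: "('k, 'a) module \<Rightarrow> ('a, 'u) cochain_complex \<Rightarrow>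
    (int \<Rightarrow> 'u \<Rightarrow> 'u) set" where
  "null_homotopic A X = {f \<in> carrier (chain_end_algebra A X).
     \<exists>s. (\<forall>i. s i \<in> mhom A (cterm X i) (cterm X (i - 1))) \<and>
       (\<forall>i. f i = compose (carrier (cterm X i)) (cdiff X (i - 1)) (s i)
          \<oplus>\<^bsub>end_algebra A (cterm X i)\<^esub> compose (carrier (cterm X i)) (s (i + 1)) (cdiff X i))}"

definition homotopy_class :: "('k, 'a) module \<Rightarrow> ('a, 'u) cochain_complex \<Rightarrow>
    (int \<Rightarrow> 'u \<Rightarrow> 'u) \<Rightarrow> (int \<Rightarrow> 'u \<Rightarrow> 'u) set" where
  "homotopy_class A X f = null_homotopic A X +>\<^bsub>chain_end_algebra A X\<^esub> f"

definition kb_end_algebra :: "('k, 'a) module \<Rightarrow> ('a, 'u) cochain_complex \<Rightarrow>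
    ('k, (int \<Rightarrow> 'u \<Rightarrow> 'u) set) module" where
  "kb_end_algebra A X =
     (let Q = chain_end_algebra A X Quot null_homotopic A X in
      \<lparr>carrier = carrier Q, monoid.mult = monoid.mult Q, one = one Q, ring.zero = ring.zero Q, add = add Q,
       smult = \<lambda>c F. \<Union>f\<in>F. homotopy_class A X (c \<odot>\<^bsub>chain_end_algebra A X\<^esub> f)\<rparr>)"


section \<open>The intermediate extension\<close>

definition corner :: "('k, 'b) module \<Rightarrow> 'b \<Rightarrow> ('k, 'b) module" where
  "corner B e = B\<lparr>carrier := (\<lambda>b. e \<otimes>\<^bsub>B\<^esub> b \<otimes>\<^bsub>B\<^esub> e) ` carrier B, one := e\<rparr>"

definition left_ideal :: "('k, 'b) module \<Rightarrow> 'b \<Rightarrow> 'b set" where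
  "left_ideal B e = (\<lambda>b. b \<otimes>\<^bsub>B\<^esub> e) ` carrier B"

definition right_ideal_module :: "('k, 'b) module \<Rightarrow> 'b \<Rightarrow> ('b, 'b) module" where
  "right_ideal_module B e =
     module_record ((\<lambda>b. e \<otimes>\<^bsub>B\<^esub> b) ` carrier B) \<zero>\<^bsub>B\<^esub> (add B) (monoid.mult B)"

text \<open>The relations defining the tensor product \<open>P \<otimes>\<^sub>R M\<close>, where \<open>P\<close> is an additive subgroup of \<open>B\<close>
  on which elements of \<open>R\<close> act by right multiplication in \<open>B\<close>.\<close>

definition tensor_relations :: "('k, 'b) module \<Rightarrow> 'b set \<Rightarrow> ('k, 'b) module \<Rightarrow> ('b, 'm) module \<Rightarrow>
    ('b \<times> 'm \<Rightarrow>\<^sub>0 int) set" where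
  "tensor_relations B P R M = generate (free_Abelian_group (P \<times> carrier M))
     ({frag_of (p \<oplus>\<^bsub>B\<^esub> q, m) - frag_of (p, m) - frag_of (q, m) | p q m.
         p \<in> P \<and> q \<in> P \<and> m \<in> carrier M} \<union>
      {frag_of (p, m \<oplus>\<^bsub>M\<^esub> n) - frag_of (p, m) - frag_of (p, n) | p m n.
         p \<in> P \<and> m \<in> carrier M \<and> n \<in> carrier M} \<union>
      {frag_of (p \<otimes>\<^bsub>B\<^esub> r, m) - frag_of (p, r \<odot>\<^bsub>M\<^esub> m) | p r m.
         p \<in> P \<and> r \<in> carrier R \<and> m \<in> carrier M})"

definition pure_tensor :: "('k, 'b) module \<Rightarrow> 'b \<Rightarrow> ('b, 'm) module \<Rightarrow> 'b \<Rightarrow> 'm \<Rightarrow>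
    ('b \<times> 'm \<Rightarrow>\<^sub>0 int) set" where
  "pure_tensor B e M p m = tensor_relations B (left_ideal B e) (corner B e) M
     #>\<^bsub>free_Abelian_group (left_ideal B e \<times> carrier M)\<^esub> frag_of (p, m)"

text \<open>For a module \<open>M\<close> over \<open>eBe\<close>: the module \<open>\<ell> M = Be \<otimes> M\<close>, the module \<open>r M = Hom(eB, M)\<close>
  with \<open>(b f)(x) = f(x b)\<close>, the canonical map between them, and its image \<open>c(M)\<close>.\<close>

definition left_extension :: "('k, 'b) module \<Rightarrow> 'b \<Rightarrow> ('b, 'm) module \<Rightarrow>
    ('b, ('b \<times> 'm \<Rightarrow>\<^sub>0 int) set) module" where
  "left_extension B e M =
     (let F = free_Abelian_group (left_ideal B e \<times> carrier M);
          N = tensor_relations B (left_ideal B e) (corner B e) M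
      in module_record (carrier (F Mod N)) \<one>\<^bsub>F Mod N\<^esub> (monoid.mult (F Mod N))
           (\<lambda>b X. \<Union>x\<in>X. N #>\<^bsub>F\<^esub> frag_extend (\<lambda>(p, m). frag_of (b \<otimes>\<^bsub>B\<^esub> p, m)) x))"

definition right_extension :: "('k, 'b) module \<Rightarrow> 'b \<Rightarrow> ('b, 'm) module \<Rightarrow>
    ('b, 'b \<Rightarrow> 'm) module" where
  "right_extension B e M =
     (let I = right_ideal_module B e
      in module_record (mhom (corner B e) I M) (zero_map I M)
           (\<lambda>f g. \<lambda>x\<in>carrier I. f x \<oplus>\<^bsub>M\<^esub> g x) (\<lambda>b f. \<lambda>x\<in>carrier I. f (x \<otimes>\<^bsub>B\<^esub> b)))"

definition canonical_map :: "('k, 'b) module \<Rightarrow> 'b \<Rightarrow> ('b, 'm) module \<Rightarrow>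
    ('b \<times> 'm \<Rightarrow>\<^sub>0 int) set \<Rightarrow> 'b \<Rightarrow> 'm" where
  "canonical_map B e M = (THE z. z \<in> mhom B (left_extension B e M) (right_extension B e M) \<and>
     (\<forall>p\<in>left_ideal B e. \<forall>m\<in>carrier M.
        z (pure_tensor B e M p m) =
        (\<lambda>x\<in>carrier (right_ideal_module B e). (x \<otimes>\<^bsub>B\<^esub> p) \<odot>\<^bsub>M\<^esub> m)))"

definition intermediate_extension :: "('k, 'b) module \<Rightarrow> 'b \<Rightarrow> ('b, 'm) module \<Rightarrow>
    ('b, 'b \<Rightarrow> 'm) module" where
  "intermediate_extension B e M = (right_extension B e M)
     \<lparr>carrier := canonical_map B e M ` carrier (left_extension B e M)\<rparr>"


section \<open>The complex \<open>E\<^sub>k\<close> and the kernel module\<close>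

definition resolution_complex :: "nat \<Rightarrow> ('a, 'm) module \<Rightarrow> (nat \<Rightarrow> ('a, 'm) module) \<Rightarrow>
    ('m \<Rightarrow> 'm) \<Rightarrow> (nat \<Rightarrow> 'm \<Rightarrow> 'm) \<Rightarrow> ('a, 'm) cochain_complex" where
  "resolution_complex k E Q \<eta> d =
     (let X = (\<lambda>i. if i = 0 then E
                   else if 1 \<le> i \<and> i \<le> int k then Q (nat (i - 1)) else zero_module E)
      in \<lparr>cterm = X,
          cdiff = \<lambda>i. if i = 0 \<and> 0 < k then \<eta>
                      else if 1 \<le> i \<and> i < int k then d (nat (i - 1))
                      else zero_map (X i) (X (i + 1))\<rparr>)"

definition E_complex :: "'k ring \<Rightarrow> ('k, 'a) module \<Rightarrow> nat \<Rightarrow> ('a, 'm) module \<Rightarrow>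
    (nat \<Rightarrow> ('a, 'm) module) \<Rightarrow> ('m \<Rightarrow> 'm) \<Rightarrow> (nat \<Rightarrow> 'm \<Rightarrow> 'm) \<Rightarrow>
    ('a, 'm \<times> ('a \<Rightarrow> 'k)) cochain_complex" where
  "E_complex K A k E Q \<eta> d =
     complex_sum (resolution_complex k E Q \<eta> d) (stalk_complex (int k) (dual_algebra K A))"

definition kb_shifted_algebra where
  "kb_shifted_algebra K A k E Q \<eta> d = opposite (kb_end_algebra A (E_complex K A k E Q \<eta> d))"

text \<open>The class of the endomorphism of \<open>E\<^sub>k\<close> that is \<open>h\<close> on the summand \<open>DA[-k]\<close> and zero on the
  complementary summand. Outside degree \<open>k\<close> the second component only takes the value zero.\<close>

definition dual_summand_class where
  "dual_summand_class K A k E Q \<eta> d h =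
     homotopy_class A (E_complex K A k E Q \<eta> d)
       (\<lambda>i. \<lambda>p\<in>carrier (cterm (E_complex K A k E Q \<eta> d) i).
          (\<zero>\<^bsub>cterm (resolution_complex k E Q \<eta> d) i\<^esub>, h (snd p)))"

definition kb_shifted_idempotent where
  "kb_shifted_idempotent K A k E Q \<eta> d = dual_summand_class K A k E Q \<eta> d (\<lambda>y. y)"

text \<open>The identification of \<open>e\<^sub>k B\<^sub>k e\<^sub>k = End(DA[-k])\<^sup>o\<^sup>p\<close> with \<open>A\<close>, under which \<open>a\<close> corresponds to the
  endomorphism of \<open>DA\<close> given by right multiplication \<open>(\<xi> a)(x) = \<xi>(a x)\<close>.\<close>

definition corner_to_base where
  "corner_to_base K A k E Q \<eta> d = inv_into (carrier A)
     (\<lambda>a. dual_summand_class K A k E Q \<eta> d (\<lambda>\<xi>. \<lambda>x\<in>carrier A. \<xi> (a \<otimes>\<^bsub>A\<^esub> x)))"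

text \<open>The kernel of \<open>D Hom(M, X\<^sup>k) \<rightarrow> D Hom(M, im g)\<close>, where \<open>g\<close> is the differential of \<open>X\<close> from
  degree \<open>k - 1\<close> to degree \<open>k\<close>. A homotopy class of endomorphisms \<open>f\<close> of \<open>X\<close> acts by
  \<open>(f \<xi>)(h) = \<xi>(f\<^sup>k h)\<close>. On this kernel the action does not depend on the representative if
  \<open>X\<close> vanishes above degree \<open>k\<close>, as \<open>E\<^sub>k\<close> does; it makes the kernel a left module over the
  opposite of the endomorphism algebra.\<close>

definition dual_hom_kernel :: "'k ring \<Rightarrow> ('k, 'a) module \<Rightarrow> ('a, 'u) cochain_complex \<Rightarrow> int \<Rightarrow>
    ('a, 'n) module \<Rightarrow> ((int \<Rightarrow> 'u \<Rightarrow> 'u) set, ('n \<Rightarrow> 'u) \<Rightarrow> 'k) module" where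
  "dual_hom_kernel K A X k M =
     (let N = cterm X k;
          im = cdiff X (k - 1) ` carrier (cterm X (k - 1));
          H = hom_space A M N;
          H' = hom_space A M (N\<lparr>carrier := im\<rparr>);
          incl = (\<lambda>h. compose (carrier M) (\<lambda>x\<in>im. x) h)
      in module_record
           {\<xi> \<in> carrier (dual_space K H). dual_map H' incl \<xi> = \<zero>\<^bsub>dual_space K H'\<^esub>}
           \<zero>\<^bsub>dual_space K H\<^esub> (add (dual_space K H))
           (\<lambda>F \<xi>. \<lambda>h\<in>carrier H. \<xi> (compose (carrier M) ((SOME f. f \<in> F) k) h)))"

end

theory Submission
  imports Defs
begin

text \<open>
  A module \<open>P\<close> over a ring \<open>B\<close> with idempotent \<open>e\<close> is the intermediate extension of the
  \<open>eBe\<close>-module \<open>eP\<close> as soon as \<open>P\<close> is generated by \<open>eP\<close> and has no nonzero element killed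
  by \<open>eB\<close>. Let \<open>Y = I \<oplus> DA\<close> be the term of highest degree of \<open>E\<^sub>k\<close>, let \<open>U\<close> be the image
  of the differential in \<open>Y\<close>, and let \<open>P\<close> consist of the functionals on \<open>Hom(M, Y)\<close> that vanish on
  \<open>Hom(M, U)\<close>. An element \<open>m\<close> of \<open>M\<close> corresponds to the functional \<open>h \<mapsto> h\<^sub>2(m)(1)\<close>, where
  \<open>h\<^sub>2\<close> is the component of \<open>h\<close> in \<open>DA\<close>. Acting on it with the chain maps \<open>E\<^sub>k \<rightarrow> DA[-k]\<close>, which
  are the functionals \<open>\<omega>\<close> on \<open>Y/U\<close>, gives all functionals \<open>h \<mapsto> \<omega>(h(m))\<close>. Their
  common kernel is \<open>Hom(M, U)\<close>, so by finite-dimensional duality they span \<open>P\<close>. An element of \<open>P\<close>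
  that is killed by all chain maps \<open>DA[-k] \<rightarrow> E\<^sub>k\<close> vanishes on every map \<open>M \<rightarrow> Y\<close> that
  factors through \<open>DA\<close>; since \<open>Y\<close> is injective, these span \<open>Hom(M, Y)\<close>.
\<close>


section \<open>Modules and homomorphisms\<close>

text \<open>The criterion holds because sending \<open>n\<close> to the map \<open>x -> x n\<close>
  takes \<open>P\<close> to \<open>Hom(eB, eP)\<close>. This is injective when \<open>eB\<close>
  kills nothing, and it sends \<open>b m\<close>, for \<open>b\<close> in \<open>Be\<close> and
  \<open>m\<close> in \<open>eP\<close>, to the value of the canonical map on the pure tensor of
  \<open>b\<close> and \<open>m\<close>. So its image is the image of the canonical map, and the
  tensor product enters only through pure tensors.

  Degree \<open>k\<close> suffices because nothing lies above it: a null-homotopic endomorphism maps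
  \<open>Y\<close> into \<open>U\<close> there, which functionals vanishing on
  \<open>Hom(M, U)\<close> cannot detect, and every endomorphism of \<open>Y\<close> killing
  \<open>U\<close> extends by zero to a chain map. The stalk summand has zero differential, so
  \<open>U\<close> has zero component in \<open>DA\<close>. Hence maps out of \<open>DA\<close> kill
  \<open>U\<close>, and distinct endomorphisms of \<open>DA\<close> stay distinct up to homotopy.

  The algebra \<open>B\<close> is an opposite ring, so maps into \<open>DA[-k]\<close> give elements
  of \<open>Be\<close> and maps out of it give elements of \<open>eB\<close>.

  Finite-dimensional duality is obtained without bases, by writing the identity as a sum of rank one
  maps.\<close>

lemma module_record_simps [simp]:
  "carrier (module_record S z pl sm) = S"
  "ring.zero (module_record S z pl sm) = z"
  "add (module_record S z pl sm) = pl"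
  "smult (module_record S z pl sm) = sm"
  by (simp_all add: module_record_def)

lemma restrict_scalars_simps [simp]:
  "carrier (restrict_scalars \<sigma> M) = carrier M"
  "ring.zero (restrict_scalars \<sigma> M) = \<zero>\<^bsub>M\<^esub>"
  "add (restrict_scalars \<sigma> M) = add M"
  "smult (restrict_scalars \<sigma> M) = (\<lambda>s. smult M (\<sigma> s))"
  by (simp_all add: restrict_scalars_def)

lemma regular_simps [simp]:
  "carrier (regular R) = carrier R"
  "ring.zero (regular R) = \<zero>\<^bsub>R\<^esub>"
  "add (regular R) = add R"
  "smult (regular R) = monoid.mult R"
  by (simp_all add: regular_def)

text \<open>The same additive group occurs inside many records that differ in scalars and
  multiplication; this moves the group axioms between them.\<close>

lemma abelian_group_cong:
  assumes "abelian_group M" "carrier N = carrier M" "add N = add M" "\<zero>\<^bsub>N\<^esub> = \<zero>\<^bsub>M\<^esub>"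
  shows "abelian_group N"
proof -
  interpret abelian_group M by fact
  show ?thesis
    by (rule abelian_groupI) (use assms l_neg in \<open>auto simp: a_ac intro: a_inv_closed\<close>)
qed

lemma (in abelian_group) minus_eq_zero_iff:
  "x \<in> carrier G \<Longrightarrow> y \<in> carrier G \<Longrightarrow> x \<ominus> y = \<zero> \<longleftrightarrow> x = y"
  by (metis a_minus_def add.inv_solve_right l_zero r_neg zero_closed)

lemma (in abelian_group) minus_zero_right:
  "x \<in> carrier G \<Longrightarrow> x \<ominus> \<zero> = x"
  using minus_equality[of \<zero> \<zero>] by (simp add: a_minus_def)

lemma left_moduleI:
  fixes R (structure) and M (structure)
  assumes "ring R" "abelian_group M"
    and "\<And>a x. \<lbrakk>a \<in> carrier R; x \<in> carrier M\<rbrakk> \<Longrightarrow> a \<odot>\<^bsub>M\<^esub> x \<in> carrier M"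
    and "\<And>a b x. \<lbrakk>a \<in> carrier R; b \<in> carrier R; x \<in> carrier M\<rbrakk> \<Longrightarrow>
      (a \<oplus> b) \<odot>\<^bsub>M\<^esub> x = a \<odot>\<^bsub>M\<^esub> x \<oplus>\<^bsub>M\<^esub> b \<odot>\<^bsub>M\<^esub> x"
    and "\<And>a x y. \<lbrakk>a \<in> carrier R; x \<in> carrier M; y \<in> carrier M\<rbrakk> \<Longrightarrow>
      a \<odot>\<^bsub>M\<^esub> (x \<oplus>\<^bsub>M\<^esub> y) = a \<odot>\<^bsub>M\<^esub> x \<oplus>\<^bsub>M\<^esub> a \<odot>\<^bsub>M\<^esub> y"
    and "\<And>a b x. \<lbrakk>a \<in> carrier R; b \<in> carrier R; x \<in> carrier M\<rbrakk> \<Longrightarrow>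
      (a \<otimes> b) \<odot>\<^bsub>M\<^esub> x = a \<odot>\<^bsub>M\<^esub> (b \<odot>\<^bsub>M\<^esub> x)"
    and "\<And>x. x \<in> carrier M \<Longrightarrow> \<one> \<odot>\<^bsub>M\<^esub> x = x"
  shows "left_module R M"
  using assms by (simp add: left_module_def left_module_axioms_def)

context left_module
begin

lemma smult_l_null: "x \<in> carrier M \<Longrightarrow> \<zero> \<odot>\<^bsub>M\<^esub> x = \<zero>\<^bsub>M\<^esub>"
  by (metis M.add.l_cancel_one R.add.one_closed R.l_zero smult_closed smult_l_distr)

lemma smult_r_null: "a \<in> carrier R \<Longrightarrow> a \<odot>\<^bsub>M\<^esub> \<zero>\<^bsub>M\<^esub> = \<zero>\<^bsub>M\<^esub>"
  by (metis M.add.l_cancel_one M.l_zero M.zero_closed smult_closed smult_r_distr)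

lemma smult_r_minus:
  "a \<in> carrier R \<Longrightarrow> x \<in> carrier M \<Longrightarrow> a \<odot>\<^bsub>M\<^esub> (\<ominus>\<^bsub>M\<^esub> x) = \<ominus>\<^bsub>M\<^esub> (a \<odot>\<^bsub>M\<^esub> x)"
  by (metis M.add.inv_closed M.l_neg M.minus_equality smult_closed smult_r_distr smult_r_null)

lemma smult_l_minus:
  "a \<in> carrier R \<Longrightarrow> x \<in> carrier M \<Longrightarrow> (\<ominus> a) \<odot>\<^bsub>M\<^esub> x = \<ominus>\<^bsub>M\<^esub> (a \<odot>\<^bsub>M\<^esub> x)"
  by (metis M.minus_equality R.add.inv_closed R.l_neg smult_closed smult_l_distr smult_l_null)

text \<open>Closure under negation comes for free, since it is multiplication by the scalar
  \<open>\<ominus> \<one>\<close>.\<close>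

lemma submodule_I:
  assumes "H \<subseteq> carrier M" "\<zero>\<^bsub>M\<^esub> \<in> H"
    and "\<And>x y. \<lbrakk>x \<in> H; y \<in> H\<rbrakk> \<Longrightarrow> x \<oplus>\<^bsub>M\<^esub> y \<in> H"
    and "\<And>a x. \<lbrakk>a \<in> carrier R; x \<in> H\<rbrakk> \<Longrightarrow> a \<odot>\<^bsub>M\<^esub> x \<in> H"
  shows "submodule H R M"
proof -
  have "\<ominus>\<^bsub>M\<^esub> x \<in> H" if "x \<in> H" for x
    using assms(4)[of "\<ominus> \<one>" x] that assms(1)
    by (auto simp: smult_l_minus smult_one)
  then show ?thesis
    unfolding submodule_def subgroup_def submodule_axioms_def
    using assms by (auto simp: a_inv_def)
qed

lemma submodule_D:
  assumes "submodule H R M"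
  shows "H \<subseteq> carrier M" "\<zero>\<^bsub>M\<^esub> \<in> H"
    and "\<And>x y. \<lbrakk>x \<in> H; y \<in> H\<rbrakk> \<Longrightarrow> x \<oplus>\<^bsub>M\<^esub> y \<in> H"
    and "\<And>a x. \<lbrakk>a \<in> carrier R; x \<in> H\<rbrakk> \<Longrightarrow> a \<odot>\<^bsub>M\<^esub> x \<in> H"
    and "\<And>x. x \<in> H \<Longrightarrow> \<ominus>\<^bsub>M\<^esub> x \<in> H"
    and "\<And>x y. \<lbrakk>x \<in> H; y \<in> H\<rbrakk> \<Longrightarrow> x \<ominus>\<^bsub>M\<^esub> y \<in> H"
  using assms unfolding submodule_def subgroup_def submodule_axioms_def
  by (auto simp: a_inv_def a_minus_def)

lemma left_module_submodule:
  assumes "submodule H R M"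
  shows "left_module R (M\<lparr>carrier := H\<rparr>)"
proof (rule left_moduleI)
  note * = submodule_D[OF assms]
  show "abelian_group (M\<lparr>carrier := H\<rparr>)"
  proof (rule abelian_groupI)
    show "\<exists>y\<in>carrier (M\<lparr>carrier := H\<rparr>). y \<oplus>\<^bsub>M\<lparr>carrier := H\<rparr>\<^esub> x = \<zero>\<^bsub>M\<lparr>carrier := H\<rparr>\<^esub>"
      if "x \<in> carrier (M\<lparr>carrier := H\<rparr>)" for x
      using that * by (auto intro!: bexI[of _ "\<ominus>\<^bsub>M\<^esub> x"] simp: M.l_neg subset_iff)
  qed (use * in \<open>auto simp: M.a_assoc subset_iff intro: M.a_comm\<close>)
qed (use submodule_D[OF assms] in \<open>auto simp: smult_l_distr smult_r_distr smult_assoc smult_one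
  subset_iff intro: R.ring_axioms\<close>)

end

lemma left_module_restrict_scalars:
  assumes "left_module R M" "ring S" "\<sigma> \<in> ring_hom S R"
  shows "left_module S (restrict_scalars \<sigma> M)"
proof -
  interpret left_module R M by fact
  show ?thesis
  proof (rule left_moduleI)
    show "abelian_group (restrict_scalars \<sigma> M)"
      by (rule abelian_group_cong[of M]) (auto intro: M.abelian_group_axioms)
  qed (use assms(2) ring_hom_memE[OF assms(3)] in \<open>auto simp: smult_l_distr smult_r_distr
    smult_assoc smult_one smult_closed\<close>)
qed

lemma mhomI:
  assumes "f \<in> extensional (carrier M)"
    and "\<And>x. x \<in> carrier M \<Longrightarrow> f x \<in> carrier N"
    and "\<And>x y. x \<in> carrier M \<Longrightarrow> y \<in> carrier M \<Longrightarrow> f (x \<oplus>\<^bsub>M\<^esub> y) = f x \<oplus>\<^bsub>N\<^esub> f y"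
    and "\<And>r x. r \<in> carrier R \<Longrightarrow> x \<in> carrier M \<Longrightarrow> f (r \<odot>\<^bsub>M\<^esub> x) = r \<odot>\<^bsub>N\<^esub> f x"
  shows "f \<in> mhom R M N"
  using assms by (auto simp: mhom_def PiE_def)

lemma mhomD:
  assumes "f \<in> mhom R M N"
  shows "f \<in> extensional (carrier M)"
    and "\<And>x. x \<in> carrier M \<Longrightarrow> f x \<in> carrier N"
    and "\<And>x y. x \<in> carrier M \<Longrightarrow> y \<in> carrier M \<Longrightarrow> f (x \<oplus>\<^bsub>M\<^esub> y) = f x \<oplus>\<^bsub>N\<^esub> f y"
    and "\<And>r x. r \<in> carrier R \<Longrightarrow> x \<in> carrier M \<Longrightarrow> f (r \<odot>\<^bsub>M\<^esub> x) = r \<odot>\<^bsub>N\<^esub> f x"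
  using assms by (auto simp: mhom_def PiE_def)

lemma mhom_eqI:
  assumes "f \<in> mhom R M N" "g \<in> mhom R' M N'" "\<And>x. x \<in> carrier M \<Longrightarrow> f x = g x"
  shows "f = g"
  using assms mhomD(1) by (metis extensionalityI)

lemma mhom_hom:
  assumes "f \<in> mhom R M N" "left_module R M" "left_module R N"
  shows "f \<zero>\<^bsub>M\<^esub> = \<zero>\<^bsub>N\<^esub>" "\<And>x. x \<in> carrier M \<Longrightarrow> f (\<ominus>\<^bsub>M\<^esub> x) = \<ominus>\<^bsub>N\<^esub> f x"
    "\<And>x y. x \<in> carrier M \<Longrightarrow> y \<in> carrier M \<Longrightarrow> f (x \<ominus>\<^bsub>M\<^esub> y) = f x \<ominus>\<^bsub>N\<^esub> f y"
proof -
  interpret M: left_module R M by fact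
  interpret N: left_module R N by fact
  note f = mhomD[OF assms(1)]
  show z: "f \<zero>\<^bsub>M\<^esub> = \<zero>\<^bsub>N\<^esub>"
    by (metis M.M.zero_closed N.M.add.l_cancel_one M.M.l_zero f(2,3))
  show m: "f (\<ominus>\<^bsub>M\<^esub> x) = \<ominus>\<^bsub>N\<^esub> f x" if "x \<in> carrier M" for x
    by (metis M.M.add.inv_closed M.M.l_neg N.M.minus_equality f(2,3) z that)
  show "f (x \<ominus>\<^bsub>M\<^esub> y) = f x \<ominus>\<^bsub>N\<^esub> f y" if "x \<in> carrier M" "y \<in> carrier M" for x y
    using that by (simp add: a_minus_def f m)
qed

lemma mhom_compose:
  assumes "f \<in> mhom R M N" "g \<in> mhom R N P" "abelian_monoid M"
    "\<And>r x. \<lbrakk>r \<in> carrier R; x \<in> carrier M\<rbrakk> \<Longrightarrow> r \<odot>\<^bsub>M\<^esub> x \<in> carrier M"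
  shows "compose (carrier M) g f \<in> mhom R M P"
  by (rule mhomI)
    (use assms(4) mhomD[OF assms(1)] mhomD[OF assms(2)] abelian_monoid.a_closed[OF assms(3)]
      in \<open>auto simp: compose_def\<close>)

lemma mhom_comp:
  assumes "left_module R M" "f \<in> mhom R M N" "g \<in> mhom R N P"
  shows "compose (carrier M) g f \<in> mhom R M P"
proof -
  interpret left_module R M by fact
  show ?thesis
    by (rule mhom_compose[OF assms(2,3)]) (auto simp: smult_closed intro: M.abelian_monoid_axioms)
qed

lemma mhom_id:
  assumes "left_module R M"
  shows "(\<lambda>x\<in>carrier M. x) \<in> mhom R M M"
proof -
  interpret left_module R M by fact
  show ?thesis by (rule mhomI) (auto simp: smult_closed)
qed

lemma mhom_zero_map:
  assumes "left_module R M" "left_module R N"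
  shows "zero_map M N \<in> mhom R M N"
proof -
  interpret M: left_module R M by fact
  interpret N: left_module R N by fact
  show ?thesis
    by (rule mhomI) (auto simp: zero_map_def M.smult_closed N.smult_r_null)
qed

lemma mhom_add:
  assumes "left_module R M" "left_module R N" "f \<in> mhom R M N" "g \<in> mhom R M N"
  shows "(\<lambda>x\<in>carrier M. f x \<oplus>\<^bsub>N\<^esub> g x) \<in> mhom R M N"
proof -
  interpret M: left_module R M by fact
  interpret N: left_module R N by fact
  show ?thesis
    by (rule mhomI) (use mhomD[OF assms(3)] mhomD[OF assms(4)] in
      \<open>auto simp: M.smult_closed N.smult_r_distr N.M.a_ac\<close>)
qed

lemma mhom_minus:
  assumes "left_module R M" "left_module R N" "f \<in> mhom R M N"
  shows "(\<lambda>x\<in>carrier M. \<ominus>\<^bsub>N\<^esub> f x) \<in> mhom R M N"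
proof -
  interpret M: left_module R M by fact
  interpret N: left_module R N by fact
  show ?thesis
    by (rule mhomI) (use mhomD[OF assms(3)] in
      \<open>auto simp: M.smult_closed N.smult_r_minus N.M.minus_add N.M.a_comm\<close>)
qed

text \<open>One verification of the group axioms serves all function spaces below: dual spaces, Hom
  spaces, right extensions, coinduced modules and the kernel module.\<close>

lemma abelian_group_pointwise:
  assumes "abelian_group N" "carrier F \<subseteq> S \<rightarrow>\<^sub>E carrier N"
    and "\<zero>\<^bsub>F\<^esub> = (\<lambda>x\<in>S. \<zero>\<^bsub>N\<^esub>)"
    and add: "\<And>f g. \<lbrakk>f \<in> carrier F; g \<in> carrier F\<rbrakk> \<Longrightarrow> f \<oplus>\<^bsub>F\<^esub> g = (\<lambda>x\<in>S. f x \<oplus>\<^bsub>N\<^esub> g x)"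
    and cl: "\<And>f g. \<lbrakk>f \<in> carrier F; g \<in> carrier F\<rbrakk> \<Longrightarrow> f \<oplus>\<^bsub>F\<^esub> g \<in> carrier F"
    and "\<zero>\<^bsub>F\<^esub> \<in> carrier F"
    and neg: "\<And>f. f \<in> carrier F \<Longrightarrow> (\<lambda>x\<in>S. \<ominus>\<^bsub>N\<^esub> f x) \<in> carrier F"
  shows "abelian_group F"
proof -
  interpret N: abelian_group N by fact
  have v: "f x \<in> carrier N" if "f \<in> carrier F" "x \<in> S" for f x
    using assms(2) that by auto
  have e: "f = (\<lambda>x\<in>S. f x)" if "f \<in> carrier F" for f
    using assms(2) that by (auto simp: PiE_def extensional_restrict)
  show ?thesis
  proof (rule abelian_groupI)
    fix f g h assume fgh: "f \<in> carrier F" "g \<in> carrier F" "h \<in> carrier F"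
    show "(f \<oplus>\<^bsub>F\<^esub> g) \<oplus>\<^bsub>F\<^esub> h = f \<oplus>\<^bsub>F\<^esub> (g \<oplus>\<^bsub>F\<^esub> h)"
      using fgh cl[OF fgh(1,2)] cl[OF fgh(2,3)] add
      by (auto simp: v N.a_assoc intro!: restrict_ext)
  next
    fix f g assume fg: "f \<in> carrier F" "g \<in> carrier F"
    show "f \<oplus>\<^bsub>F\<^esub> g = g \<oplus>\<^bsub>F\<^esub> f"
      using fg add by (auto simp: v N.a_comm intro!: restrict_ext)
  next
    fix f assume f: "f \<in> carrier F"
    have "\<zero>\<^bsub>F\<^esub> \<oplus>\<^bsub>F\<^esub> f = (\<lambda>x\<in>S. f x)"
      using f add[OF assms(6) f] v by (auto simp: assms(3) intro!: restrict_ext)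
    then show "\<zero>\<^bsub>F\<^esub> \<oplus>\<^bsub>F\<^esub> f = f" using e[OF f] by simp
    show "\<exists>g\<in>carrier F. g \<oplus>\<^bsub>F\<^esub> f = \<zero>\<^bsub>F\<^esub>"
      by (rule bexI[OF _ neg[OF f]]) (use f add[OF neg[OF f] f] v in
          \<open>auto simp: assms(3) N.l_neg intro!: restrict_ext\<close>)
  qed (use assms in auto)
qed

lemma mod_iso_sym:
  assumes "left_module R N" "mod_iso R N M"
  shows "mod_iso R M N"
proof -
  interpret N: left_module R N by fact
  obtain f where f: "f \<in> mhom R N M" and b: "bij_betw f (carrier N) (carrier M)"
    using assms(2) by (auto simp: mod_iso_def)
  define g where "g = (\<lambda>y\<in>carrier M. inv_into (carrier N) f y)"
  have g: "g y \<in> carrier N" "f (g y) = y" if "y \<in> carrier M" for y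
    using b that by (auto simp: g_def bij_betw_def inv_into_into f_inv_into_f)
  have gf: "g (f x) = x" if "x \<in> carrier N" for x
    using b that mhomD(2)[OF f] by (auto simp: g_def bij_betw_def)
  have "g \<in> mhom R M N"
  proof (rule mhomI)
    show "g (x \<oplus>\<^bsub>M\<^esub> y) = g x \<oplus>\<^bsub>N\<^esub> g y" if "x \<in> carrier M" "y \<in> carrier M" for x y
      using gf[of "g x \<oplus>\<^bsub>N\<^esub> g y"] g that by (simp add: mhomD(3)[OF f])
    show "g (r \<odot>\<^bsub>M\<^esub> x) = r \<odot>\<^bsub>N\<^esub> g x" if "r \<in> carrier R" "x \<in> carrier M" for r x
      using gf[of "r \<odot>\<^bsub>N\<^esub> g x"] g that by (simp add: mhomD(4)[OF f] N.smult_closed)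
  qed (use g in \<open>auto simp: g_def\<close>)
  moreover have "bij_betw g (carrier M) (carrier N)"
    by (rule bij_betwI[of _ _ _ f]) (use g gf mhomD(2)[OF f] in auto)
  ultimately show ?thesis by (auto simp: mod_iso_def)
qed


section \<open>Finite-dimensional vector spaces\<close>

abbreviation functionals :: "'k ring \<Rightarrow> ('k, 'v) module \<Rightarrow> ('v \<Rightarrow> 'k) set" where
  "functionals K V \<equiv> mhom K V (regular K)"

lemma dual_space_simps [simp]:
  "carrier (dual_space K V) = functionals K V"
  "\<zero>\<^bsub>dual_space K V\<^esub> = (\<lambda>x\<in>carrier V. \<zero>\<^bsub>K\<^esub>)"
  "f \<oplus>\<^bsub>dual_space K V\<^esub> g = (\<lambda>x\<in>carrier V. f x \<oplus>\<^bsub>K\<^esub> g x)"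
  "c \<odot>\<^bsub>dual_space K V\<^esub> f = (\<lambda>x\<in>carrier V. c \<otimes>\<^bsub>K\<^esub> f x)"
  by (simp_all add: dual_space_def)

lemma left_module_regular:
  assumes "ring R" shows "left_module R (regular R)"
proof -
  interpret ring R by fact
  show ?thesis
  proof (rule left_moduleI)
    show "abelian_group (regular R)"
      by (rule abelian_group_cong[of R]) (auto intro: abelian_group_axioms)
  qed (auto simp: l_distr r_distr m_assoc intro: ring_axioms)
qed

lemma functionalI:
  assumes "f \<in> extensional (carrier V)" "\<And>x. x \<in> carrier V \<Longrightarrow> f x \<in> carrier K"
    and "\<And>x y. x \<in> carrier V \<Longrightarrow> y \<in> carrier V \<Longrightarrow> f (x \<oplus>\<^bsub>V\<^esub> y) = f x \<oplus>\<^bsub>K\<^esub> f y"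
    and "\<And>r x. r \<in> carrier K \<Longrightarrow> x \<in> carrier V \<Longrightarrow> f (r \<odot>\<^bsub>V\<^esub> x) = r \<otimes>\<^bsub>K\<^esub> f x"
  shows "f \<in> functionals K V"
  using assms by (intro mhomI) auto

lemma functionalD:
  assumes "f \<in> functionals K V"
  shows "f \<in> extensional (carrier V)" "\<And>x. x \<in> carrier V \<Longrightarrow> f x \<in> carrier K"
    and "\<And>x y. x \<in> carrier V \<Longrightarrow> y \<in> carrier V \<Longrightarrow> f (x \<oplus>\<^bsub>V\<^esub> y) = f x \<oplus>\<^bsub>K\<^esub> f y"
    and "\<And>r x. r \<in> carrier K \<Longrightarrow> x \<in> carrier V \<Longrightarrow> f (r \<odot>\<^bsub>V\<^esub> x) = r \<otimes>\<^bsub>K\<^esub> f x"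
  using mhomD[OF assms] by auto

lemma functional_hom:
  assumes "f \<in> functionals K V" "left_module K V"
  shows "f \<zero>\<^bsub>V\<^esub> = \<zero>\<^bsub>K\<^esub>" "\<And>x. x \<in> carrier V \<Longrightarrow> f (\<ominus>\<^bsub>V\<^esub> x) = \<ominus>\<^bsub>K\<^esub> f x"
    "\<And>x y. x \<in> carrier V \<Longrightarrow> y \<in> carrier V \<Longrightarrow> f (x \<ominus>\<^bsub>V\<^esub> y) = f x \<ominus>\<^bsub>K\<^esub> f y"
proof -
  interpret left_module K V by fact
  interpret K: left_module K "regular K"
    by (rule left_module_regular) (rule R.ring_axioms)
  note f = functionalD[OF assms(1)]
  show z: "f \<zero>\<^bsub>V\<^esub> = \<zero>\<^bsub>K\<^esub>"
    using mhom_hom(1)[OF assms K.left_module_axioms] by simp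
  show m: "f (\<ominus>\<^bsub>V\<^esub> x) = \<ominus>\<^bsub>K\<^esub> f x" if "x \<in> carrier V" for x
    by (metis M.add.inv_closed M.l_neg R.minus_equality f(2,3) z that)
  show "f (x \<ominus>\<^bsub>V\<^esub> y) = f x \<ominus>\<^bsub>K\<^esub> f y" if "x \<in> carrier V" "y \<in> carrier V" for x y
    using that by (simp add: a_minus_def f m)
qed

lemma left_module_dual_space:
  assumes "cring K" "left_module K V"
  shows "left_module K (dual_space K V)"
proof -
  interpret cring K by fact
  interpret V: left_module K V by fact
  have sm: "(\<lambda>x\<in>carrier V. c \<otimes>\<^bsub>K\<^esub> f x) \<in> functionals K V" if "f \<in> functionals K V" "c \<in> carrier K" for c f
    by (rule functionalI) (use functionalD[OF that(1)] that(2) in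
        \<open>auto simp: V.smult_closed r_distr m_lcomm\<close>)
  show ?thesis
  proof (rule left_moduleI)
    show "abelian_group (dual_space K V)"
    proof (rule abelian_group_pointwise[of K _ "carrier V"])
      fix f assume "f \<in> carrier (dual_space K V)"
      then show "(\<lambda>x\<in>carrier V. \<ominus>\<^bsub>K\<^esub> f x) \<in> carrier (dual_space K V)"
        using functionalD[of f] by (auto intro!: functionalI simp: V.smult_closed r_minus minus_add a_comm)
    next
      fix f g assume "f \<in> carrier (dual_space K V)" "g \<in> carrier (dual_space K V)"
      then show "f \<oplus>\<^bsub>dual_space K V\<^esub> g \<in> carrier (dual_space K V)"
        using functionalD[of f] functionalD[of g]
        by (auto intro!: functionalI simp: V.smult_closed r_distr a_ac)
    next
      show "carrier (dual_space K V) \<subseteq> carrier V \<rightarrow>\<^sub>E carrier K"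
        using functionalD(1,2) by (auto simp: PiE_def)
      show "\<zero>\<^bsub>dual_space K V\<^esub> \<in> carrier (dual_space K V)"
        by (auto intro!: functionalI simp: V.smult_closed)
    qed (auto intro: abelian_group_axioms)
  next
    fix f assume "f \<in> carrier (dual_space K V)"
    then show "\<one>\<^bsub>K\<^esub> \<odot>\<^bsub>dual_space K V\<^esub> f = f"
      using functionalD(1,2)[of f] by (auto intro!: extensionalityI[of _ "carrier V"])
  qed (auto simp: sm functionalD(2) l_distr r_distr m_assoc intro: ring_axioms intro!: restrict_ext)
qed

text \<open>Zorn's lemma gives a subspace \<open>W\<close> maximal among those that contain
  \<open>U\<close> and miss \<open>v\<close>. Maximality makes \<open>W\<close> a complement of the
  line through \<open>v\<close>, and the functional is the coefficient of \<open>v\<close> modulo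
  \<open>W\<close>.\<close>

lemma exists_functional:
  assumes "field K" "left_module K V" "submodule U K V" "v \<in> carrier V" "v \<notin> U"
  obtains c where "c \<in> functionals K V" "\<And>u. u \<in> U \<Longrightarrow> c u = \<zero>\<^bsub>K\<^esub>" "c v = \<one>\<^bsub>K\<^esub>"
proof -
  interpret K: field K by fact
  interpret V: left_module K V by fact
  define \<A> where "\<A> = {W. submodule W K V \<and> U \<subseteq> W \<and> v \<notin> W}"
  have "\<exists>W\<in>\<A>. \<forall>X\<in>\<A>. W \<subseteq> X \<longrightarrow> X = W"
  proof (rule subset_Zorn_nonempty)
    show "\<A> \<noteq> {}" using assms by (auto simp: \<A>_def)
  next
    fix \<C> assume ne: "\<C> \<noteq> {}" and ch: "subset.chain \<A> \<C>"
    have C: "submodule W K V" "U \<subseteq> W" "v \<notin> W" if "W \<in> \<C>" for W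
      using ch that by (auto simp: \<A>_def subset_chain_def)
    note D = V.submodule_D[OF C(1)]
    have "submodule (\<Union>\<C>) K V"
    proof (rule V.submodule_I)
      fix x y assume "x \<in> \<Union>\<C>" "y \<in> \<Union>\<C>"
      then obtain W W' where W: "W \<in> \<C>" "W' \<in> \<C>" "x \<in> W" "y \<in> W'" by auto
      then have "W \<subseteq> W' \<or> W' \<subseteq> W" using ch by (auto simp: subset_chain_def)
      then show "x \<oplus>\<^bsub>V\<^esub> y \<in> \<Union>\<C>" using W D(3) by blast
    next
      show "\<Union>\<C> \<subseteq> carrier V" using D(1) by (auto simp: subset_iff)
      obtain W where "W \<in> \<C>" using ne by auto
      then show "\<zero>\<^bsub>V\<^esub> \<in> \<Union>\<C>" using D(2) by auto
    next
      fix a x assume "a \<in> carrier K" "x \<in> \<Union>\<C>"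
      then show "a \<odot>\<^bsub>V\<^esub> x \<in> \<Union>\<C>" using D(4) by auto
    qed
    moreover have "U \<subseteq> \<Union>\<C>" using ne C(2) by blast
    ultimately show "\<Union>\<C> \<in> \<A>" using C(3) by (auto simp: \<A>_def)
  qed
  then obtain W where W: "submodule W K V" "U \<subseteq> W" "v \<notin> W"
    and max: "\<And>X. submodule X K V \<Longrightarrow> U \<subseteq> X \<Longrightarrow> v \<notin> X \<Longrightarrow> W \<subseteq> X \<Longrightarrow> X = W"
    by (auto simp: \<A>_def)
  note D = V.submodule_D[OF W(1)]
  note [simp] = V.smult_closed
  have ex: "\<exists>a. a \<in> carrier K \<and> x \<ominus>\<^bsub>V\<^esub> a \<odot>\<^bsub>V\<^esub> v \<in> W" if x: "x \<in> carrier V" for x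
  proof (cases "x \<in> W")
    case True
    then show ?thesis
      using x by (auto intro!: exI[of _ "\<zero>\<^bsub>K\<^esub>"] simp: V.smult_l_null assms V.M.minus_zero_right)
  next
    case False
    \<comment> \<open>Enlarging \<open>W\<close> by \<open>x\<close> must capture \<open>v\<close>,
      so \<open>v = w + b x\<close> with \<open>w\<close> in \<open>W\<close>. Here \<open>b\<close>
      is invertible, as otherwise \<open>v\<close> would lie in \<open>W\<close>; solving for
      \<open>x\<close> gives its coefficient along \<open>v\<close>.\<close>
    define X where "X = {w \<oplus>\<^bsub>V\<^esub> b \<odot>\<^bsub>V\<^esub> x | w b. w \<in> W \<and> b \<in> carrier K}"
    have "submodule X K V"
    proof (rule V.submodule_I)
      show "X \<subseteq> carrier V" using D(1) x by (auto simp: X_def)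
      show "\<zero>\<^bsub>V\<^esub> \<in> X" using D(2) x unfolding X_def
        by (auto intro!: exI[of _ "\<zero>\<^bsub>V\<^esub>"] exI[of _ "\<zero>\<^bsub>K\<^esub>"] simp: V.smult_l_null)
    next
      fix p q assume "p \<in> X" "q \<in> X"
      then obtain w b w' b' where p: "p = w \<oplus>\<^bsub>V\<^esub> b \<odot>\<^bsub>V\<^esub> x" "w \<in> W" "b \<in> carrier K"
        and q: "q = w' \<oplus>\<^bsub>V\<^esub> b' \<odot>\<^bsub>V\<^esub> x" "w' \<in> W" "b' \<in> carrier K" by (auto simp: X_def)
      have "p \<oplus>\<^bsub>V\<^esub> q = (w \<oplus>\<^bsub>V\<^esub> w') \<oplus>\<^bsub>V\<^esub> (b \<oplus>\<^bsub>K\<^esub> b') \<odot>\<^bsub>V\<^esub> x"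
        using p q D(1) x by (auto simp: V.smult_l_distr V.M.a_ac subset_iff)
      then show "p \<oplus>\<^bsub>V\<^esub> q \<in> X" using p q D(3) by (auto simp: X_def)
    next
      fix a p assume a: "a \<in> carrier K" and "p \<in> X"
      then obtain w b where p: "p = w \<oplus>\<^bsub>V\<^esub> b \<odot>\<^bsub>V\<^esub> x" "w \<in> W" "b \<in> carrier K"
        by (auto simp: X_def)
      have "a \<odot>\<^bsub>V\<^esub> p = a \<odot>\<^bsub>V\<^esub> w \<oplus>\<^bsub>V\<^esub> (a \<otimes>\<^bsub>K\<^esub> b) \<odot>\<^bsub>V\<^esub> x"
        using p D(1) x a by (auto simp: V.smult_r_distr V.smult_assoc subset_iff)
      then show "a \<odot>\<^bsub>V\<^esub> p \<in> X" using p a D(4) by (auto simp: X_def)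
    qed
    moreover have "W \<subseteq> X"
    proof
      fix w assume "w \<in> W"
      then show "w \<in> X" using D(1) x unfolding X_def
        by (auto intro!: exI[of _ w] exI[of _ "\<zero>\<^bsub>K\<^esub>"] simp: V.smult_l_null)
    qed
    moreover have "x \<in> X" using D(2) x unfolding X_def
      by (auto intro!: exI[of _ "\<zero>\<^bsub>V\<^esub>"] exI[of _ "\<one>\<^bsub>K\<^esub>"] simp: V.smult_one)
    ultimately have "v \<in> X" using max[of X] False W(2) by auto
    then obtain w b where w: "v = w \<oplus>\<^bsub>V\<^esub> b \<odot>\<^bsub>V\<^esub> x" "w \<in> W" "b \<in> carrier K"
      by (auto simp: X_def)
    have wV: "w \<in> carrier V" using D(1) w by auto
    have "b \<noteq> \<zero>\<^bsub>K\<^esub>" using w W(3) wV x by (auto simp: V.smult_l_null)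
    then have u: "b \<in> Units K" using w K.field_Units by auto
    define a where "a = inv\<^bsub>K\<^esub> b"
    have a: "a \<in> carrier K" "a \<otimes>\<^bsub>K\<^esub> b = \<one>\<^bsub>K\<^esub>" using u by (auto simp: a_def)
    have "a \<odot>\<^bsub>V\<^esub> v = x \<oplus>\<^bsub>V\<^esub> a \<odot>\<^bsub>V\<^esub> w"
      using w wV x a by (auto simp: V.M.a_comm V.smult_r_distr V.smult_one simp flip: V.smult_assoc)
    then have "x \<ominus>\<^bsub>V\<^esub> a \<odot>\<^bsub>V\<^esub> v = \<ominus>\<^bsub>V\<^esub> (a \<odot>\<^bsub>V\<^esub> w)"
      using a wV x by (simp add: a_minus_def V.M.minus_add V.M.r_neg2)
    then show ?thesis using a w D(4,5) by auto
  qed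
  have uniq: "a = b" if "a \<in> carrier K" "b \<in> carrier K" "x \<in> carrier V"
    "x \<ominus>\<^bsub>V\<^esub> a \<odot>\<^bsub>V\<^esub> v \<in> W" "x \<ominus>\<^bsub>V\<^esub> b \<odot>\<^bsub>V\<^esub> v \<in> W" for a b x
  proof (rule ccontr)
    assume ne: "a \<noteq> b"
    \<comment> \<open>Two different coefficients would put a nonzero multiple of \<open>v\<close>,
      and hence \<open>v\<close> itself, into \<open>W\<close>.\<close>
    have "(x \<ominus>\<^bsub>V\<^esub> b \<odot>\<^bsub>V\<^esub> v) \<ominus>\<^bsub>V\<^esub> (x \<ominus>\<^bsub>V\<^esub> a \<odot>\<^bsub>V\<^esub> v) = (a \<ominus>\<^bsub>K\<^esub> b) \<odot>\<^bsub>V\<^esub> v"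
      using that assms by (simp add: a_minus_def V.M.minus_add V.smult_l_distr V.smult_l_minus
          V.M.a_ac V.M.r_neg V.M.r_neg1 V.M.r_neg2)
    then have 1: "(a \<ominus>\<^bsub>K\<^esub> b) \<odot>\<^bsub>V\<^esub> v \<in> W" using D(6)[OF that(5,4)] by simp
    have "a \<ominus>\<^bsub>K\<^esub> b \<noteq> \<zero>\<^bsub>K\<^esub>" using ne that by (simp add: K.minus_eq_zero_iff)
    then have u: "a \<ominus>\<^bsub>K\<^esub> b \<in> Units K" using that K.field_Units by auto
    have "inv\<^bsub>K\<^esub> (a \<ominus>\<^bsub>K\<^esub> b) \<odot>\<^bsub>V\<^esub> ((a \<ominus>\<^bsub>K\<^esub> b) \<odot>\<^bsub>V\<^esub> v) = v"
      using u that assms by (simp add: V.smult_one flip: V.smult_assoc)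
    then show False using D(4)[OF K.Units_inv_closed[OF u] 1] W(3) by simp
  qed
  define c where "c = (\<lambda>x\<in>carrier V. SOME a. a \<in> carrier K \<and> x \<ominus>\<^bsub>V\<^esub> a \<odot>\<^bsub>V\<^esub> v \<in> W)"
  have c: "c x \<in> carrier K" "x \<ominus>\<^bsub>V\<^esub> c x \<odot>\<^bsub>V\<^esub> v \<in> W" if "x \<in> carrier V" for x
    using someI_ex[OF ex[OF that]] that by (auto simp: c_def)
  have cI: "c x = a" if "x \<in> carrier V" "a \<in> carrier K" "x \<ominus>\<^bsub>V\<^esub> a \<odot>\<^bsub>V\<^esub> v \<in> W" for x a
    using uniq c that by blast
  have "c \<in> functionals K V"
  proof (rule functionalI)
    fix x y assume xy: "x \<in> carrier V" "y \<in> carrier V"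
    have "(x \<oplus>\<^bsub>V\<^esub> y) \<ominus>\<^bsub>V\<^esub> (c x \<oplus>\<^bsub>K\<^esub> c y) \<odot>\<^bsub>V\<^esub> v = (x \<ominus>\<^bsub>V\<^esub> c x \<odot>\<^bsub>V\<^esub> v) \<oplus>\<^bsub>V\<^esub> (y \<ominus>\<^bsub>V\<^esub> c y \<odot>\<^bsub>V\<^esub> v)"
      using xy c assms by (simp add: a_minus_def V.smult_l_distr V.M.minus_add V.M.a_ac)
    then show "c (x \<oplus>\<^bsub>V\<^esub> y) = c x \<oplus>\<^bsub>K\<^esub> c y" using xy c D(3) by (intro cI) auto
  next
    fix r x assume rx: "r \<in> carrier K" "x \<in> carrier V"
    have "r \<odot>\<^bsub>V\<^esub> x \<ominus>\<^bsub>V\<^esub> (r \<otimes>\<^bsub>K\<^esub> c x) \<odot>\<^bsub>V\<^esub> v = r \<odot>\<^bsub>V\<^esub> (x \<ominus>\<^bsub>V\<^esub> c x \<odot>\<^bsub>V\<^esub> v)"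
      using rx c assms by (simp add: a_minus_def V.smult_assoc V.smult_r_distr V.smult_r_minus)
    then show "c (r \<odot>\<^bsub>V\<^esub> x) = r \<otimes>\<^bsub>K\<^esub> c x" using rx c D(4) by (intro cI) auto
  qed (use c in \<open>auto simp: c_def\<close>)
  moreover have "c u = \<zero>\<^bsub>K\<^esub>" if "u \<in> U" for u
    using that W(2) D(1) assms(4) by (intro cI) (auto simp: V.smult_l_null V.M.minus_zero_right subset_iff)
  moreover have "c v = \<one>\<^bsub>K\<^esub>"
    using assms D(2) by (intro cI) (auto simp: V.smult_one a_minus_def V.M.r_neg)
  ultimately show ?thesis using that by blast
qed

lemma functional_eqI:
  assumes "field K" "left_module K V" "x \<in> carrier V" "y \<in> carrier V"
    and "\<And>c. c \<in> functionals K V \<Longrightarrow> c x = c y"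
  shows "x = y"
proof (rule ccontr)
  interpret K: field K by fact
  interpret V: left_module K V by fact
  assume "x \<noteq> y"
  then have "x \<ominus>\<^bsub>V\<^esub> y \<noteq> \<zero>\<^bsub>V\<^esub>" using assms(3,4) by (simp add: V.M.minus_eq_zero_iff)
  moreover have "submodule {\<zero>\<^bsub>V\<^esub>} K V"
    by (rule V.submodule_I) (auto simp: V.smult_r_null)
  ultimately obtain c where c: "c \<in> functionals K V" "c (x \<ominus>\<^bsub>V\<^esub> y) = \<one>\<^bsub>K\<^esub>"
    using exists_functional[of K V "{\<zero>\<^bsub>V\<^esub>}" "x \<ominus>\<^bsub>V\<^esub> y"] assms by auto
  then show False
    using assms(5)[OF c(1)] assms functionalD[OF c(1)]
    by (simp add: functional_hom[OF c(1) assms(2)] a_minus_def K.r_neg)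
qed

section \<open>Sums of rank one maps and finite-dimensional duality\<close>

inductive_set finite_rank :: "'k ring \<Rightarrow> ('k, 'v) module \<Rightarrow> ('v \<Rightarrow> 'v) set" for K V where
  zero: "zero_map V V \<in> finite_rank K V"
| add: "\<lbrakk>\<pi> \<in> finite_rank K V; c \<in> functionals K V; v \<in> carrier V\<rbrakk> \<Longrightarrow>
    (\<lambda>x\<in>carrier V. \<pi> x \<oplus>\<^bsub>V\<^esub> c x \<odot>\<^bsub>V\<^esub> v) \<in> finite_rank K V"

text \<open>Writing the identity as a finite sum of maps \<open>x -> c(x) v\<close> replaces a
  choice of basis and dual basis. Statements about \<open>V\<close> can then be proved by induction
  over \<open>finite_rank\<close> and read off at the identity.\<close>

definition fin_dim :: "'k ring \<Rightarrow> ('k, 'v) module \<Rightarrow> bool" where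
  "fin_dim K V \<longleftrightarrow> left_module K V \<and> (\<lambda>x\<in>carrier V. x) \<in> finite_rank K V"

lemma finite_rank_mhom:
  assumes "\<pi> \<in> finite_rank K V" "left_module K V"
  shows "\<pi> \<in> mhom K V V"
  using assms(1)
proof induction
  case zero
  then show ?case by (intro mhom_zero_map assms)
next
  case (add \<pi> c v)
  interpret left_module K V by fact
  show ?case
    by (rule mhomI) (use mhomD[OF add.IH] functionalD[OF add.hyps(2)] add.hyps(3) in
      \<open>auto simp: smult_closed smult_l_distr smult_r_distr smult_assoc M.a_ac extensional_def\<close>)
qed

text \<open>Apart from the converse below, generation is used only in this form: no proper submodule
  contains \<open>S\<close>. Linear combinations then need not be handled again.\<close>

lemma finitely_generatedE:
  assumes "finitely_generated R M" "left_module R M"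
  obtains S where "finite S" "S \<subseteq> carrier M"
    "\<And>U. submodule U R M \<Longrightarrow> S \<subseteq> U \<Longrightarrow> U = carrier M"
proof -
  interpret left_module R M by fact
  obtain S where S: "finite S" "S \<subseteq> carrier M"
    "\<forall>x\<in>carrier M. \<exists>a\<in>S \<rightarrow> carrier R. x = (\<Oplus>\<^bsub>M\<^esub>s\<in>S. a s \<odot>\<^bsub>M\<^esub> s)"
    using assms by (auto simp: finitely_generated_def)
  have "U = carrier M" if U: "submodule U R M" "S \<subseteq> U" for U
  proof -
    note D = submodule_D[OF U(1)]
    have 1: "(\<Oplus>\<^bsub>M\<^esub>s\<in>T. a s \<odot>\<^bsub>M\<^esub> s) \<in> U" if "a \<in> S \<rightarrow> carrier R" "T \<subseteq> S" for a T
      using finite_subset[OF that(2) S(1)] that(2)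
    proof (induction T rule: finite_induct)
      case (insert s T)
      then have "(\<Oplus>\<^bsub>M\<^esub>s\<in>insert s T. a s \<odot>\<^bsub>M\<^esub> s) = a s \<odot>\<^bsub>M\<^esub> s \<oplus>\<^bsub>M\<^esub> (\<Oplus>\<^bsub>M\<^esub>s\<in>T. a s \<odot>\<^bsub>M\<^esub> s)"
        using that(1) S(2) by (subst M.finsum_insert) (auto intro!: smult_closed)
      moreover have "a s \<odot>\<^bsub>M\<^esub> s \<in> U"
        using insert.prems U(2) that(1) by (intro D(4)) auto
      ultimately show ?case using insert D(3) by auto
    qed (auto simp: D)
    have "carrier M \<subseteq> U"
    proof
      fix x assume "x \<in> carrier M"
      then obtain a where "a \<in> S \<rightarrow> carrier R" "x = (\<Oplus>\<^bsub>M\<^esub>s\<in>S. a s \<odot>\<^bsub>M\<^esub> s)"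
        using S(3) by auto
      then show "x \<in> U" using 1[of a S] by simp
    qed
    then show ?thesis using D(1) by auto
  qed
  then show ?thesis using that S by blast
qed

text \<open>The linear combinations of \<open>S\<close> form a submodule containing
  \<open>S\<close>, hence everything.\<close>

lemma finitely_generatedI:
  assumes "left_module R M" "finite S" "S \<subseteq> carrier M"
    "\<And>U. submodule U R M \<Longrightarrow> S \<subseteq> U \<Longrightarrow> U = carrier M"
  shows "finitely_generated R M"
proof -
  interpret left_module R M by fact
  define U where "U = {(\<Oplus>\<^bsub>M\<^esub>s\<in>S. a s \<odot>\<^bsub>M\<^esub> s) | a. a \<in> S \<rightarrow> carrier R}"
  have sc: "a s \<odot>\<^bsub>M\<^esub> s \<in> carrier M" if "a \<in> S \<rightarrow> carrier R" "s \<in> S" for a s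
    using that assms(3) by (auto intro!: smult_closed)
  have "submodule U R M"
  proof (rule submodule_I)
    show "U \<subseteq> carrier M" using sc by (auto simp: U_def intro!: M.finsum_closed)
    have "(\<Oplus>\<^bsub>M\<^esub>s\<in>S. \<zero>\<^bsub>R\<^esub> \<odot>\<^bsub>M\<^esub> s) = (\<Oplus>\<^bsub>M\<^esub>s\<in>S. \<zero>\<^bsub>M\<^esub>)"
      using assms(3) by (intro M.finsum_cong') (auto simp: smult_l_null)
    then show "\<zero>\<^bsub>M\<^esub> \<in> U" unfolding U_def by (auto intro!: exI[of _ "\<lambda>_. \<zero>\<^bsub>R\<^esub>"])
  next
    fix x y assume "x \<in> U" "y \<in> U"
    then obtain a b where a: "a \<in> S \<rightarrow> carrier R" "x = (\<Oplus>\<^bsub>M\<^esub>s\<in>S. a s \<odot>\<^bsub>M\<^esub> s)"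
      and b: "b \<in> S \<rightarrow> carrier R" "y = (\<Oplus>\<^bsub>M\<^esub>s\<in>S. b s \<odot>\<^bsub>M\<^esub> s)" by (auto simp: U_def)
    have "x \<oplus>\<^bsub>M\<^esub> y = (\<Oplus>\<^bsub>M\<^esub>s\<in>S. a s \<odot>\<^bsub>M\<^esub> s \<oplus>\<^bsub>M\<^esub> b s \<odot>\<^bsub>M\<^esub> s)"
      unfolding a b using sc[OF a(1)] sc[OF b(1)] by (subst M.finsum_addf) auto
    also have "\<dots> = (\<Oplus>\<^bsub>M\<^esub>s\<in>S. (a s \<oplus>\<^bsub>R\<^esub> b s) \<odot>\<^bsub>M\<^esub> s)"
      using a b assms(3) sc by (intro M.finsum_cong') (auto simp: smult_l_distr Pi_def subset_iff smult_closed)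
    finally show "x \<oplus>\<^bsub>M\<^esub> y \<in> U"
      using a b unfolding U_def by (auto intro!: exI[of _ "\<lambda>s. a s \<oplus>\<^bsub>R\<^esub> b s"])
  next
    fix r x assume r: "r \<in> carrier R" and "x \<in> U"
    then obtain a where a: "a \<in> S \<rightarrow> carrier R" "x = (\<Oplus>\<^bsub>M\<^esub>s\<in>S. a s \<odot>\<^bsub>M\<^esub> s)" by (auto simp: U_def)
    have "r \<odot>\<^bsub>M\<^esub> (\<Oplus>\<^bsub>M\<^esub>s\<in>T. a s \<odot>\<^bsub>M\<^esub> s) = (\<Oplus>\<^bsub>M\<^esub>s\<in>T. (r \<otimes>\<^bsub>R\<^esub> a s) \<odot>\<^bsub>M\<^esub> s)" if "T \<subseteq> S" for T
      using finite_subset[OF that assms(2)] that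
    proof (induction T rule: finite_induct)
      case (insert s T)
      have as: "a t \<in> carrier R" "t \<in> carrier M" if "t \<in> insert s T" for t
        using that insert.prems a assms(3) by auto
      have "(\<Oplus>\<^bsub>M\<^esub>s\<in>insert s T. a s \<odot>\<^bsub>M\<^esub> s) = a s \<odot>\<^bsub>M\<^esub> s \<oplus>\<^bsub>M\<^esub> (\<Oplus>\<^bsub>M\<^esub>s\<in>T. a s \<odot>\<^bsub>M\<^esub> s)"
        using insert as by (subst M.finsum_insert) (auto intro!: smult_closed)
      moreover have "(\<Oplus>\<^bsub>M\<^esub>s\<in>insert s T. (r \<otimes>\<^bsub>R\<^esub> a s) \<odot>\<^bsub>M\<^esub> s)
          = (r \<otimes>\<^bsub>R\<^esub> a s) \<odot>\<^bsub>M\<^esub> s \<oplus>\<^bsub>M\<^esub> (\<Oplus>\<^bsub>M\<^esub>s\<in>T. (r \<otimes>\<^bsub>R\<^esub> a s) \<odot>\<^bsub>M\<^esub> s)"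
        using insert as r by (subst M.finsum_insert) (auto intro!: smult_closed)
      ultimately show ?case
        using insert as r by (simp add: smult_r_distr smult_assoc smult_closed Pi_def M.finsum_closed)
    qed (auto simp: smult_r_null r)
    then have "r \<odot>\<^bsub>M\<^esub> x = (\<Oplus>\<^bsub>M\<^esub>s\<in>S. (r \<otimes>\<^bsub>R\<^esub> a s) \<odot>\<^bsub>M\<^esub> s)" using a by simp
    then show "r \<odot>\<^bsub>M\<^esub> x \<in> U" using a r unfolding U_def by (auto intro!: exI[of _ "\<lambda>s. r \<otimes>\<^bsub>R\<^esub> a s"])
  qed
  moreover have "S \<subseteq> U"
  proof
    fix t assume t: "t \<in> S"
    have "(\<Oplus>\<^bsub>M\<^esub>s\<in>S. (if s = t then \<one>\<^bsub>R\<^esub> else \<zero>\<^bsub>R\<^esub>) \<odot>\<^bsub>M\<^esub> s) = (\<Oplus>\<^bsub>M\<^esub>s\<in>S. if t = s then s else \<zero>\<^bsub>M\<^esub>)"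
      using assms(3) by (intro M.finsum_cong') (auto simp: smult_l_null smult_one)
    also have "\<dots> = t"
      using t assms by (intro M.finsum_singleton) auto
    finally show "t \<in> U" unfolding U_def
      by (intro CollectI exI[of _ "\<lambda>s. if s = t then \<one>\<^bsub>R\<^esub> else \<zero>\<^bsub>R\<^esub>"]) auto
  qed
  ultimately have U: "U = carrier M" using assms(4) by blast
  show ?thesis
    unfolding finitely_generated_def
  proof (intro exI[of _ S] conjI assms(2,3) ballI)
    fix x assume "x \<in> carrier M"
    then show "\<exists>a\<in>S \<rightarrow> carrier R. x = (\<Oplus>\<^bsub>M\<^esub>s\<in>S. a s \<odot>\<^bsub>M\<^esub> s)"
      unfolding U[symmetric] U_def by auto
  qed
qed

text \<open>Generators are fixed one at a time. If \<open>\<pi>\<close> does not yet fix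
  \<open>s\<close>, some functional \<open>c\<close> vanishes on all fixed points of
  \<open>\<pi>\<close> and has \<open>c s = 1\<close>. Adding \<open>c(x) (s - \<pi> s)\<close>
  repairs \<open>s\<close> and leaves the earlier fixed points alone. A map that fixes a generating
  set is the identity.\<close>

lemma fin_dim_if_finitely_generated:
  assumes "field K" "left_module K V" "finitely_generated K V"
  shows "fin_dim K V"
proof -
  interpret K: field K by fact
  interpret V: left_module K V by fact
  obtain S where S: "finite S" "S \<subseteq> carrier V"
    "\<And>U. submodule U K V \<Longrightarrow> S \<subseteq> U \<Longrightarrow> U = carrier V"
    by (rule finitely_generatedE[OF assms(3,2)], rule that)
  have fix_sub: "submodule {x\<in>carrier V. \<pi> x = x} K V" if "\<pi> \<in> finite_rank K V" for \<pi>
  proof (rule V.submodule_I)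
    note * = finite_rank_mhom[OF that assms(2)]
    show "\<zero>\<^bsub>V\<^esub> \<in> {x\<in>carrier V. \<pi> x = x}" using mhom_hom(1)[OF * assms(2,2)] by simp
  qed (use mhomD[OF finite_rank_mhom[OF that assms(2)]] in \<open>auto simp: V.smult_closed\<close>)
  have "\<exists>\<pi>\<in>finite_rank K V. \<forall>s\<in>S. \<pi> s = s"
    using S(1,2)
  proof (induction S rule: finite_induct)
    case empty
    then show ?case using finite_rank.zero by auto
  next
    case (insert s S)
    then obtain \<pi> where \<pi>: "\<pi> \<in> finite_rank K V" "\<forall>s\<in>S. \<pi> s = s" by auto
    note \<pi>h = mhomD[OF finite_rank_mhom[OF \<pi>(1) assms(2)]]
    show ?case
    proof (cases "\<pi> s = s")
      case True
      then show ?thesis using \<pi> by auto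
    next
      case False
      then obtain c where c: "c \<in> functionals K V" "\<And>u. u \<in> {x\<in>carrier V. \<pi> x = x} \<Longrightarrow> c u = \<zero>\<^bsub>K\<^esub>"
        "c s = \<one>\<^bsub>K\<^esub>"
        using exists_functional[OF assms(1,2) fix_sub[OF \<pi>(1)], of s] insert.prems by auto
      have sV: "s \<in> carrier V" using insert.prems by simp
      let ?\<pi> = "\<lambda>x\<in>carrier V. \<pi> x \<oplus>\<^bsub>V\<^esub> c x \<odot>\<^bsub>V\<^esub> (s \<ominus>\<^bsub>V\<^esub> \<pi> s)"
      have "?\<pi> \<in> finite_rank K V"
        by (rule finite_rank.add) (use \<pi> c sV \<pi>h in auto)
      moreover have "?\<pi> x = x" if "x \<in> insert s S" for x
      proof (cases "x = s")
        case True
        then show ?thesis using sV c \<pi>h(2)[OF sV]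
          by (simp add: V.smult_one a_minus_def V.M.a_lcomm V.M.r_neg)
      next
        case False
        then have "x \<in> carrier V" "\<pi> x = x" using that insert.prems \<pi>(2) by auto
        then show ?thesis using c(2)[of x] sV \<pi>h(2)[OF sV] by (simp add: V.smult_l_null)
      qed
      ultimately show ?thesis by blast
    qed
  qed
  then obtain \<pi> where \<pi>: "\<pi> \<in> finite_rank K V" "\<forall>s\<in>S. \<pi> s = s" by auto
  have "{x\<in>carrier V. \<pi> x = x} = carrier V"
    using S(2) \<pi>(2) by (intro S(3) fix_sub \<pi>(1)) auto
  then have "\<pi> = (\<lambda>x\<in>carrier V. x)"
    using mhomD(1)[OF finite_rank_mhom[OF \<pi>(1) assms(2)]] by (auto simp: fun_eq_iff extensional_def)
  then show ?thesis using \<pi> assms by (auto simp: fin_dim_def)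
qed

text \<open>Dual to the previous construction: \<open>\<pi>\<close> is built so that
  \<open>c (\<pi> x) = c x\<close> for more and more \<open>c\<close> in \<open>C\<close>. If this
  fails for \<open>c\<close> at \<open>z\<close>, a multiple \<open>y\<close> of
  \<open>z - \<pi> z\<close> has \<open>c y = 1\<close> and is killed by the functionals already
  treated, so adding \<open>(c x - c (\<pi> x)) y\<close> repairs \<open>c\<close> only. At the end
  \<open>x - \<pi> x\<close> is killed by all of \<open>C\<close>.\<close>

lemma fin_dim_if_separated:
  assumes "field K" "left_module K V" "finite C" "C \<subseteq> functionals K V"
    and sep: "\<And>x. x \<in> carrier V \<Longrightarrow> \<forall>c\<in>C. c x = \<zero>\<^bsub>K\<^esub> \<Longrightarrow> x = \<zero>\<^bsub>V\<^esub>"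
  shows "fin_dim K V"
proof -
  interpret K: field K by fact
  interpret V: left_module K V by fact
  have "\<exists>\<pi>\<in>finite_rank K V. \<forall>c\<in>C. \<forall>x\<in>carrier V. c (\<pi> x) = c x"
    using assms(3,4)
  proof (induction C rule: finite_induct)
    case empty
    then show ?case using finite_rank.zero by auto
  next
    case (insert c C)
    then obtain \<pi> where \<pi>: "\<pi> \<in> finite_rank K V" "\<forall>c\<in>C. \<forall>x\<in>carrier V. c (\<pi> x) = c x" by auto
    have cf: "c \<in> functionals K V" using insert by auto
    note \<pi>m = finite_rank_mhom[OF \<pi>(1) assms(2)]
    note \<pi>h = mhomD[OF \<pi>m]
    note cd = functionalD[OF cf]
    show ?case
    proof (cases "\<forall>x\<in>carrier V. c (\<pi> x) = c x")
      case True
      then show ?thesis using \<pi> by auto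
    next
      case False
      then obtain z where z: "z \<in> carrier V" "c (\<pi> z) \<noteq> c z" by auto
      define b where "b = c z \<ominus>\<^bsub>K\<^esub> c (\<pi> z)"
      have b: "b \<in> Units K" using z cd(2) \<pi>h(2) by (auto simp: b_def K.field_Units K.minus_eq_zero_iff)
      define y where "y = inv\<^bsub>K\<^esub> b \<odot>\<^bsub>V\<^esub> (z \<ominus>\<^bsub>V\<^esub> \<pi> z)"
      have y: "y \<in> carrier V" using z b \<pi>h(2) by (auto simp: y_def intro!: V.smult_closed)
      have fy: "f y = inv\<^bsub>K\<^esub> b \<otimes>\<^bsub>K\<^esub> (f z \<ominus>\<^bsub>K\<^esub> f (\<pi> z))" if "f \<in> functionals K V" for f
        using functionalD[OF that] functional_hom(3)[OF that assms(2)] z b \<pi>h(2) by (simp add: y_def)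
      have c1: "c y = \<one>\<^bsub>K\<^esub>" using fy[OF cf] b by (simp flip: b_def)
      have c0: "f y = \<zero>\<^bsub>K\<^esub>" if "f \<in> C" for f
      proof -
        have f: "f \<in> functionals K V" using that insert.prems by auto
        show ?thesis
          using fy[OF f] that \<pi>(2) z b functionalD(2)[OF f] by (auto simp: a_minus_def K.r_neg)
      qed
      let ?c = "\<lambda>x\<in>carrier V. c x \<oplus>\<^bsub>K\<^esub> \<ominus>\<^bsub>K\<^esub> c (\<pi> x)"
      have c'f: "?c \<in> functionals K V"
        by (rule functionalI) (use cd \<pi>h in \<open>auto simp: V.smult_closed K.r_distr K.r_minus K.minus_add K.a_ac\<close>)
      let ?\<pi> = "\<lambda>x\<in>carrier V. \<pi> x \<oplus>\<^bsub>V\<^esub> ?c x \<odot>\<^bsub>V\<^esub> y"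
      have "?\<pi> \<in> finite_rank K V"
        by (rule finite_rank.add[OF \<pi>(1) c'f y])
      moreover have "f (?\<pi> x) = f x" if "f \<in> insert c C" "x \<in> carrier V" for f x
      proof -
        have f: "f \<in> functionals K V" using that insert.prems by auto
        have *: "f (?\<pi> x) = f (\<pi> x) \<oplus>\<^bsub>K\<^esub> (c x \<oplus>\<^bsub>K\<^esub> \<ominus>\<^bsub>K\<^esub> c (\<pi> x)) \<otimes>\<^bsub>K\<^esub> f y"
          using that functionalD[OF f] \<pi>h(2) cd(2) y by (simp add: V.smult_closed)
        show ?thesis
        proof (cases "f = c")
          case True
          then show ?thesis unfolding * using that cd(2) \<pi>h(2) c1
            by (simp add: K.a_lcomm K.r_neg)
        next
          case False
          then have "f (\<pi> x) = f x" "f y = \<zero>\<^bsub>K\<^esub>" using that \<pi>(2) c0 by auto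
          then show ?thesis unfolding * using that cd(2) \<pi>h(2) functionalD(2)[OF f] by simp
        qed
      qed
      ultimately show ?thesis by blast
    qed
  qed
  then obtain \<pi> where \<pi>: "\<pi> \<in> finite_rank K V" "\<forall>c\<in>C. \<forall>x\<in>carrier V. c (\<pi> x) = c x" by auto
  note \<pi>h = mhomD[OF finite_rank_mhom[OF \<pi>(1) assms(2)]]
  have "\<pi> x = x" if x: "x \<in> carrier V" for x
  proof -
    have "c (x \<ominus>\<^bsub>V\<^esub> \<pi> x) = \<zero>\<^bsub>K\<^esub>" if "c \<in> C" for c
    proof -
      have c: "c \<in> functionals K V" using that assms(4) by auto
      have "c (\<pi> x) = c x" using that \<pi>(2) x by auto
      then show ?thesis
        using functional_hom(3)[OF c assms(2) x \<pi>h(2)[OF x]] functionalD(2)[OF c x]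
        by (simp add: a_minus_def K.r_neg)
    qed
    then have "x \<ominus>\<^bsub>V\<^esub> \<pi> x = \<zero>\<^bsub>V\<^esub>" using x \<pi>h(2) by (intro sep) auto
    then show ?thesis using x \<pi>h(2) by (simp add: V.M.minus_eq_zero_iff)
  qed
  then have "\<pi> = (\<lambda>x\<in>carrier V. x)"
    using \<pi>h(1) by (auto simp: fun_eq_iff extensional_def)
  then show ?thesis using \<pi> assms by (auto simp: fin_dim_def)
qed

text \<open>The functionals that occur in a rank one decomposition of the identity separate points:
  where all of them vanish, so does the sum.\<close>

lemma fin_dim_separated:
  assumes "field K" "fin_dim K V"
  obtains C where "finite C" "C \<subseteq> functionals K V"
    "\<And>x. x \<in> carrier V \<Longrightarrow> \<forall>c\<in>C. c x = \<zero>\<^bsub>K\<^esub> \<Longrightarrow> x = \<zero>\<^bsub>V\<^esub>"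
proof -
  interpret K: field K by fact
  interpret V: left_module K V using assms by (simp add: fin_dim_def)
  have *: "\<exists>C. finite C \<and> C \<subseteq> functionals K V \<and>
    (\<forall>x\<in>carrier V. (\<forall>c\<in>C. c x = \<zero>\<^bsub>K\<^esub>) \<longrightarrow> \<pi> x = \<zero>\<^bsub>V\<^esub>)" if "\<pi> \<in> finite_rank K V" for \<pi>
    using that
  proof induction
    case zero
    then show ?case by (auto simp: zero_map_def)
  next
    case (add \<pi> c v)
    then obtain C where "finite C \<and> C \<subseteq> functionals K V \<and>
      (\<forall>x\<in>carrier V. (\<forall>c\<in>C. c x = \<zero>\<^bsub>K\<^esub>) \<longrightarrow> \<pi> x = \<zero>\<^bsub>V\<^esub>)" by blast
    then show ?case using add.hyps by (intro exI[of _ "insert c C"]) (auto simp: V.smult_l_null)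
  qed
  show ?thesis
    using *[of "\<lambda>x\<in>carrier V. x"] assms(2) that by (auto simp: fin_dim_def)
qed

text \<open>The vectors that occur in a rank one decomposition of the identity generate.\<close>

lemma finitely_generated_if_fin_dim:
  assumes "fin_dim K V"
  shows "finitely_generated K V"
proof -
  interpret V: left_module K V using assms by (simp add: fin_dim_def)
  have *: "\<exists>S. finite S \<and> S \<subseteq> carrier V \<and>
    (\<forall>U. submodule U K V \<and> S \<subseteq> U \<longrightarrow> \<pi> ` carrier V \<subseteq> U)" if "\<pi> \<in> finite_rank K V" for \<pi>
    using that
  proof induction
    case zero
    then show ?case using V.submodule_D(2) by (intro exI[of _ "{}"]) (auto simp: zero_map_def)
  next
    case (add \<pi> c v)
    then obtain S where S: "finite S" "S \<subseteq> carrier V"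
      "\<forall>U. submodule U K V \<and> S \<subseteq> U \<longrightarrow> \<pi> ` carrier V \<subseteq> U" by blast
    show ?case
    proof (intro exI[of _ "insert v S"] conjI allI impI image_subsetI)
      fix U x assume U: "submodule U K V \<and> insert v S \<subseteq> U" and x: "x \<in> carrier V"
      then have "\<pi> x \<in> U" using S(3) by blast
      then show "(\<lambda>x\<in>carrier V. \<pi> x \<oplus>\<^bsub>V\<^esub> c x \<odot>\<^bsub>V\<^esub> v) x \<in> U"
        using U x V.submodule_D(3,4)[of U] functionalD(2)[OF add.hyps(2)] by simp
    qed (use S add.hyps in auto)
  qed
  obtain S where "finite S" "S \<subseteq> carrier V"
    and S: "\<forall>U. submodule U K V \<and> S \<subseteq> U \<longrightarrow> (\<lambda>x\<in>carrier V. x) ` carrier V \<subseteq> U"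
    using *[of "\<lambda>x\<in>carrier V. x"] assms by (auto simp: fin_dim_def)
  have "(\<lambda>x\<in>carrier V. x) ` carrier V = carrier V" by auto
  then have S': "carrier V \<subseteq> U" if "submodule U K V" "S \<subseteq> U" for U
    using S that by metis
  show ?thesis
  proof (rule finitely_generatedI[OF V.left_module_axioms \<open>finite S\<close> \<open>S \<subseteq> carrier V\<close>])
    show "U = carrier V" if "submodule U K V" "S \<subseteq> U" for U
      using S'[OF that] V.submodule_D(1)[OF that(1)] by auto
  qed
qed

text \<open>If \<open>\<pi>\<close> is the sum of the maps \<open>c(-) v\<close>, then
  \<open>\<Phi> (\<xi> \<circ> \<pi>)\<close> is the value of \<open>\<xi>\<close> at the sum of the
  vectors \<open>\<Phi>(c) v\<close>. The identity is such a \<open>\<pi>\<close>, which gives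
  \<open>w\<close>.\<close>

lemma bidual_evaluation:
  assumes "field K" "fin_dim K V" "\<Phi> \<in> functionals K (dual_space K V)"
  obtains w where "w \<in> carrier V" "\<And>\<xi>. \<xi> \<in> functionals K V \<Longrightarrow> \<Phi> \<xi> = \<xi> w"
proof -
  interpret K: field K by fact
  interpret V: left_module K V using assms by (simp add: fin_dim_def)
  interpret D: left_module K "dual_space K V"
    by (rule left_module_dual_space) (rule K.cring_axioms V.left_module_axioms)+
  note \<Phi> = functionalD[OF assms(3)]
  have *: "\<exists>w\<in>carrier V. \<forall>\<xi>\<in>functionals K V. \<Phi> (compose (carrier V) \<xi> \<pi>) = \<xi> w"
    if "\<pi> \<in> finite_rank K V" for \<pi>
    using that
  proof induction
    case zero
    have "\<Phi> (compose (carrier V) \<xi> (zero_map V V)) = \<xi> \<zero>\<^bsub>V\<^esub>" if "\<xi> \<in> functionals K V" for \<xi>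
    proof -
      have "compose (carrier V) \<xi> (zero_map V V) = \<zero>\<^bsub>dual_space K V\<^esub>"
        using functional_hom(1)[OF that V.left_module_axioms]
        by (auto simp: compose_def zero_map_def intro!: restrict_ext)
      then show ?thesis
        using functional_hom(1)[OF assms(3) D.left_module_axioms]
          functional_hom(1)[OF that V.left_module_axioms] by simp
    qed
    then show ?case by blast
  next
    case (add \<pi> c v)
    then obtain w where w: "w \<in> carrier V"
      "\<And>\<xi>. \<xi> \<in> functionals K V \<Longrightarrow> \<Phi> (compose (carrier V) \<xi> \<pi>) = \<xi> w" by blast
    note \<pi>m = finite_rank_mhom[OF add.hyps(1) V.left_module_axioms]
    note \<pi>h = mhomD[OF \<pi>m]
    have \<Phi>c: "\<Phi> c \<in> carrier K" using \<Phi>(2) add.hyps by simp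
    have "\<Phi> (compose (carrier V) \<xi> (\<lambda>x\<in>carrier V. \<pi> x \<oplus>\<^bsub>V\<^esub> c x \<odot>\<^bsub>V\<^esub> v)) = \<xi> (w \<oplus>\<^bsub>V\<^esub> \<Phi> c \<odot>\<^bsub>V\<^esub> v)"
      if \<xi>: "\<xi> \<in> functionals K V" for \<xi>
    proof -
      note \<xi>d = functionalD[OF \<xi>]
      have 1: "compose (carrier V) \<xi> \<pi> \<in> functionals K V"
        by (rule mhom_comp[OF V.left_module_axioms \<pi>m \<xi>])
      have 2: "\<xi> v \<odot>\<^bsub>dual_space K V\<^esub> c \<in> functionals K V"
        using D.smult_closed[of "\<xi> v" c] add.hyps \<xi>d by simp
      have "compose (carrier V) \<xi> (\<lambda>x\<in>carrier V. \<pi> x \<oplus>\<^bsub>V\<^esub> c x \<odot>\<^bsub>V\<^esub> v)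
          = compose (carrier V) \<xi> \<pi> \<oplus>\<^bsub>dual_space K V\<^esub> (\<xi> v \<odot>\<^bsub>dual_space K V\<^esub> c)"
        using \<xi>d \<pi>h(2) functionalD(2)[OF add.hyps(2)] add.hyps(3)
        by (auto simp: compose_def V.smult_closed K.m_comm intro!: restrict_ext)
      then have "\<Phi> (compose (carrier V) \<xi> (\<lambda>x\<in>carrier V. \<pi> x \<oplus>\<^bsub>V\<^esub> c x \<odot>\<^bsub>V\<^esub> v))
          = \<Phi> (compose (carrier V) \<xi> \<pi>) \<oplus>\<^bsub>K\<^esub> \<Phi> (\<xi> v \<odot>\<^bsub>dual_space K V\<^esub> c)"
        using \<Phi>(3) 1 2 by (simp del: dual_space_simps(3,4))
      also have "\<Phi> (\<xi> v \<odot>\<^bsub>dual_space K V\<^esub> c) = \<xi> v \<otimes>\<^bsub>K\<^esub> \<Phi> c"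
        using \<Phi>(4) \<xi>d(2) add.hyps by (simp del: dual_space_simps(4))
      also have "\<Phi> (compose (carrier V) \<xi> \<pi>) \<oplus>\<^bsub>K\<^esub> \<xi> v \<otimes>\<^bsub>K\<^esub> \<Phi> c = \<xi> (w \<oplus>\<^bsub>V\<^esub> \<Phi> c \<odot>\<^bsub>V\<^esub> v)"
        using w \<xi> \<xi>d \<Phi>c add.hyps(3) by (simp add: V.smult_closed K.m_comm)
      finally show ?thesis .
    qed
    then show ?case using w(1) \<Phi>c add.hyps(3)
      by (intro bexI[of _ "w \<oplus>\<^bsub>V\<^esub> \<Phi> c \<odot>\<^bsub>V\<^esub> v"] ballI) (blast, simp add: V.smult_closed)
  qed
  obtain w where w: "w \<in> carrier V"
    "\<And>\<xi>. \<xi> \<in> functionals K V \<Longrightarrow> \<Phi> (compose (carrier V) \<xi> (\<lambda>x\<in>carrier V. x)) = \<xi> w"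
    using *[of "\<lambda>x\<in>carrier V. x"] assms(2) by (auto simp: fin_dim_def)
  have "compose (carrier V) \<xi> (\<lambda>x\<in>carrier V. x) = \<xi>" if "\<xi> \<in> functionals K V" for \<xi>
    using functionalD(1)[OF that] by (auto simp: compose_def fun_eq_iff extensional_def)
  then show ?thesis using w that by simp
qed

text \<open>Evaluation at a point of \<open>T\<close> followed by a member of a finite separating
  family on \<open>Z\<close> gives finitely many functionals that separate \<open>V\<close>. Hom
  spaces, \<open>DA\<close> and coinduced modules are treated this way, with \<open>T\<close> a
  generating set.\<close>

lemma fin_dim_functions:
  assumes "field K" "left_module K V" "fin_dim K Z" "finite T"
    and val: "\<And>f t. f \<in> carrier V \<Longrightarrow> t \<in> T \<Longrightarrow> f t \<in> carrier Z"
    and add: "\<And>f g t. f \<in> carrier V \<Longrightarrow> g \<in> carrier V \<Longrightarrow> t \<in> T \<Longrightarrow> (f \<oplus>\<^bsub>V\<^esub> g) t = f t \<oplus>\<^bsub>Z\<^esub> g t"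
    and smult: "\<And>f r t. f \<in> carrier V \<Longrightarrow> r \<in> carrier K \<Longrightarrow> t \<in> T \<Longrightarrow> (r \<odot>\<^bsub>V\<^esub> f) t = r \<odot>\<^bsub>Z\<^esub> f t"
    and sep: "\<And>f. f \<in> carrier V \<Longrightarrow> \<forall>t\<in>T. f t = \<zero>\<^bsub>Z\<^esub> \<Longrightarrow> f = \<zero>\<^bsub>V\<^esub>"
  shows "fin_dim K V"
proof -
  interpret V: left_module K V by fact
  obtain C where C: "finite C" "C \<subseteq> functionals K Z"
    "\<And>x. x \<in> carrier Z \<Longrightarrow> \<forall>c\<in>C. c x = \<zero>\<^bsub>K\<^esub> \<Longrightarrow> x = \<zero>\<^bsub>Z\<^esub>"
    by (rule fin_dim_separated[OF assms(1,3)], rule that)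
  let ?ev = "\<lambda>(c, t). \<lambda>f\<in>carrier V. c (f t)"
  show ?thesis
  proof (rule fin_dim_if_separated[OF assms(1,2)])
    show "finite (?ev ` (C \<times> T))" using C assms by auto
    have "(\<lambda>f\<in>carrier V. c (f t)) \<in> functionals K V" if "c \<in> C" "t \<in> T" for c t
      by (rule functionalI) (use that functionalD[of c K Z] C(2) val add smult in
        \<open>auto simp: V.smult_closed subset_iff\<close>)
    then show "?ev ` (C \<times> T) \<subseteq> functionals K V" by auto
  next
    fix f assume f: "f \<in> carrier V" and *: "\<forall>c\<in>?ev ` (C \<times> T). c f = \<zero>\<^bsub>K\<^esub>"
    show "f = \<zero>\<^bsub>V\<^esub>"
    proof (rule sep[OF f], rule ballI, rule C(3))
      fix t assume t: "t \<in> T"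
      then show "f t \<in> carrier Z" using f val by auto
      show "\<forall>c\<in>C. c (f t) = \<zero>\<^bsub>K\<^esub>" using * t f by force
    qed
  qed
qed


section \<open>Intermediate extensions\<close>

lemma (in abelian_group) add_minus_minus:
  assumes "x \<in> carrier G" "y \<in> carrier G"
  shows "x \<oplus> y \<ominus> x \<ominus> y = \<zero>"
  unfolding a_comm[OF assms] using assms by (simp add: a_minus_def a_assoc r_neg2 r_neg)

lemma corner_simps [simp]:
  "carrier (corner B e) = (\<lambda>b. e \<otimes>\<^bsub>B\<^esub> b \<otimes>\<^bsub>B\<^esub> e) ` carrier B"
  "monoid.mult (corner B e) = monoid.mult B" "one (corner B e) = e"
  "add (corner B e) = add B" "ring.zero (corner B e) = ring.zero B"
  by (simp_all add: corner_def)

locale ring_idempotent = ring B for B :: "('k, 'b) module" (structure) +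
  fixes e :: 'b
  assumes e_closed [simp]: "e \<in> carrier B" and e_idem [simp]: "e \<otimes> e = e"
begin

lemma carrier_corner: "b \<in> carrier (corner B e) \<longleftrightarrow> b \<in> carrier B \<and> e \<otimes> b = b \<and> b \<otimes> e = b"
proof
  assume "b \<in> carrier B \<and> e \<otimes> b = b \<and> b \<otimes> e = b"
  then show "b \<in> carrier (corner B e)" by (auto intro!: image_eqI[of _ _ b])
next
  assume "b \<in> carrier (corner B e)"
  then show "b \<in> carrier B \<and> e \<otimes> b = b \<and> b \<otimes> e = b"
    by (auto simp: m_assoc) (simp flip: m_assoc)
qed

lemma left_ideal_iff: "p \<in> left_ideal B e \<longleftrightarrow> p \<in> carrier B \<and> p \<otimes> e = p"
  by (auto simp: left_ideal_def m_assoc image_iff intro!: bexI[of _ p])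

lemma carrier_right_ideal: "x \<in> carrier (right_ideal_module B e) \<longleftrightarrow> x \<in> carrier B \<and> e \<otimes> x = x"
  by (auto simp: right_ideal_module_def image_iff intro!: bexI[of _ x]) (simp flip: m_assoc)

lemma right_ideal_simps [simp]:
  "add (right_ideal_module B e) = add B" "ring.zero (right_ideal_module B e) = ring.zero B"
  "smult (right_ideal_module B e) = monoid.mult B"
  by (simp_all add: right_ideal_module_def)

lemma ring_corner: "ring (corner B e)"
proof (rule ringI)
  have neg: "\<ominus> x \<in> carrier (corner B e)" if "x \<in> carrier (corner B e)" for x
    using that unfolding carrier_corner by (simp add: l_minus r_minus)
  show "abelian_group (corner B e)"
  proof (rule abelian_groupI)
    show "\<exists>y\<in>carrier (corner B e). y \<oplus>\<^bsub>corner B e\<^esub> x = \<zero>\<^bsub>corner B e\<^esub>"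
      if "x \<in> carrier (corner B e)" for x
      using neg[OF that] that by (intro bexI[of _ "\<ominus> x"]) (auto simp: carrier_corner l_neg simp del: corner_simps(1))
  qed (auto simp: carrier_corner l_distr r_distr a_ac simp del: corner_simps(1))
  have "e \<otimes> (x \<otimes> y) = x \<otimes> y" if "e \<otimes> x = x" "x \<in> carrier B" "y \<in> carrier B" for x y
    using that by (metis m_assoc e_closed)
  then show "monoid (corner B e)"
    by (intro monoidI) (auto simp: carrier_corner m_assoc simp del: corner_simps(1))
qed (auto simp: carrier_corner l_distr r_distr simp del: corner_simps(1))

end

locale corner_module = ring_idempotent B e + M: left_module "corner B e" M
  for B :: "('k, 'b) module" (structure) and e and M :: "('b, 'm) module"
begin

abbreviation "I \<equiv> right_ideal_module B e"
abbreviation "X \<equiv> right_extension B e M"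

lemma X_simps [simp]:
  "carrier X = mhom (corner B e) I M"
  "\<zero>\<^bsub>X\<^esub> = zero_map I M"
  "f \<oplus>\<^bsub>X\<^esub> g = (\<lambda>x\<in>carrier I. f x \<oplus>\<^bsub>M\<^esub> g x)"
  "b \<odot>\<^bsub>X\<^esub> f = (\<lambda>x\<in>carrier I. f (x \<otimes> b))"
  by (simp_all add: right_extension_def Let_def)

lemma left_module_I: "left_module (corner B e) I"
proof (rule left_moduleI[OF ring_corner])
  show "abelian_group I"
  proof (rule abelian_groupI)
    show "\<exists>y\<in>carrier I. y \<oplus>\<^bsub>I\<^esub> x = \<zero>\<^bsub>I\<^esub>" if "x \<in> carrier I" for x
      using that by (intro bexI[of _ "\<ominus> x"]) (auto simp: carrier_right_ideal r_minus l_neg)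
  qed (auto simp: carrier_right_ideal r_distr a_ac)
qed (auto simp: carrier_right_ideal carrier_corner l_distr r_distr m_assoc simp del: corner_simps(1)
    simp flip: m_assoc)

lemma X_memI:
  assumes "f \<in> extensional (carrier I)" "\<And>x. x \<in> carrier I \<Longrightarrow> f x \<in> carrier M"
    and "\<And>x y. x \<in> carrier I \<Longrightarrow> y \<in> carrier I \<Longrightarrow> f (x \<oplus> y) = f x \<oplus>\<^bsub>M\<^esub> f y"
    and "\<And>r x. r \<in> carrier (corner B e) \<Longrightarrow> x \<in> carrier I \<Longrightarrow> f (r \<otimes> x) = r \<odot>\<^bsub>M\<^esub> f x"
  shows "f \<in> carrier X"
  using assms by (auto intro!: mhomI)

lemma X_memD:
  assumes "f \<in> carrier X"
  shows "f \<in> extensional (carrier I)" "\<And>x. x \<in> carrier I \<Longrightarrow> f x \<in> carrier M"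
    and "\<And>x y. x \<in> carrier I \<Longrightarrow> y \<in> carrier I \<Longrightarrow> f (x \<oplus> y) = f x \<oplus>\<^bsub>M\<^esub> f y"
    and "\<And>r x. r \<in> carrier (corner B e) \<Longrightarrow> x \<in> carrier I \<Longrightarrow> f (r \<otimes> x) = r \<odot>\<^bsub>M\<^esub> f x"
  using mhomD[of f "corner B e" I M] assms by auto

lemma I_times: "x \<in> carrier I \<Longrightarrow> b \<in> carrier B \<Longrightarrow> x \<otimes> b \<in> carrier I"
  by (auto simp: carrier_right_ideal simp flip: m_assoc)

lemma I_add: "x \<in> carrier I \<Longrightarrow> y \<in> carrier I \<Longrightarrow> x \<oplus> y \<in> carrier I"
  by (auto simp: carrier_right_ideal r_distr)

lemma I_B: "x \<in> carrier I \<Longrightarrow> x \<in> carrier B"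
  by (simp add: carrier_right_ideal)

lemma X_smult:
  assumes "f \<in> carrier X" "b \<in> carrier B"
  shows "b \<odot>\<^bsub>X\<^esub> f \<in> carrier X"
proof (rule X_memI)
  note f = X_memD[OF assms(1)]
  show "(b \<odot>\<^bsub>X\<^esub> f) (r \<otimes> x) = r \<odot>\<^bsub>M\<^esub> (b \<odot>\<^bsub>X\<^esub> f) x" if "r \<in> carrier (corner B e)" "x \<in> carrier I" for r x
    using that assms I_B f(4)[of r "x \<otimes> b"] mhomD(4)[OF mhom_id[OF left_module_I], of r x]
      left_module.smult_closed[OF left_module_I that]
    by (auto simp: I_times m_assoc carrier_corner simp del: corner_simps(1))
qed (use X_memD[OF assms(1)] assms(2) in \<open>auto simp: I_times I_add I_B l_distr\<close>)

lemma left_module_X: "left_module B X"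
proof (rule left_moduleI)
  note [simp del] = corner_simps(1)
  show "abelian_group X"
  proof (rule abelian_group_pointwise[OF M.M.abelian_group_axioms, of _ "carrier I"])
    show "carrier X \<subseteq> carrier I \<rightarrow>\<^sub>E carrier M" by (auto simp: mhom_def)
    show "\<zero>\<^bsub>X\<^esub> \<in> carrier X"
      by (simp add: mhom_zero_map[OF left_module_I M.left_module_axioms])
    show "f \<oplus>\<^bsub>X\<^esub> g \<in> carrier X" if "f \<in> carrier X" "g \<in> carrier X" for f g
      using mhom_add[OF left_module_I M.left_module_axioms] that by simp
    show "(\<lambda>x\<in>carrier I. \<ominus>\<^bsub>M\<^esub> f x) \<in> carrier X" if "f \<in> carrier X" for f
      using mhom_minus[OF left_module_I M.left_module_axioms] that by simp
  qed (auto simp: zero_map_def)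
  show "a \<odot>\<^bsub>X\<^esub> f \<in> carrier X" if "a \<in> carrier B" "f \<in> carrier X" for a f
    using X_smult that by blast
  show "(a \<oplus> b) \<odot>\<^bsub>X\<^esub> f = a \<odot>\<^bsub>X\<^esub> f \<oplus>\<^bsub>X\<^esub> b \<odot>\<^bsub>X\<^esub> f"
    if "a \<in> carrier B" "b \<in> carrier B" "f \<in> carrier X" for a b f
    using that X_memD[OF that(3)] by (auto simp: I_times I_B r_distr intro!: restrict_ext)
  show "(a \<otimes> b) \<odot>\<^bsub>X\<^esub> f = a \<odot>\<^bsub>X\<^esub> (b \<odot>\<^bsub>X\<^esub> f)"
    if "a \<in> carrier B" "b \<in> carrier B" "f \<in> carrier X" for a b f
    using that by (auto simp: I_times I_B m_assoc intro!: restrict_ext)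
  show "\<one> \<odot>\<^bsub>X\<^esub> f = f" if "f \<in> carrier X" for f
    using X_memD(1)[OF that] by (auto intro!: extensionalityI[of _ "carrier I"] simp: I_B)
qed (auto simp: I_times ring_axioms intro!: restrict_ext)

declare X_simps [simp del]

section \<open>The tensor product \<open>Be \<otimes> M\<close> and the canonical map\<close>

definition "S = left_ideal B e \<times> carrier M"
definition "F = free_Abelian_group S"
definition "N = tensor_relations B (left_ideal B e) (corner B e) M"
text \<open>The value prescribed for the canonical map at the pure tensor of \<open>p\<close> and
  \<open>m\<close>.\<close>

definition "t = (\<lambda>(p, m). \<lambda>x\<in>carrier I. (x \<otimes> p) \<odot>\<^bsub>M\<^esub> m)"

lemma left_extension_simps [simp]:
  "carrier (left_extension B e M) = carrier (F Mod N)"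
  "\<zero>\<^bsub>left_extension B e M\<^esub> = N"
  "add (left_extension B e M) = monoid.mult (F Mod N)"
  "b \<odot>\<^bsub>left_extension B e M\<^esub> Z = (\<Union>x\<in>Z. N #>\<^bsub>F\<^esub> frag_extend (\<lambda>(p, m). frag_of (b \<otimes> p, m)) x)"
  by (simp_all add: left_extension_def Let_def F_def S_def N_def)

lemma corner_mem: "x \<in> carrier I \<Longrightarrow> p \<in> left_ideal B e \<Longrightarrow> x \<otimes> p \<in> carrier (corner B e)"
  by (auto simp: carrier_right_ideal left_ideal_iff carrier_corner m_assoc simp del: corner_simps(1))
    (auto simp flip: m_assoc)

lemma t_closed: "t ` S \<subseteq> carrier X"
proof
  fix f assume "f \<in> t ` S"
  then obtain p m where f: "f = (\<lambda>x\<in>carrier I. (x \<otimes> p) \<odot>\<^bsub>M\<^esub> m)" and p: "p \<in> left_ideal B e"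
    and m: "m \<in> carrier M" by (auto simp: t_def S_def)
  note [simp del] = corner_simps(1)
  have pB: "p \<in> carrier B" using p by (simp add: left_ideal_iff)
  show "f \<in> carrier X"
  proof (rule X_memI)
    fix r x assume r: "r \<in> carrier (corner B e)" and x: "x \<in> carrier I"
    have rx: "r \<otimes> x \<in> carrier I" using left_module.smult_closed[OF left_module_I r x] by simp
    have "(r \<otimes> x) \<otimes> p = r \<otimes> (x \<otimes> p)" using r x pB by (simp add: carrier_corner I_B m_assoc)
    then show "f (r \<otimes> x) = r \<odot>\<^bsub>M\<^esub> f x"
      using M.smult_assoc[OF r corner_mem[OF x p] m] x rx by (simp add: f)
  next
    fix x y assume x: "x \<in> carrier I" and y: "y \<in> carrier I"
    then show "f (x \<oplus> y) = f x \<oplus>\<^bsub>M\<^esub> f y"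
      using M.smult_l_distr[OF corner_mem[OF x p] corner_mem[OF y p] m] I_add[OF x y]
      by (simp add: f l_distr I_B pB)
  qed (use corner_mem[OF _ p] m in \<open>auto simp: f intro!: M.smult_closed\<close>)
qed

sublocale F: comm_group F
  unfolding F_def by (rule abelian_free_Abelian_group)

lemma F_simps [simp]:
  "x \<in> carrier F \<longleftrightarrow> Poly_Mapping.keys x \<subseteq> S" "x \<otimes>\<^bsub>F\<^esub> y = x + y" "\<one>\<^bsub>F\<^esub> = 0"
  by (simp_all add: F_def)

definition "rels =
     {frag_of (p \<oplus> q, m) - frag_of (p, m) - frag_of (q, m) | p q m.
         p \<in> left_ideal B e \<and> q \<in> left_ideal B e \<and> m \<in> carrier M} \<union>
      {frag_of (p, m \<oplus>\<^bsub>M\<^esub> n) - frag_of (p, m) - frag_of (p, n) | p m n.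
         p \<in> left_ideal B e \<and> m \<in> carrier M \<and> n \<in> carrier M} \<union>
      {frag_of (p \<otimes> r, m) - frag_of (p, r \<odot>\<^bsub>M\<^esub> m) | p r m.
         p \<in> left_ideal B e \<and> r \<in> carrier (corner B e) \<and> m \<in> carrier M}"

lemma rels_intros:
  "\<lbrakk>p \<in> left_ideal B e; q \<in> left_ideal B e; m \<in> carrier M\<rbrakk> \<Longrightarrow>
    frag_of (p \<oplus> q, m) - frag_of (p, m) - frag_of (q, m) \<in> rels"
  "\<lbrakk>p \<in> left_ideal B e; m \<in> carrier M; n \<in> carrier M\<rbrakk> \<Longrightarrow>
    frag_of (p, m \<oplus>\<^bsub>M\<^esub> n) - frag_of (p, m) - frag_of (p, n) \<in> rels"
  "\<lbrakk>p \<in> left_ideal B e; r \<in> carrier (corner B e); m \<in> carrier M\<rbrakk> \<Longrightarrow>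
    frag_of (p \<otimes> r, m) - frag_of (p, r \<odot>\<^bsub>M\<^esub> m) \<in> rels"
  unfolding rels_def by blast+

lemma rels_cases:
  assumes "x \<in> rels"
  obtains (1) p q m where "x = frag_of (p \<oplus> q, m) - frag_of (p, m) - frag_of (q, m)"
      "p \<in> left_ideal B e" "q \<in> left_ideal B e" "m \<in> carrier M"
    | (2) p m n where "x = frag_of (p, m \<oplus>\<^bsub>M\<^esub> n) - frag_of (p, m) - frag_of (p, n)"
      "p \<in> left_ideal B e" "m \<in> carrier M" "n \<in> carrier M"
    | (3) p r m where "x = frag_of (p \<otimes> r, m) - frag_of (p, r \<odot>\<^bsub>M\<^esub> m)"
      "p \<in> left_ideal B e" "r \<in> carrier (corner B e)" "m \<in> carrier M"
  using assms unfolding rels_def by blast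

lemma N_eq: "N = generate F rels"
  unfolding N_def tensor_relations_def rels_def F_def S_def by simp

lemma left_ideal_closed:
  "p \<in> left_ideal B e \<Longrightarrow> q \<in> left_ideal B e \<Longrightarrow> p \<oplus> q \<in> left_ideal B e"
  "p \<in> left_ideal B e \<Longrightarrow> r \<in> carrier (corner B e) \<Longrightarrow> p \<otimes> r \<in> left_ideal B e"
  "b \<in> carrier B \<Longrightarrow> p \<in> left_ideal B e \<Longrightarrow> b \<otimes> p \<in> left_ideal B e"
  by (auto simp: left_ideal_iff carrier_corner l_distr m_assoc simp del: corner_simps(1))

lemma F_diff: "a \<in> carrier F \<Longrightarrow> b \<in> carrier F \<Longrightarrow> a - b \<in> carrier F"
  using keys_diff[of a b] by auto

lemma F_of: "p \<in> left_ideal B e \<Longrightarrow> m \<in> carrier M \<Longrightarrow> frag_of (p, m) \<in> carrier F"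
  by (auto simp: S_def)

lemma rels_subset: "rels \<subseteq> carrier F"
  unfolding rels_def
  by (auto simp del: corner_simps(1) F_simps(1) intro!: F_diff F_of left_ideal_closed(1,2) M.smult_closed)

lemma N_subgroup: "subgroup N F"
  unfolding N_eq by (rule F.generate_is_subgroup[OF rels_subset])

lemma carrier_Mod: "carrier (F Mod N) = (\<lambda>x. N #>\<^bsub>F\<^esub> x) ` carrier F"
  by (rule carrier_FactGroup)

lemma N_normal: "N \<lhd> F"
  using N_subgroup by (simp add: F.normal_iff_subgroup)

abbreviation "act b \<equiv> frag_extend (\<lambda>(p, m). frag_of (b \<otimes> p, m) :: ('b \<times> 'm) \<Rightarrow>\<^sub>0 int)"

lemma F_induct [consumes 1, case_names zero diff of]:
  assumes "x \<in> carrier F" "P 0"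
    and "\<And>x y. \<lbrakk>x \<in> carrier F; y \<in> carrier F; P x; P y\<rbrakk> \<Longrightarrow> P (x - y)"
    and "\<And>p m. \<lbrakk>p \<in> left_ideal B e; m \<in> carrier M\<rbrakk> \<Longrightarrow> P (frag_of (p, m))"
  shows "P x"
  by (rule free_Abelian_group_induct[of x S]) (use assms in \<open>auto simp: S_def\<close>)

lemma act_closed:
  assumes "b \<in> carrier B" "x \<in> carrier F"
  shows "act b x \<in> carrier F"
  using assms(2)
  by (induction rule: F_induct)
    (auto simp: frag_extend_diff assms(1) left_ideal_closed simp del: F_simps(1) intro!: F_diff F_of, simp)

text \<open>Left multiplication by \<open>b\<close> turns each defining relation into a relation of
  the same kind, and the elements it sends into \<open>N\<close> form a subgroup. So it descends to
  the tensor product.\<close>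

lemma act_N:
  assumes "b \<in> carrier B" "x \<in> N"
  shows "act b x \<in> N"
proof -
  note N = subgroup.m_closed[OF N_subgroup, simplified] subgroup.one_closed[OF N_subgroup, simplified]
  have N_neg: "- x \<in> N" if "x \<in> N" for x
    using subgroup.m_inv_closed[OF N_subgroup that] subgroup.mem_carrier[OF N_subgroup that]
    by (simp add: F_def)
  let ?H = "{x \<in> carrier F. act b x \<in> N}"
  have "subgroup ?H F"
  proof (rule F.subgroupI)
    show "inv\<^bsub>F\<^esub> x \<in> ?H" if "x \<in> ?H" for x
      using that N_neg by (auto simp: F_def frag_extend_minus)
    have "0 \<in> ?H" using N by simp
    then show "?H \<noteq> {}" by blast
    show "x \<otimes>\<^bsub>F\<^esub> y \<in> ?H" if "x \<in> ?H" "y \<in> ?H" for x y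
      using that N F.m_closed[of x y] by (auto simp: frag_extend_add simp del: F_simps(1))
  qed auto
  moreover have "rels \<subseteq> ?H"
  proof
    fix x assume x: "x \<in> rels"
    from x have "act b x \<in> rels"
    proof (cases rule: rels_cases)
      case (1 p q m)
      then have "act b x = frag_of (b \<otimes> p \<oplus> b \<otimes> q, m) - frag_of (b \<otimes> p, m) - frag_of (b \<otimes> q, m)"
        using assms(1) by (simp add: frag_extend_diff left_ideal_iff r_distr)
      then show ?thesis using 1 left_ideal_closed(3)[OF assms(1)] by (auto intro!: rels_intros simp del: corner_simps(1))
    next
      case (2 p m n)
      then have "act b x = frag_of (b \<otimes> p, m \<oplus>\<^bsub>M\<^esub> n) - frag_of (b \<otimes> p, m) - frag_of (b \<otimes> p, n)"
        by (simp add: frag_extend_diff)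
      then show ?thesis using 2 left_ideal_closed(3)[OF assms(1)] by (auto intro!: rels_intros simp del: corner_simps(1))
    next
      case (3 p r m)
      then have "act b x = frag_of (b \<otimes> p \<otimes> r, m) - frag_of (b \<otimes> p, r \<odot>\<^bsub>M\<^esub> m)"
        using assms(1) by (simp add: frag_extend_diff left_ideal_iff carrier_corner m_assoc del: corner_simps(1))
      then show ?thesis using 3 left_ideal_closed(3)[OF assms(1)] by (auto intro!: rels_intros simp del: corner_simps(1))
    qed
    moreover have "rels \<subseteq> N" unfolding N_eq by (auto intro: generate.incl)
    ultimately show "x \<in> ?H" using x rels_subset by blast
  qed
  ultimately have "generate F rels \<subseteq> ?H" by (rule F.generate_subgroup_incl[rotated])
  then show ?thesis using assms(2) by (auto simp: N_eq)
qed
text \<open>Scalar multiplication on the tensor product is a union over all representatives of a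
  coset; by \<open>act_N\<close> they all contribute the same coset.\<close>

lemma act_coset:
  assumes "b \<in> carrier B" "x \<in> carrier F"
  shows "b \<odot>\<^bsub>left_extension B e M\<^esub> (N #>\<^bsub>F\<^esub> x) = N #>\<^bsub>F\<^esub> act b x"
proof -
  have const: "N #>\<^bsub>F\<^esub> act b y = N #>\<^bsub>F\<^esub> act b x" if y: "y \<in> N #>\<^bsub>F\<^esub> x" for y
  proof -
    obtain n where n: "n \<in> N" "y = n + x" using y by (auto simp: r_coset_def)
    have "act b y \<in> N #>\<^bsub>F\<^esub> act b x"
      using act_N[OF assms(1) n(1)] n by (auto simp: r_coset_def frag_extend_add)
    from F.repr_independence[OF this act_closed[OF assms] N_subgroup] show ?thesis ..
  qed
  have "x \<in> N #>\<^bsub>F\<^esub> x" by (rule F.rcos_self[OF assms(2) N_subgroup])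
  then show ?thesis
    unfolding left_extension_simps by (rule UN_constant_eq) (rule ballI, rule const)
qed

lemma pure_tensor_eq: "pure_tensor B e M p m = N #>\<^bsub>F\<^esub> frag_of (p, m)"
  by (simp add: pure_tensor_def N_def F_def S_def)

lemma add_X: "comm_group (add_monoid X)"
  using left_module_X by (simp add: left_module_def abelian_group.a_comm_group)

text \<open>The first three identities say that \<open>t\<close> is biadditive and balanced over the
  corner, so that it factors through the tensor product; the last one gives
  \<open>B\<close>-linearity.\<close>

lemma t_simps:
  "\<lbrakk>p \<in> left_ideal B e; q \<in> left_ideal B e; m \<in> carrier M\<rbrakk> \<Longrightarrow> t (p \<oplus> q, m) = t (p, m) \<oplus>\<^bsub>X\<^esub> t (q, m)"
  "\<lbrakk>p \<in> left_ideal B e; m \<in> carrier M; n \<in> carrier M\<rbrakk> \<Longrightarrow>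
    t (p, m \<oplus>\<^bsub>M\<^esub> n) = t (p, m) \<oplus>\<^bsub>X\<^esub> t (p, n)"
  "\<lbrakk>p \<in> left_ideal B e; r \<in> carrier (corner B e); m \<in> carrier M\<rbrakk> \<Longrightarrow>
    t (p \<otimes> r, m) = t (p, r \<odot>\<^bsub>M\<^esub> m)"
  "\<lbrakk>b \<in> carrier B; p \<in> left_ideal B e; m \<in> carrier M\<rbrakk> \<Longrightarrow> t (b \<otimes> p, m) = b \<odot>\<^bsub>X\<^esub> t (p, m)"
proof -
  assume p: "p \<in> left_ideal B e" and m: "m \<in> carrier M"
  note [simp del] = corner_simps(1)
  have pB: "p \<in> carrier B" using p by (simp add: left_ideal_iff)
  show "t (p \<oplus> q, m) = t (p, m) \<oplus>\<^bsub>X\<^esub> t (q, m)" if q: "q \<in> left_ideal B e"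
  proof -
    have "q \<in> carrier B" using q by (simp add: left_ideal_iff)
    then show ?thesis
      using pB M.smult_l_distr[OF corner_mem[OF _ p] corner_mem[OF _ q] m]
      by (auto simp: t_def X_simps r_distr I_B intro!: restrict_ext)
  qed
  show "t (p, m \<oplus>\<^bsub>M\<^esub> n) = t (p, m) \<oplus>\<^bsub>X\<^esub> t (p, n)" if n: "n \<in> carrier M"
    using M.smult_r_distr[OF corner_mem[OF _ p] m n] by (auto simp: t_def X_simps intro!: restrict_ext)
  show "t (p \<otimes> r, m) = t (p, r \<odot>\<^bsub>M\<^esub> m)" if r: "r \<in> carrier (corner B e)"
    using M.smult_assoc[OF corner_mem[OF _ p] r m] r pB
    by (auto simp: t_def X_simps I_B carrier_corner m_assoc intro!: restrict_ext)
  show "t (b \<otimes> p, m) = b \<odot>\<^bsub>X\<^esub> t (p, m)" if "b \<in> carrier B"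
    using that pB by (auto simp: t_def X_simps I_times I_B m_assoc intro!: restrict_ext)
qed

lemma hom_F:
  assumes "h \<in> hom F (add_monoid X)"
  shows "h 0 = \<zero>\<^bsub>X\<^esub>"
    "\<And>x y. x \<in> carrier F \<Longrightarrow> y \<in> carrier F \<Longrightarrow> h (x - y) = h x \<ominus>\<^bsub>X\<^esub> h y"
    "\<And>x. x \<in> carrier F \<Longrightarrow> h x \<in> carrier X"
proof -
  interpret G: comm_group "add_monoid X" by (rule add_X)
  interpret h: group_hom F "add_monoid X" h
    by (rule group_hom.intro) (auto simp: group_hom_axioms_def assms intro: F.group_axioms G.group_axioms)
  show "h 0 = \<zero>\<^bsub>X\<^esub>" using h.hom_one by simp
  show "h (x - y) = h x \<ominus>\<^bsub>X\<^esub> h y" if "x \<in> carrier F" "y \<in> carrier F" for x y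
  proof -
    have "h (x \<otimes>\<^bsub>F\<^esub> inv\<^bsub>F\<^esub> y) = h x \<otimes>\<^bsub>add_monoid X\<^esub> inv\<^bsub>add_monoid X\<^esub> (h y)"
      using that by (simp del: F_simps monoid.simps)
    then show ?thesis using that by (simp add: F_def a_minus_def a_inv_def)
  qed
  show "h x \<in> carrier X" if "x \<in> carrier F" for x
    using h.hom_closed[OF that] by simp
qed

text \<open>Existence for the definite description in \<open>canonical_map\<close>. The additive
  extension \<open>h\<close> of \<open>t\<close> to the free group is exported along with
  \<open>z\<close>, since both have the same image and \<open>h\<close> is easier to compute
  with.\<close>

lemma exists_canonical:
  obtains h z where "h \<in> hom F (add_monoid X)" "\<And>s. s \<in> S \<Longrightarrow> h (frag_of s) = t s"
    "z \<in> mhom B (left_extension B e M) X" "\<And>x. x \<in> carrier F \<Longrightarrow> z (N #>\<^bsub>F\<^esub> x) = h x"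
proof -
  interpret X: left_module B X by (rule left_module_X)
  obtain h where h: "h \<in> hom F (add_monoid X)" and hS: "\<And>s. s \<in> S \<Longrightarrow> h (frag_of s) = t s"
    using comm_group.free_Abelian_group_universal[OF add_X, of t S] t_closed unfolding F_def by auto
  interpret h: group_hom F "add_monoid X" h
    by (rule group_hom.intro) (auto simp: group_hom_axioms_def h intro: F.group_axioms comm_group.axioms(2)[OF add_X])
  note hF = hom_F[OF h]
  have hof: "h (frag_of (p, m)) = t (p, m)" if "p \<in> left_ideal B e" "m \<in> carrier M" for p m
    using hS that by (simp add: S_def)
  have tX: "t (p, m) \<in> carrier X" if "p \<in> left_ideal B e" "m \<in> carrier M" for p m
    using that t_closed by (auto simp: S_def)
  have canc: "f \<oplus>\<^bsub>X\<^esub> g \<ominus>\<^bsub>X\<^esub> f \<ominus>\<^bsub>X\<^esub> g = \<zero>\<^bsub>X\<^esub>" if "f \<in> carrier X" "g \<in> carrier X" for f g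
    using that by (rule X.M.add_minus_minus)
  have "rels \<subseteq> kernel F (add_monoid X) h"
  proof
    fix x assume x: "x \<in> rels"
    have xF: "x \<in> carrier F" using x rels_subset by blast
    from x have "h x = \<zero>\<^bsub>X\<^esub>"
    proof (cases rule: rels_cases)
      case (1 p q m)
      then have "h x = t (p \<oplus> q, m) \<ominus>\<^bsub>X\<^esub> t (p, m) \<ominus>\<^bsub>X\<^esub> t (q, m)"
        by (simp add: hF F_of F_diff hof left_ideal_closed del: F_simps)
      then show ?thesis unfolding t_simps(1)[OF 1(2-4)] using canc tX 1 by simp
    next
      case (2 p m n)
      then have "h x = t (p, m \<oplus>\<^bsub>M\<^esub> n) \<ominus>\<^bsub>X\<^esub> t (p, m) \<ominus>\<^bsub>X\<^esub> t (p, n)"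
        by (simp add: hF F_of F_diff hof del: F_simps)
      then show ?thesis unfolding t_simps(2)[OF 2(2-4)] using canc tX 2 by simp
    next
      case (3 p r m)
      then have "h x = t (p \<otimes> r, m) \<ominus>\<^bsub>X\<^esub> t (p, r \<odot>\<^bsub>M\<^esub> m)"
        by (simp add: hF F_of F_diff hof left_ideal_closed M.smult_closed del: F_simps corner_simps(1))
      then show ?thesis unfolding t_simps(3)[OF 3(2-4)]
        using tX[OF 3(2) M.smult_closed[OF 3(3,4)]] by (simp add: X.M.minus_eq_zero_iff)
    qed
    then show "x \<in> kernel F (add_monoid X) h" using xF by (simp add: kernel_def)
  qed
  then have ker: "N \<subseteq> kernel F (add_monoid X) h"
    unfolding N_eq by (rule F.generate_subgroup_incl[OF _ h.subgroup_kernel])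
  obtain g where g: "g \<in> hom (F Mod N) (add_monoid X)"
    and gh: "\<And>x. x \<in> carrier F \<Longrightarrow> g (N #>\<^bsub>F\<^esub> x) = h x"
    using h.FactGroup_universal_kernel[OF N_normal ker] by metis
  interpret Q: comm_group "F Mod N" by (rule F.abelian_FactGroup[OF N_subgroup])
  define z where "z = restrict g (carrier (F Mod N))"
  have z: "z (N #>\<^bsub>F\<^esub> x) = h x" if "x \<in> carrier F" for x
    using gh[OF that] that by (auto simp: z_def carrier_Mod)
  \<comment> \<open>Linearity over \<open>B\<close> reduces to free generators, where it is the last
    identity of \<open>t_simps\<close>.\<close>
  have hact: "h (act b x) = b \<odot>\<^bsub>X\<^esub> h x" if "x \<in> carrier F" "b \<in> carrier B" for b x
    using that(1)
  proof (induction rule: F_induct)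
    case zero
    then show ?case using hF(1) X.smult_r_null[OF that(2)] by (simp)
  next
    case (diff x y)
    then show ?case
      using hF(3) act_closed[OF that(2)] that(2)
      by (simp add: frag_extend_diff hF(2) a_minus_def X.smult_r_distr X.smult_r_minus del: F_simps)
  next
    case (of p m)
    then show ?case
      using that(2) by (simp add: hof left_ideal_closed t_simps(4) del: F_simps)
  qed
  have "z \<in> mhom B (left_extension B e M) X"
  proof (rule mhomI)
    fix Z assume "Z \<in> carrier (left_extension B e M)"
    then show "z Z \<in> carrier X" using g by (auto simp: z_def hom_def)
  next
    fix Z Z' assume "Z \<in> carrier (left_extension B e M)" "Z' \<in> carrier (left_extension B e M)"
    then show "z (Z \<oplus>\<^bsub>left_extension B e M\<^esub> Z') = z Z \<oplus>\<^bsub>X\<^esub> z Z'"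
      using g Q.m_closed[of Z Z'] by (simp add: z_def hom_def del: mult_FactGroup)
  next
    fix b Z assume b: "b \<in> carrier B" and "Z \<in> carrier (left_extension B e M)"
    then obtain x where x: "x \<in> carrier F" "Z = N #>\<^bsub>F\<^esub> x" by (auto simp: carrier_Mod)
    show "z (b \<odot>\<^bsub>left_extension B e M\<^esub> Z) = b \<odot>\<^bsub>X\<^esub> z Z"
      unfolding x(2) act_coset[OF b x(1)] z[OF act_closed[OF b x(1)]] z[OF x(1)]
      by (rule hact[OF x(1) b])
  qed (auto simp: z_def)
  then show ?thesis using that[OF h hS _ z] by blast
qed

text \<open>The canonical map has the same image as its lift to the free group, which is generated
  by the images of the free generators. After this the tensor product no longer appears.\<close>

lemma intermediate_extension_carrier:
  "carrier (intermediate_extension B e M) =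
    generate (add_monoid X) {\<lambda>x\<in>carrier I. (x \<otimes> p) \<odot>\<^bsub>M\<^esub> m | p m. p \<in> left_ideal B e \<and> m \<in> carrier M}"
    (is "_ = generate _ ?T")
proof -
  interpret G: comm_group "add_monoid X" by (rule add_X)
  interpret X: left_module B X by (rule left_module_X)
  obtain h z where h: "h \<in> hom F (add_monoid X)" and hS: "\<And>s. s \<in> S \<Longrightarrow> h (frag_of s) = t s"
    and z: "z \<in> mhom B (left_extension B e M) X" and zh: "\<And>x. x \<in> carrier F \<Longrightarrow> z (N #>\<^bsub>F\<^esub> x) = h x"
    by (rule exists_canonical, rule that)
  interpret h: group_hom F "add_monoid X" h
    by (rule group_hom.intro) (auto simp: group_hom_axioms_def h intro: F.group_axioms G.group_axioms)
  have T: "?T = t ` S" by (auto simp: t_def S_def image_iff)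
  have "canonical_map B e M = z"
    unfolding canonical_map_def
  proof (rule the_equality)
    show "z \<in> mhom B (left_extension B e M) X \<and>
      (\<forall>p\<in>left_ideal B e. \<forall>m\<in>carrier M. z (pure_tensor B e M p m) = (\<lambda>x\<in>carrier I. (x \<otimes> p) \<odot>\<^bsub>M\<^esub> m))"
      using z zh[OF F_of] hS by (auto simp: pure_tensor_eq t_def S_def simp del: F_simps)
  next
    \<comment> \<open>Uniqueness: precomposed with the quotient map, two candidates are
      homomorphisms on the free group that agree on its generators.\<close>
    fix z' assume z': "z' \<in> mhom B (left_extension B e M) X \<and>
      (\<forall>p\<in>left_ideal B e. \<forall>m\<in>carrier M. z' (pure_tensor B e M p m) = (\<lambda>x\<in>carrier I. (x \<otimes> p) \<odot>\<^bsub>M\<^esub> m))"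
    have hom: "(\<lambda>x. y (N #>\<^bsub>F\<^esub> x)) \<in> hom F (add_monoid X)"
      if "y \<in> mhom B (left_extension B e M) X" for y
    proof (rule homI)
      fix a b assume ab: "a \<in> carrier F" "b \<in> carrier F"
      then have "y ((N #>\<^bsub>F\<^esub> a) \<oplus>\<^bsub>left_extension B e M\<^esub> (N #>\<^bsub>F\<^esub> b))
          = y (N #>\<^bsub>F\<^esub> a) \<oplus>\<^bsub>X\<^esub> y (N #>\<^bsub>F\<^esub> b)"
        by (intro mhomD(3)[OF that]) (auto simp: carrier_Mod simp del: F_simps)
      then show "y (N #>\<^bsub>F\<^esub> (a \<otimes>\<^bsub>F\<^esub> b)) = y (N #>\<^bsub>F\<^esub> a) \<otimes>\<^bsub>add_monoid X\<^esub> y (N #>\<^bsub>F\<^esub> b)"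
        using normal.rcos_sum[OF N_normal ab] by (simp del: F_simps)
    qed (use mhomD(2)[OF that] in \<open>auto simp: carrier_Mod simp del: F_simps\<close>)
    note hom' = hom_F[OF hom[OF conjunct1[OF z']]] and homz = hom_F[OF hom[OF z]]
    have "z' (N #>\<^bsub>F\<^esub> x) = z (N #>\<^bsub>F\<^esub> x)" if "x \<in> carrier F" for x
      using that
    proof (induction rule: F_induct)
      case zero
      then show ?case using hom'(1) homz(1) by simp
    next
      case (diff x y)
      then show ?case using hom'(2) homz(2) by (simp del: F_simps)
    next
      case (of p m)
      then show ?case using z' zh[OF F_of] hS by (auto simp: pure_tensor_eq t_def S_def simp del: F_simps)
    qed
    then show "z' = z"
      using mhomD(1)[OF conjunct1[OF z']] mhomD(1)[OF z]
      by (auto simp: carrier_Mod intro!: extensionalityI[of _ "carrier (F Mod N)"])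
  qed
  then have "carrier (intermediate_extension B e M) = z ` (\<lambda>x. N #>\<^bsub>F\<^esub> x) ` carrier F"
    by (simp add: intermediate_extension_def carrier_Mod)
  also have "\<dots> = h ` carrier F" unfolding image_image by (rule image_cong) (auto simp: zh simp del: F_simps)
  also have "\<dots> = generate (add_monoid X) ?T"
  proof
    show "generate (add_monoid X) ?T \<subseteq> h ` carrier F"
    proof (rule G.generate_subgroup_incl[OF _ h.img_is_subgroup])
      show "?T \<subseteq> h ` carrier F"
        unfolding T by (auto simp: S_def simp flip: hS simp del: F_simps intro!: F_of)
    qed
    have "subgroup (generate (add_monoid X) ?T) (add_monoid X)"
      unfolding T by (rule G.generate_is_subgroup) (use t_closed in auto)
    note gen = this
    show "h ` carrier F \<subseteq> generate (add_monoid X) ?T"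
    proof (rule image_subsetI)
      fix x assume "x \<in> carrier F"
      then show "h x \<in> generate (add_monoid X) ?T"
      proof (induction rule: F_induct)
        case zero
        have "h 0 = \<one>\<^bsub>add_monoid X\<^esub>" using hom_F(1)[OF h] by simp
        with subgroup.one_closed[OF gen] show ?case by (simp only:)
      next
        case (diff x y)
        then have "h x \<otimes>\<^bsub>add_monoid X\<^esub> inv\<^bsub>add_monoid X\<^esub> (h y) \<in> generate (add_monoid X) ?T"
          by (intro subgroup.m_closed[OF gen] subgroup.m_inv_closed[OF gen])
        moreover have "h (x - y) = h x \<otimes>\<^bsub>add_monoid X\<^esub> inv\<^bsub>add_monoid X\<^esub> (h y)"
          using diff(1,2) by (simp add: hom_F(2)[OF h] a_minus_def a_inv_def del: F_simps)
        ultimately show ?case by (simp only:)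
      next
        case (of p m)
        then have "h (frag_of (p, m)) \<in> ?T" using hS[of "(p, m)"] unfolding T by (auto simp: S_def)
        then show ?case by (rule generate.incl)
      qed
    qed
  qed
  finally show ?thesis .
qed

section \<open>Recognizing an intermediate extension\<close>

lemma intermediate_extension_simps [simp]:
  "\<zero>\<^bsub>intermediate_extension B e M\<^esub> = \<zero>\<^bsub>X\<^esub>"
  "add (intermediate_extension B e M) = add X"
  "smult (intermediate_extension B e M) = smult X"
  by (simp_all add: intermediate_extension_def)

text \<open>The isomorphism is built from \<open>P\<close> to the intermediate extension:
  \<open>\<theta> n\<close> sends \<open>x\<close> in \<open>eB\<close> to the element of
  \<open>M\<close> whose image under \<open>\<psi>\<close> is \<open>x n\<close>. It takes
  \<open>p \<psi>(m)\<close> to \<open>t (p, m)\<close>, which together with \<open>gen\<close>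
  identifies its image, while \<open>nondeg\<close> makes it injective.\<close>

lemma intermediate_extension_iso:
  fixes P :: "('b, 'n) module"
  assumes P: "left_module B P"
    and \<psi>: "\<And>m. m \<in> carrier M \<Longrightarrow> \<psi> m \<in> carrier P"
    and \<psi>_add: "\<And>m n. m \<in> carrier M \<Longrightarrow> n \<in> carrier M \<Longrightarrow> \<psi> (m \<oplus>\<^bsub>M\<^esub> n) = \<psi> m \<oplus>\<^bsub>P\<^esub> \<psi> n"
    and \<psi>_smult: "\<And>r m. r \<in> carrier (corner B e) \<Longrightarrow> m \<in> carrier M \<Longrightarrow>
      \<psi> (r \<odot>\<^bsub>M\<^esub> m) = r \<odot>\<^bsub>P\<^esub> \<psi> m"
    and inj: "inj_on \<psi> (carrier M)"
    and gen: "\<And>U. submodule U B P \<Longrightarrow> \<psi> ` carrier M \<subseteq> U \<Longrightarrow> U = carrier P"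
    and nondeg: "\<And>n. n \<in> carrier P \<Longrightarrow> (\<And>x. x \<in> carrier (right_ideal_module B e) \<Longrightarrow>
      x \<odot>\<^bsub>P\<^esub> n = \<zero>\<^bsub>P\<^esub>) \<Longrightarrow> n = \<zero>\<^bsub>P\<^esub>"
  shows "mod_iso B (intermediate_extension B e M) P"
proof -
  note [simp del] = corner_simps(1)
  interpret P: left_module B P by (rule P)
  interpret X: left_module B X by (rule left_module_X)
  have \<psi>0: "\<psi> \<zero>\<^bsub>M\<^esub> = \<zero>\<^bsub>P\<^esub>"
    using \<psi>_add[of "\<zero>\<^bsub>M\<^esub>" "\<zero>\<^bsub>M\<^esub>"] \<psi>[of "\<zero>\<^bsub>M\<^esub>"] P.M.add.l_cancel_one by simp
  have e\<psi>: "e \<odot>\<^bsub>P\<^esub> \<psi> m = \<psi> m" if "m \<in> carrier M" for m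
    using \<psi>_smult[of e m] that M.smult_one[of m] by (simp add: carrier_corner)
  have x\<psi>: "x \<odot>\<^bsub>P\<^esub> (p \<odot>\<^bsub>P\<^esub> \<psi> m) = \<psi> ((x \<otimes> p) \<odot>\<^bsub>M\<^esub> m)"
    if "x \<in> carrier I" "p \<in> left_ideal B e" "m \<in> carrier M" for x p m
    using that I_B[of x] \<psi> by (simp add: \<psi>_smult corner_mem P.smult_assoc left_ideal_iff)
  have e_left: "e \<in> left_ideal B e" by (simp add: left_ideal_iff)
  \<comment> \<open>This set makes \<open>\<theta>\<close> well defined: \<open>x n\<close> must lie
    in the image of \<open>\<psi>\<close>. It is closed under \<open>B\<close> because
    \<open>eB\<close> is a right ideal, and it contains the copy of \<open>M\<close> because
    \<open>eBe\<close> acts there through \<open>M\<close>.\<close>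
  define U where "U = {n \<in> carrier P. \<forall>x\<in>carrier I. x \<odot>\<^bsub>P\<^esub> n \<in> \<psi> ` carrier M}"
  have "U = carrier P"
  proof (rule gen)
    show "submodule U B P"
    proof (rule P.submodule_I)
      show "\<zero>\<^bsub>P\<^esub> \<in> U"
        using \<psi>0 I_B by (auto simp: U_def P.smult_r_null intro!: image_eqI[of _ _ "\<zero>\<^bsub>M\<^esub>"])
    next
      fix n n' assume n: "n \<in> U" "n' \<in> U"
      have "x \<odot>\<^bsub>P\<^esub> (n \<oplus>\<^bsub>P\<^esub> n') \<in> \<psi> ` carrier M" if x: "x \<in> carrier I" for x
      proof -
        obtain m m' where "m \<in> carrier M" "x \<odot>\<^bsub>P\<^esub> n = \<psi> m" "m' \<in> carrier M" "x \<odot>\<^bsub>P\<^esub> n' = \<psi> m'"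
          using n x by (force simp: U_def)
        then show ?thesis using n x I_B
          by (auto simp: U_def P.smult_r_distr \<psi>_add intro!: image_eqI[of _ _ "m \<oplus>\<^bsub>M\<^esub> m'"])
      qed
      then show "n \<oplus>\<^bsub>P\<^esub> n' \<in> U" using n by (auto simp: U_def)
    next
      fix b n assume "b \<in> carrier B" "n \<in> U"
      then show "b \<odot>\<^bsub>P\<^esub> n \<in> U"
        by (auto simp: U_def P.smult_closed I_B I_times simp flip: P.smult_assoc)
    qed (auto simp: U_def)
    show "\<psi> ` carrier M \<subseteq> U"
    proof
      fix n assume "n \<in> \<psi> ` carrier M"
      then obtain m where m: "n = \<psi> m" "m \<in> carrier M" by auto
      then show "n \<in> U"
        using \<psi> x\<psi>[OF _ e_left m(2)] e\<psi>[OF m(2)] M.smult_closed[OF corner_mem[OF _ e_left] m(2)]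
        by (auto simp: U_def)
    qed
  qed
  then have val: "x \<odot>\<^bsub>P\<^esub> n \<in> \<psi> ` carrier M" if "n \<in> carrier P" "x \<in> carrier I" for n x
    using that by (auto simp: U_def)
  define \<theta> where "\<theta> = (\<lambda>n. \<lambda>x\<in>carrier I. inv_into (carrier M) \<psi> (x \<odot>\<^bsub>P\<^esub> n))"
  have \<theta>: "\<theta> n x \<in> carrier M" "\<psi> (\<theta> n x) = x \<odot>\<^bsub>P\<^esub> n" if "n \<in> carrier P" "x \<in> carrier I" for n x
    using inv_into_into[OF val[OF that]] f_inv_into_f[OF val[OF that]] that by (auto simp: \<theta>_def)
  have \<theta>I: "\<theta> n x = m" if "n \<in> carrier P" "x \<in> carrier I" "m \<in> carrier M" "\<psi> m = x \<odot>\<^bsub>P\<^esub> n" for n x m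
    using inj_onD[OF inj, of "\<theta> n x" m] that \<theta> by simp
  have \<theta>_ext: "\<theta> n \<in> extensional (carrier I)" for n by (simp add: \<theta>_def)
  have \<theta>X: "\<theta> n \<in> carrier X" if n: "n \<in> carrier P" for n
  proof (rule X_memI)
    show "\<theta> n (x \<oplus> y) = \<theta> n x \<oplus>\<^bsub>M\<^esub> \<theta> n y" if "x \<in> carrier I" "y \<in> carrier I" for x y
      using that n by (intro \<theta>I) (auto simp: I_add \<theta> \<psi>_add P.smult_l_distr I_B)
    show "\<theta> n (r \<otimes> x) = r \<odot>\<^bsub>M\<^esub> \<theta> n x" if "r \<in> carrier (corner B e)" "x \<in> carrier I" for r x
      using that n left_module.smult_closed[OF left_module_I that]
      by (intro \<theta>I) (auto simp: \<theta> \<psi>_smult M.smult_closed P.smult_assoc I_B carrier_corner)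
  qed (use n \<theta> \<theta>_ext in auto)
  have \<theta>_add: "\<theta> (n \<oplus>\<^bsub>P\<^esub> n') = \<theta> n \<oplus>\<^bsub>X\<^esub> \<theta> n'" if "n \<in> carrier P" "n' \<in> carrier P" for n n'
  proof (rule extensionalityI[OF \<theta>_ext])
    show "\<theta> n \<oplus>\<^bsub>X\<^esub> \<theta> n' \<in> extensional (carrier I)" by (simp add: X_simps)
    show "\<theta> (n \<oplus>\<^bsub>P\<^esub> n') x = (\<theta> n \<oplus>\<^bsub>X\<^esub> \<theta> n') x" if x: "x \<in> carrier I" for x
      using x \<open>n \<in> _\<close> \<open>n' \<in> _\<close>
      by (intro \<theta>I) (auto simp: X_simps \<theta> \<psi>_add P.smult_r_distr I_B)
  qed
  have \<theta>_smult: "\<theta> (b \<odot>\<^bsub>P\<^esub> n) = b \<odot>\<^bsub>X\<^esub> \<theta> n" if "b \<in> carrier B" "n \<in> carrier P" for b n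
  proof (rule extensionalityI[OF \<theta>_ext])
    show "b \<odot>\<^bsub>X\<^esub> \<theta> n \<in> extensional (carrier I)" by (simp add: X_simps)
    show "\<theta> (b \<odot>\<^bsub>P\<^esub> n) x = (b \<odot>\<^bsub>X\<^esub> \<theta> n) x" if x: "x \<in> carrier I" for x
      using x \<open>b \<in> _\<close> \<open>n \<in> _\<close>
      by (intro \<theta>I) (auto simp: X_simps \<theta> I_times I_B P.smult_closed P.smult_assoc)
  qed
  have \<theta>_t: "\<theta> (p \<odot>\<^bsub>P\<^esub> \<psi> m) = t (p, m)" if pm: "p \<in> left_ideal B e" "m \<in> carrier M" for p m
  proof (rule extensionalityI[OF \<theta>_ext])
    show "t (p, m) \<in> extensional (carrier I)" by (simp add: t_def)
    show "\<theta> (p \<odot>\<^bsub>P\<^esub> \<psi> m) x = t (p, m) x" if x: "x \<in> carrier I" for x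
      using x pm x\<psi>[OF x pm] \<psi>[OF pm(2)] M.smult_closed[OF corner_mem[OF x pm(1)] pm(2)]
      by (intro \<theta>I) (auto simp: t_def P.smult_closed left_ideal_iff)
  qed
  define T where "T = {\<lambda>x\<in>carrier I. (x \<otimes> p) \<odot>\<^bsub>M\<^esub> m | p m. p \<in> left_ideal B e \<and> m \<in> carrier M}"
  have T: "T = {t (p, m) | p m. p \<in> left_ideal B e \<and> m \<in> carrier M}"
    by (simp add: T_def t_def)
  have TX: "T \<subseteq> carrier X" using t_closed by (auto simp: T S_def)
  define C where "C = generate (add_monoid X) T"
  have C: "subgroup C (add_monoid X)"
    unfolding C_def by (rule X.M.add.generate_is_subgroup[OF TX])
  have C_sub: "C \<subseteq> H" if "subgroup H (add_monoid X)" "T \<subseteq> H" for H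
    unfolding C_def by (rule X.M.add.generate_subgroup_incl[OF that(2,1)])
  have C_smult: "b \<odot>\<^bsub>X\<^esub> f \<in> C" if "b \<in> carrier B" "f \<in> C" for b f
  proof -
    let ?H = "{f \<in> carrier X. b \<odot>\<^bsub>X\<^esub> f \<in> C}"
    have "subgroup ?H (add_monoid X)"
    proof (rule X.M.add.subgroupI)
      have "\<zero>\<^bsub>X\<^esub> \<in> ?H" using that(1) subgroup.one_closed[OF C] by (simp add: X.smult_r_null)
      then show "?H \<noteq> {}" by blast
      fix f assume f: "f \<in> ?H"
      show "\<ominus>\<^bsub>X\<^esub> f \<in> ?H"
        using f that(1) subgroup.m_inv_closed[OF C, of "b \<odot>\<^bsub>X\<^esub> f"]
        by (simp add: X.smult_r_minus flip: a_inv_def)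
    next
      fix f g assume "f \<in> ?H" "g \<in> ?H"
      then show "f \<oplus>\<^bsub>X\<^esub> g \<in> ?H"
        using that(1) subgroup.m_closed[OF C, of "b \<odot>\<^bsub>X\<^esub> f" "b \<odot>\<^bsub>X\<^esub> g"] by (simp add: X.smult_r_distr)
    qed auto
    moreover have "T \<subseteq> ?H"
    proof
      fix f assume "f \<in> T"
      then obtain p m where f: "f = t (p, m)" and p: "p \<in> left_ideal B e" and m: "m \<in> carrier M"
        by (auto simp: T)
      have "b \<odot>\<^bsub>X\<^esub> f \<in> T"
        using t_simps(4)[OF that(1) p m, symmetric] left_ideal_closed(3)[OF that(1) p] m unfolding f T by blast
      then show "f \<in> ?H" using \<open>f \<in> T\<close> TX unfolding C_def by (auto intro: generate.incl)
    qed
    ultimately show ?thesis using C_sub that(2) by blast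
  qed
  \<comment> \<open>The preimage of \<open>C\<close> is a submodule containing the copy of
    \<open>M\<close>, so \<open>\<theta>\<close> maps all of \<open>P\<close> into the intermediate
    extension. The reverse inclusion follows because the generators of \<open>C\<close> are values
    of \<open>\<theta>\<close>.\<close>
  have "{n \<in> carrier P. \<theta> n \<in> C} = carrier P"
  proof (rule gen)
    have "\<theta> \<zero>\<^bsub>P\<^esub> = \<zero>\<^bsub>X\<^esub>"
      using \<theta>_add[of "\<zero>\<^bsub>P\<^esub>" "\<zero>\<^bsub>P\<^esub>"] \<theta>X[of "\<zero>\<^bsub>P\<^esub>"] X.M.add.l_cancel_one by simp
    then have "\<theta> \<zero>\<^bsub>P\<^esub> \<in> C" using subgroup.one_closed[OF C] by simp
    then show "submodule {n \<in> carrier P. \<theta> n \<in> C} B P"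
      using subgroup.m_closed[OF C] C_smult
      by (intro P.submodule_I) (auto simp: \<theta>_add \<theta>_smult P.smult_closed)
    have "\<theta> (\<psi> m) \<in> C" if "m \<in> carrier M" for m
    proof -
      have "\<theta> (\<psi> m) \<in> T" using \<theta>_t[OF e_left that] that e_left by (auto simp: e\<psi> T)
      then show ?thesis by (simp add: C_def generate.incl)
    qed
    then show "\<psi> ` carrier M \<subseteq> {n \<in> carrier P. \<theta> n \<in> C}" using \<psi> by auto
  qed
  then have "\<theta> ` carrier P \<subseteq> C" by auto
  moreover have "C \<subseteq> \<theta> ` carrier P"
  proof (rule C_sub)
    show "subgroup (\<theta> ` carrier P) (add_monoid X)"
    proof (rule X.M.add.subgroupI)
      show "\<theta> ` carrier P \<noteq> {}" using P.M.zero_closed by blast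
      show "\<theta> ` carrier P \<subseteq> carrier X" using \<theta>X by auto
      fix f assume "f \<in> \<theta> ` carrier P"
      then obtain n where n: "f = \<theta> n" "n \<in> carrier P" by auto
      have "\<theta> (\<ominus>\<^bsub>B\<^esub> \<one>\<^bsub>B\<^esub> \<odot>\<^bsub>P\<^esub> n) = \<ominus>\<^bsub>X\<^esub> f"
        using \<theta>_smult[of "\<ominus>\<^bsub>B\<^esub> \<one>\<^bsub>B\<^esub>" n] n \<theta>X[of n] by (simp add: X.smult_l_minus X.smult_one)
      moreover have "\<ominus>\<^bsub>B\<^esub> \<one>\<^bsub>B\<^esub> \<odot>\<^bsub>P\<^esub> n \<in> carrier P" using n by (simp add: P.smult_closed)
      ultimately show "\<ominus>\<^bsub>X\<^esub> f \<in> \<theta> ` carrier P" by (metis imageI)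
    next
      fix f g assume "f \<in> \<theta> ` carrier P" "g \<in> \<theta> ` carrier P"
      then show "f \<oplus>\<^bsub>X\<^esub> g \<in> \<theta> ` carrier P"
        by (auto simp flip: \<theta>_add)
    qed
    show "T \<subseteq> \<theta> ` carrier P"
      using \<psi> by (auto simp: T left_ideal_iff simp flip: \<theta>_t intro!: imageI P.smult_closed)
  qed
  ultimately have image: "\<theta> ` carrier P = carrier (intermediate_extension B e M)"
    by (simp add: intermediate_extension_carrier C_def T_def)
  have "inj_on \<theta> (carrier P)"
  proof (rule inj_onI)
    fix n n' assume n: "n \<in> carrier P" "n' \<in> carrier P" "\<theta> n = \<theta> n'"
    have "n \<ominus>\<^bsub>P\<^esub> n' = \<zero>\<^bsub>P\<^esub>"
    proof (rule nondeg)
      fix x assume x: "x \<in> carrier I"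
      have "x \<odot>\<^bsub>P\<^esub> n = x \<odot>\<^bsub>P\<^esub> n'" using \<theta>(2)[OF n(1) x] \<theta>(2)[OF n(2) x] n(3) by simp
      then show "x \<odot>\<^bsub>P\<^esub> (n \<ominus>\<^bsub>P\<^esub> n') = \<zero>\<^bsub>P\<^esub>"
        using n I_B[OF x] by (simp add: a_minus_def P.smult_r_distr P.smult_r_minus P.M.r_neg P.smult_closed)
    qed (use n in auto)
    then show "n = n'" using n by (simp add: P.M.minus_eq_zero_iff)
  qed
  then have "bij_betw (restrict \<theta> (carrier P)) (carrier P) (carrier (intermediate_extension B e M))"
    using image by (simp add: bij_betw_def inj_on_def cong: image_cong)
  moreover have "restrict \<theta> (carrier P) \<in> mhom B P (intermediate_extension B e M)"
    using image by (intro mhomI) (auto simp: \<theta>_add \<theta>_smult P.smult_closed)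
  ultimately have "mod_iso B P (intermediate_extension B e M)"
    unfolding mod_iso_def by (rule bexI)
  then show ?thesis by (rule mod_iso_sym[OF P])
qed

end


section \<open>Algebras and endomorphisms of complexes\<close>

lemma opposite_simps [simp]:
  "carrier (opposite A) = carrier A" "\<zero>\<^bsub>opposite A\<^esub> = \<zero>\<^bsub>A\<^esub>" "\<one>\<^bsub>opposite A\<^esub> = \<one>\<^bsub>A\<^esub>"
  "add (opposite A) = add A" "smult (opposite A) = smult A" "x \<otimes>\<^bsub>opposite A\<^esub> y = y \<otimes>\<^bsub>A\<^esub> x"
  by (simp_all add: opposite_def)

lemma ring_opposite:
  assumes "ring A" shows "ring (opposite A)"
proof -
  interpret ring A by fact
  show ?thesis
  proof (rule ringI)
    show "abelian_group (opposite A)"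
      by (rule abelian_group_cong[OF abelian_group_axioms]) auto
    show "monoid (opposite A)" by (rule monoidI) (auto simp: m_assoc)
  qed (auto simp: l_distr r_distr)
qed

lemma hom_space_simps [simp]:
  "carrier (hom_space A M N) = mhom A M N" "\<zero>\<^bsub>hom_space A M N\<^esub> = zero_map M N"
  "f \<oplus>\<^bsub>hom_space A M N\<^esub> g = (\<lambda>x\<in>carrier M. f x \<oplus>\<^bsub>N\<^esub> g x)"
  "c \<odot>\<^bsub>hom_space A M N\<^esub> f = (\<lambda>x\<in>carrier M. (c \<odot>\<^bsub>A\<^esub> \<one>\<^bsub>A\<^esub>) \<odot>\<^bsub>N\<^esub> f x)"
  by (simp_all add: hom_space_def)

lemma abelian_group_hom_space:
  assumes "left_module A M" "left_module A N"
  shows "abelian_group (hom_space A M N)"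
proof -
  interpret N: left_module A N by fact
  show ?thesis
  proof (rule abelian_group_pointwise[OF N.M.abelian_group_axioms, of _ "carrier M"])
    show "carrier (hom_space A M N) \<subseteq> carrier M \<rightarrow>\<^sub>E carrier N" by (auto simp: mhom_def)
  qed (use mhom_zero_map[OF assms] mhom_add[OF assms] mhom_minus[OF assms] in \<open>auto simp: zero_map_def\<close>)
qed

lemma end_algebra_simps [simp]:
  "carrier (end_algebra A M) = mhom A M M" "\<zero>\<^bsub>end_algebra A M\<^esub> = zero_map M M"
  "\<one>\<^bsub>end_algebra A M\<^esub> = (\<lambda>x\<in>carrier M. x)"
  "f \<oplus>\<^bsub>end_algebra A M\<^esub> g = (\<lambda>x\<in>carrier M. f x \<oplus>\<^bsub>M\<^esub> g x)"
  "f \<otimes>\<^bsub>end_algebra A M\<^esub> g = compose (carrier M) f g"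
  by (simp_all add: end_algebra_def hom_space_def module_record_def)

lemma ring_end_algebra:
  assumes "left_module A M"
  shows "ring (end_algebra A M)"
proof -
  interpret left_module A M by fact
  have ext: "f = g" if "f \<in> mhom A M M" "g \<in> mhom A M M" "\<And>x. x \<in> carrier M \<Longrightarrow> f x = g x" for f g
    using mhom_eqI[OF that] by blast
  note comp = mhom_comp[OF assms] and D = mhomD[of _ A M M]
  show ?thesis
  proof (rule ringI)
    show "abelian_group (end_algebra A M)"
      by (rule abelian_group_cong[OF abelian_group_hom_space[OF assms assms]])
        (auto simp: end_algebra_def)
    show "monoid (end_algebra A M)"
      by (rule monoidI)
        (use comp mhom_id[OF assms] D in \<open>auto simp: compose_eq intro!: ext comp\<close>)
  next
    fix f g h assume "f \<in> carrier (end_algebra A M)" "g \<in> carrier (end_algebra A M)"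
      "h \<in> carrier (end_algebra A M)"
    then have m: "f \<in> mhom A M M" "g \<in> mhom A M M" "h \<in> mhom A M M" by simp_all
    note add = mhom_add[OF assms assms]
    show "(f \<oplus>\<^bsub>end_algebra A M\<^esub> g) \<otimes>\<^bsub>end_algebra A M\<^esub> h =
        f \<otimes>\<^bsub>end_algebra A M\<^esub> h \<oplus>\<^bsub>end_algebra A M\<^esub> g \<otimes>\<^bsub>end_algebra A M\<^esub> h"
      unfolding end_algebra_simps
      by (rule mhom_eqI[OF comp[OF m(3) add[OF m(1,2)]] add[OF comp[OF m(3,1)] comp[OF m(3,2)]]])
        (use D(2)[OF m(3)] in \<open>simp add: compose_eq\<close>)
    show "h \<otimes>\<^bsub>end_algebra A M\<^esub> (f \<oplus>\<^bsub>end_algebra A M\<^esub> g) =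
        h \<otimes>\<^bsub>end_algebra A M\<^esub> f \<oplus>\<^bsub>end_algebra A M\<^esub> h \<otimes>\<^bsub>end_algebra A M\<^esub> g"
      unfolding end_algebra_simps
      by (rule mhom_eqI[OF comp[OF add[OF m(1,2)] m(3)] add[OF comp[OF m(1,3)] comp[OF m(2,3)]]])
        (use D(2)[OF m(1)] D(2)[OF m(2)] D(3)[OF m(3)] in \<open>simp add: compose_eq\<close>)
  qed
qed

section \<open>Endomorphisms of a complex up to homotopy\<close>

locale module_complex = ring A for A :: "('k, 'a) module" (structure) +
  fixes X :: "('a, 'u) cochain_complex"
  assumes cterm_module: "left_module A (cterm X i)"
    and cdiff_hom: "cdiff X i \<in> mhom A (cterm X i) (cterm X (i + 1))"
begin

abbreviation "C \<equiv> chain_end_algebra A X"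

lemma chain_simps [simp]:
  "\<zero>\<^bsub>C\<^esub> = (\<lambda>i. zero_map (cterm X i) (cterm X i))"
  "\<one>\<^bsub>C\<^esub> = (\<lambda>i. \<lambda>x\<in>carrier (cterm X i). x)"
  "f \<oplus>\<^bsub>C\<^esub> g = (\<lambda>i. \<lambda>x\<in>carrier (cterm X i). f i x \<oplus>\<^bsub>cterm X i\<^esub> g i x)"
  "f \<otimes>\<^bsub>C\<^esub> g = (\<lambda>i. compose (carrier (cterm X i)) (f i) (g i))"
  by (simp_all add: chain_end_algebra_def)

lemma cdiff_hom':
  "cdiff X (i - 1) \<in> mhom A (cterm X (i - 1)) (cterm X i)"
  using cdiff_hom[of "i - 1"] by simp

lemma chain_iff:
  "f \<in> carrier C \<longleftrightarrow> (\<forall>i. f i \<in> mhom A (cterm X i) (cterm X i)) \<and>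
    (\<forall>i. \<forall>x\<in>carrier (cterm X i). cdiff X i (f i x) = f (i + 1) (cdiff X i x))"
  by (auto simp: chain_end_algebra_def compose_def restrict_def fun_eq_iff)

lemma chainD:
  assumes "f \<in> carrier C"
  shows "f i \<in> mhom A (cterm X i) (cterm X i)"
    "x \<in> carrier (cterm X i) \<Longrightarrow> cdiff X i (f i x) = f (i + 1) (cdiff X i x)"
  using assms by (auto simp: chain_iff)

lemma chain_eqI:
  assumes "f \<in> carrier C" "g \<in> carrier C" "\<And>i x. x \<in> carrier (cterm X i) \<Longrightarrow> f i x = g i x"
  shows "f = g"
proof
  fix i show "f i = g i"
    using mhom_eqI[OF chainD(1)[OF assms(1)] chainD(1)[OF assms(2)] assms(3)] .
qed

lemma chain_val:
  assumes "f \<in> carrier C" "x \<in> carrier (cterm X i)"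
  shows "f i x \<in> carrier (cterm X i)"
  by (rule mhomD(2)[OF chainD(1)[OF assms(1)] assms(2)])

lemma cdiff_simps:
  "x \<in> carrier (cterm X i) \<Longrightarrow> cdiff X i x \<in> carrier (cterm X (i + 1))"
  "x \<in> carrier (cterm X i) \<Longrightarrow> y \<in> carrier (cterm X i) \<Longrightarrow>
    cdiff X i (x \<oplus>\<^bsub>cterm X i\<^esub> y) = cdiff X i x \<oplus>\<^bsub>cterm X (i + 1)\<^esub> cdiff X i y"
  "x \<in> carrier (cterm X i) \<Longrightarrow> cdiff X i (\<ominus>\<^bsub>cterm X i\<^esub> x) = \<ominus>\<^bsub>cterm X (i + 1)\<^esub> cdiff X i x"
  using mhomD(2,3)[OF cdiff_hom] mhom_hom(2)[OF cdiff_hom cterm_module cterm_module] by auto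

lemma chain_add:
  assumes "f \<in> carrier C" "g \<in> carrier C"
  shows "f \<oplus>\<^bsub>C\<^esub> g \<in> carrier C"
  using chainD[OF assms(1)] chainD[OF assms(2)] cterm_module
  by (auto simp: chain_iff cdiff_simps chain_val[OF assms(1)] chain_val[OF assms(2)] intro!: mhom_add)

lemma chain_mult:
  assumes "f \<in> carrier C" "g \<in> carrier C"
  shows "f \<otimes>\<^bsub>C\<^esub> g \<in> carrier C"
  using chainD[OF assms(1)] chainD[OF assms(2)] cterm_module
  by (auto simp: chain_iff cdiff_simps chain_val[OF assms(1)] chain_val[OF assms(2)] compose_eq
      intro!: mhom_comp)

lemma chain_neg:
  assumes "f \<in> carrier C"
  shows "(\<lambda>i. \<lambda>x\<in>carrier (cterm X i). \<ominus>\<^bsub>cterm X i\<^esub> f i x) \<in> carrier C"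
  using chainD[OF assms] cterm_module
  by (auto simp: chain_iff cdiff_simps chain_val[OF assms] intro!: mhom_minus)

lemma chain_zero: "\<zero>\<^bsub>C\<^esub> \<in> carrier C"
  using mhom_zero_map[OF cterm_module cterm_module] mhom_hom(1)[OF cdiff_hom cterm_module cterm_module]
  by (auto simp: chain_iff zero_map_def mhomD(2)[OF cdiff_hom])

lemma chain_one: "\<one>\<^bsub>C\<^esub> \<in> carrier C"
  using mhom_id[OF cterm_module] by (auto simp: chain_iff mhomD(2)[OF cdiff_hom])

lemma cterm_ab: "abelian_group (cterm X i)"
  using cterm_module[of i] by (simp add: left_module_def)

lemma ring_chain: "ring C"
proof (rule ringI)
  note v = chain_val mhomD(3)[OF chainD(1)]
  note abm = abelian_group.axioms(1)[OF cterm_ab]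
  note ab = abelian_monoid.a_closed[OF abm] abelian_monoid.zero_closed[OF abm] abelian_monoid.a_assoc[OF abm]
  note cl = chain_add chain_mult chain_zero chain_one chain_neg
  note [simp del] = chain_simps
  have app: "(f \<oplus>\<^bsub>C\<^esub> g) i x = f i x \<oplus>\<^bsub>cterm X i\<^esub> g i x" "(f \<otimes>\<^bsub>C\<^esub> g) i x = f i (g i x)"
    "\<zero>\<^bsub>C\<^esub> i x = \<zero>\<^bsub>cterm X i\<^esub>" "\<one>\<^bsub>C\<^esub> i x = x"
    if "x \<in> carrier (cterm X i)" for f g i x
    using that by (simp_all add: chain_simps compose_eq zero_map_def)
  show "abelian_group C"
  proof (rule abelian_groupI)
    show "f \<oplus>\<^bsub>C\<^esub> g = g \<oplus>\<^bsub>C\<^esub> f" if "f \<in> carrier C" "g \<in> carrier C" for f g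
      using that chain_add[OF that] chain_add[OF that(2,1)]
      by (rule_tac chain_eqI) (simp_all add: app abelian_monoid.a_comm[OF abm] chain_val)
    show "\<exists>g\<in>carrier C. g \<oplus>\<^bsub>C\<^esub> f = \<zero>\<^bsub>C\<^esub>" if f: "f \<in> carrier C" for f
    proof (rule bexI[OF _ chain_neg[OF f]])
      show "(\<lambda>i. \<lambda>x\<in>carrier (cterm X i). \<ominus>\<^bsub>cterm X i\<^esub> f i x) \<oplus>\<^bsub>C\<^esub> f = \<zero>\<^bsub>C\<^esub>"
        using chain_neg[OF f] f v(1)[OF f] abelian_group.l_neg[OF cterm_ab]
        by (intro chain_eqI) (auto simp: app cl)
    qed
  qed (auto intro!: cl chain_eqI simp: app v ab abelian_monoid.l_zero[OF abm])
  show "monoid C"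
    by (rule monoidI) (auto intro!: cl chain_eqI simp: app v)
next
  note [simp del] = chain_simps
  fix f g h assume *: "f \<in> carrier C" "g \<in> carrier C" "h \<in> carrier C"
  show "(f \<oplus>\<^bsub>C\<^esub> g) \<otimes>\<^bsub>C\<^esub> h = f \<otimes>\<^bsub>C\<^esub> h \<oplus>\<^bsub>C\<^esub> g \<otimes>\<^bsub>C\<^esub> h"
    "h \<otimes>\<^bsub>C\<^esub> (f \<oplus>\<^bsub>C\<^esub> g) = h \<otimes>\<^bsub>C\<^esub> f \<oplus>\<^bsub>C\<^esub> h \<otimes>\<^bsub>C\<^esub> g"
    using * by (auto intro!: chain_add chain_mult chain_eqI)
      (simp_all add: chain_simps compose_eq chain_val mhomD(3)[OF chainD(1)])
qed

definition homotopy :: "(int \<Rightarrow> 'u \<Rightarrow> 'u) \<Rightarrow> (int \<Rightarrow> 'u \<Rightarrow> 'u) \<Rightarrow> bool" where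
  "homotopy f s \<longleftrightarrow> (\<forall>i. s i \<in> mhom A (cterm X i) (cterm X (i - 1))) \<and>
    (\<forall>i. \<forall>x\<in>carrier (cterm X i). f i x = cdiff X (i - 1) (s i x) \<oplus>\<^bsub>cterm X i\<^esub> s (i + 1) (cdiff X i x))"

lemma null_homotopic_iff:
  "f \<in> null_homotopic A X \<longleftrightarrow> f \<in> carrier C \<and> (\<exists>s. homotopy f s)"
proof -
  have "(\<forall>i. f i = compose (carrier (cterm X i)) (cdiff X (i - 1)) (s i)
          \<oplus>\<^bsub>end_algebra A (cterm X i)\<^esub> compose (carrier (cterm X i)) (s (i + 1)) (cdiff X i)) \<longleftrightarrow>
    (\<forall>i. \<forall>x\<in>carrier (cterm X i). f i x = cdiff X (i - 1) (s i x) \<oplus>\<^bsub>cterm X i\<^esub> s (i + 1) (cdiff X i x))"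
    if "f \<in> carrier C" for s
    using mhomD(1)[OF chainD(1)[OF that]]
    by (auto simp: compose_eq intro!: extensionalityI[of _ "carrier (cterm X i)" for i])
  then show ?thesis unfolding null_homotopic_def homotopy_def mem_Collect_eq by meson
qed

text \<open>If \<open>s\<close> is a null-homotopy of \<open>f\<close> and \<open>g\<close> is a
  chain map, then \<open>g s\<close> is one of \<open>g f\<close> and \<open>s g\<close> is one of
  \<open>f g\<close>, since \<open>g\<close> commutes with the differentials.\<close>

lemma ideal_null_homotopic: "ideal (null_homotopic A X) C"
proof -
  interpret C: ring C by (rule ring_chain)
  note [simp del] = chain_simps
  note app = chain_simps
  note cl = mhomD(2)[OF cdiff_hom] mhomD(2)[OF cdiff_hom']
  \<comment> \<open>The target of \<open>s (i + 1)\<close> is literally the term of degree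
    \<open>i + 1 - 1\<close>; the second form normalizes this index to \<open>i\<close>.\<close>
  have s': "homotopy f s \<Longrightarrow> s i \<in> mhom A (cterm X i) (cterm X (i - 1))"
    "homotopy f s \<Longrightarrow> s (i + 1) \<in> mhom A (cterm X (i + 1)) (cterm X i)" for f s i
    unfolding homotopy_def by (blast, metis add_diff_cancel_right')
  have left: "g \<otimes>\<^bsub>C\<^esub> f \<in> null_homotopic A X" if f: "f \<in> null_homotopic A X" and g: "g \<in> carrier C" for f g
  proof -
    obtain s where fC: "f \<in> carrier C" and s: "homotopy f s" using f by (auto simp: null_homotopic_iff)
    let ?s = "\<lambda>i. compose (carrier (cterm X i)) (g (i - 1)) (s i)"
    have "homotopy (g \<otimes>\<^bsub>C\<^esub> f) ?s"
      unfolding homotopy_def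
    proof (intro conjI allI ballI)
      fix i x assume x: "x \<in> carrier (cterm X i)"
      have "(g \<otimes>\<^bsub>C\<^esub> f) i x = g i (cdiff X (i - 1) (s i x)) \<oplus>\<^bsub>cterm X i\<^esub> g i (s (i + 1) (cdiff X i x))"
        using s x cl mhomD(2)[OF s'(1)[OF s]] mhomD(2)[OF s'(2)[OF s]]
        by (simp add: app compose_eq homotopy_def mhomD(3)[OF chainD(1)[OF g]])
      also have "g i (cdiff X (i - 1) (s i x)) = cdiff X (i - 1) (g (i - 1) (s i x))"
        using chainD(2)[OF g mhomD(2)[OF s'(1)[OF s] x]] by simp
      finally show "(g \<otimes>\<^bsub>C\<^esub> f) i x = cdiff X (i - 1) (?s i x) \<oplus>\<^bsub>cterm X i\<^esub> ?s (i + 1) (cdiff X i x)"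
        using x cl by (simp add: compose_eq)
    qed (intro mhom_comp[OF cterm_module s'(1)[OF s]] chainD(1)[OF g])
    then show ?thesis using fC g by (auto simp: null_homotopic_iff)
  qed
  have right: "f \<otimes>\<^bsub>C\<^esub> g \<in> null_homotopic A X" if f: "f \<in> null_homotopic A X" and g: "g \<in> carrier C" for f g
  proof -
    obtain s where fC: "f \<in> carrier C" and s: "homotopy f s" using f by (auto simp: null_homotopic_iff)
    let ?s = "\<lambda>i. compose (carrier (cterm X i)) (s i) (g i)"
    have "homotopy (f \<otimes>\<^bsub>C\<^esub> g) ?s"
      unfolding homotopy_def
    proof (intro conjI allI ballI)
      fix i x assume x: "x \<in> carrier (cterm X i)"
      have "(f \<otimes>\<^bsub>C\<^esub> g) i x = cdiff X (i - 1) (s i (g i x)) \<oplus>\<^bsub>cterm X i\<^esub> s (i + 1) (cdiff X i (g i x))"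
        using s x mhomD(2)[OF chainD(1)[OF g]] by (simp add: app compose_eq homotopy_def)
      then show "(f \<otimes>\<^bsub>C\<^esub> g) i x = cdiff X (i - 1) (?s i x) \<oplus>\<^bsub>cterm X i\<^esub> ?s (i + 1) (cdiff X i x)"
        using x cl chainD(2)[OF g x] by (simp add: compose_eq)
    qed (intro mhom_comp[OF cterm_module chainD(1)[OF g]] s'(1)[OF s])
    then show ?thesis using fC g by (auto simp: null_homotopic_iff)
  qed
  have "homotopy \<zero>\<^bsub>C\<^esub> (\<lambda>i. zero_map (cterm X i) (cterm X (i - 1)))"
    unfolding homotopy_def
    using cl mhom_hom(1)[OF cdiff_hom' cterm_module cterm_module] abelian_groupE(2,5)[OF cterm_ab]
    by (auto simp: app zero_map_def intro!: mhom_zero_map[unfolded zero_map_def] cterm_module)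
  then have zero: "\<zero>\<^bsub>C\<^esub> \<in> null_homotopic A X" using C.zero_closed by (auto simp: null_homotopic_iff)
  have add: "f \<oplus>\<^bsub>C\<^esub> g \<in> null_homotopic A X"
    if f: "f \<in> null_homotopic A X" and g: "g \<in> null_homotopic A X" for f g
  proof -
    obtain s where fC: "f \<in> carrier C" and s: "homotopy f s" using f by (auto simp: null_homotopic_iff)
    obtain t where gC: "g \<in> carrier C" and t: "homotopy g t" using g by (auto simp: null_homotopic_iff)
    let ?s = "\<lambda>i. \<lambda>x\<in>carrier (cterm X i). s i x \<oplus>\<^bsub>cterm X (i - 1)\<^esub> t i x"
    have "homotopy (f \<oplus>\<^bsub>C\<^esub> g) ?s"
      unfolding homotopy_def
    proof (intro conjI allI ballI)
      fix i x assume x: "x \<in> carrier (cterm X i)"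
      interpret T: abelian_group "cterm X i" by (rule cterm_ab)
      show "(f \<oplus>\<^bsub>C\<^esub> g) i x = cdiff X (i - 1) (?s i x) \<oplus>\<^bsub>cterm X i\<^esub> ?s (i + 1) (cdiff X i x)"
        using x s t cl mhomD(2)[OF s'(1)[OF s]] mhomD(2)[OF s'(2)[OF s]]
          mhomD(2)[OF s'(1)[OF t]] mhomD(2)[OF s'(2)[OF t]]
        by (simp add: app homotopy_def mhomD(3)[OF cdiff_hom'] T.a_ac)
    qed (intro mhom_add[OF cterm_module cterm_module] s'(1)[OF s] s'(1)[OF t])
    then show ?thesis using fC gC by (auto simp: null_homotopic_iff)
  qed
  have sub: "null_homotopic A X \<subseteq> carrier C" by (auto simp: null_homotopic_iff)
  show ?thesis
  proof (rule idealI[OF ring_chain _ left right])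
    show "subgroup (null_homotopic A X) (add_monoid C)"
    proof (rule C.add.subgroupI[OF sub])
      show "null_homotopic A X \<noteq> {}" using zero by blast
      show "\<ominus>\<^bsub>C\<^esub> f \<in> null_homotopic A X" if "f \<in> null_homotopic A X" for f
        using left[OF that, of "\<ominus>\<^bsub>C\<^esub> \<one>\<^bsub>C\<^esub>"] that sub by (auto simp: C.l_minus subset_iff)
    qed (rule add)
  qed
qed

abbreviation "cls \<equiv> homotopy_class A X"
abbreviation "B \<equiv> opposite (kb_end_algebra A X)"

lemma kb_simps [simp]:
  "carrier (kb_end_algebra A X) = carrier (C Quot null_homotopic A X)"
  "\<zero>\<^bsub>kb_end_algebra A X\<^esub> = \<zero>\<^bsub>C Quot null_homotopic A X\<^esub>"
  "\<one>\<^bsub>kb_end_algebra A X\<^esub> = \<one>\<^bsub>C Quot null_homotopic A X\<^esub>"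
  "add (kb_end_algebra A X) = add (C Quot null_homotopic A X)"
  "monoid.mult (kb_end_algebra A X) = monoid.mult (C Quot null_homotopic A X)"
  by (simp_all add: kb_end_algebra_def Let_def)

lemma ring_kb: "ring (kb_end_algebra A X)"
proof -
  interpret ideal "null_homotopic A X" C by (rule ideal_null_homotopic)
  interpret Q: ring "C Quot null_homotopic A X" by (rule quotient_is_ring)
  show ?thesis
  proof (rule ringI)
    show "abelian_group (kb_end_algebra A X)"
      by (rule abelian_group_cong[OF Q.abelian_group_axioms]) auto
    show "monoid (kb_end_algebra A X)" by (rule monoidI) (auto simp: Q.m_assoc)
  qed (auto simp: Q.l_distr Q.r_distr)
qed

lemma ring_B: "ring B"
  by (rule ring_opposite[OF ring_kb])

text \<open>The factors on the right of the product rule are interchanged because \<open>B\<close>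
  is the opposite of the endomorphism algebra.\<close>

lemma cls_hom:
  "f \<in> carrier C \<Longrightarrow> cls f \<in> carrier B"
  "f \<in> carrier C \<Longrightarrow> g \<in> carrier C \<Longrightarrow> cls f \<otimes>\<^bsub>B\<^esub> cls g = cls (g \<otimes>\<^bsub>C\<^esub> f)"
  "f \<in> carrier C \<Longrightarrow> g \<in> carrier C \<Longrightarrow> cls f \<oplus>\<^bsub>B\<^esub> cls g = cls (f \<oplus>\<^bsub>C\<^esub> g)"
  "\<one>\<^bsub>B\<^esub> = cls \<one>\<^bsub>C\<^esub>" "\<zero>\<^bsub>B\<^esub> = null_homotopic A X"
proof -
  interpret ideal "null_homotopic A X" C by (rule ideal_null_homotopic)
  note hom = ring_hom_memE[OF rcos_ring_hom]
  show "f \<in> carrier C \<Longrightarrow> cls f \<in> carrier B"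
    "f \<in> carrier C \<Longrightarrow> g \<in> carrier C \<Longrightarrow> cls f \<otimes>\<^bsub>B\<^esub> cls g = cls (g \<otimes>\<^bsub>C\<^esub> f)"
    "f \<in> carrier C \<Longrightarrow> g \<in> carrier C \<Longrightarrow> cls f \<oplus>\<^bsub>B\<^esub> cls g = cls (f \<oplus>\<^bsub>C\<^esub> g)"
    "\<one>\<^bsub>B\<^esub> = cls \<one>\<^bsub>C\<^esub>"
    using hom by (simp_all add: homotopy_class_def del: chain_simps)
  show "\<zero>\<^bsub>B\<^esub> = null_homotopic A X" by (simp add: FactRing_def)
qed

lemma carrier_B: "carrier B = cls ` carrier C"
  by (auto simp: FactRing_def A_RCOSETS_def RCOSETS_def homotopy_class_def a_r_coset_def)

lemma cls_mem:
  "f \<in> carrier C \<Longrightarrow> g \<in> cls f \<Longrightarrow> \<exists>n\<in>null_homotopic A X. g = n \<oplus>\<^bsub>C\<^esub> f"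
  "f \<in> carrier C \<Longrightarrow> f \<in> cls f"
proof -
  interpret ideal "null_homotopic A X" C by (rule ideal_null_homotopic)
  show "f \<in> carrier C \<Longrightarrow> g \<in> cls f \<Longrightarrow> \<exists>n\<in>null_homotopic A X. g = n \<oplus>\<^bsub>C\<^esub> f"
    by (auto simp: homotopy_class_def a_r_coset_def r_coset_def simp del: chain_simps)
  show "f \<in> carrier C \<Longrightarrow> f \<in> cls f"
    unfolding homotopy_class_def by (rule a_rcos_self)
qed

end


section \<open>Modules over finite-dimensional algebras\<close>

lemma finitely_generated_image:
  assumes "left_module R M" "left_module R N" "finitely_generated R M" "f \<in> mhom R M N"
    and "f ` carrier M = carrier N"
  shows "finitely_generated R N"
proof -
  interpret M: left_module R M by fact
  interpret N: left_module R N by fact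
  obtain S where S: "finite S" "S \<subseteq> carrier M"
    "\<And>U. submodule U R M \<Longrightarrow> S \<subseteq> U \<Longrightarrow> U = carrier M"
    by (rule finitely_generatedE[OF assms(3,1)], rule that)
  show ?thesis
  proof (rule finitely_generatedI[OF assms(2), of "f ` S"])
    fix U assume U: "submodule U R N" "f ` S \<subseteq> U"
    note D = N.submodule_D[OF U(1)]
    have "{x \<in> carrier M. f x \<in> U} = carrier M"
    proof (rule S(3))
      show "submodule {x \<in> carrier M. f x \<in> U} R M"
        by (rule M.submodule_I)
          (use D mhomD(3,4)[OF assms(4)] mhom_hom(1)[OF assms(4,1,2)] in \<open>auto simp: M.smult_closed\<close>)
    qed (use S U in auto)
    then have "f ` carrier M \<subseteq> U" by blast
    then show "U = carrier N" using assms(5) D(1) by auto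
  qed (use S assms(5) in auto)
qed

lemma dual_algebra_simps [simp]:
  "carrier (dual_algebra K A) = functionals K A"
  "\<zero>\<^bsub>dual_algebra K A\<^esub> = (\<lambda>x\<in>carrier A. \<zero>\<^bsub>K\<^esub>)"
  "f \<oplus>\<^bsub>dual_algebra K A\<^esub> g = (\<lambda>x\<in>carrier A. f x \<oplus>\<^bsub>K\<^esub> g x)"
  "a \<odot>\<^bsub>dual_algebra K A\<^esub> f = (\<lambda>x\<in>carrier A. f (x \<otimes>\<^bsub>A\<^esub> a))"
  by (simp_all add: dual_algebra_def)

locale fin_dim_algebra = K: field K + ring A
  for K :: "'k ring" and A :: "('k, 'a) module" (structure) +
  assumes vector_space: "left_module K A" and A_finitely_generated: "finitely_generated K A"
    and smult_times: "\<lbrakk>c \<in> carrier K; x \<in> carrier A; y \<in> carrier A\<rbrakk> \<Longrightarrow>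
      (c \<odot> x) \<otimes> y = c \<odot> (x \<otimes> y)"
    and times_smult: "\<lbrakk>c \<in> carrier K; x \<in> carrier A; y \<in> carrier A\<rbrakk> \<Longrightarrow>
      x \<otimes> (c \<odot> y) = c \<odot> (x \<otimes> y)"
begin

sublocale V: left_module K A by (rule vector_space)

definition "scal c = c \<odot> \<one>"
definition "ground M = restrict_scalars scal M"

lemma scal_closed [simp]: "c \<in> carrier K \<Longrightarrow> scal c \<in> carrier A"
  by (simp add: scal_def V.smult_closed)

lemma scal_times: "c \<in> carrier K \<Longrightarrow> x \<in> carrier A \<Longrightarrow> scal c \<otimes> x = c \<odot> x"
  "c \<in> carrier K \<Longrightarrow> x \<in> carrier A \<Longrightarrow> x \<otimes> scal c = c \<odot> x"
  by (simp_all add: scal_def smult_times times_smult)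

lemma scal_ring_hom: "scal \<in> ring_hom K A"
proof (rule ring_hom_memI)
  fix c d assume "c \<in> carrier K" "d \<in> carrier K"
  then show "scal (c \<otimes>\<^bsub>K\<^esub> d) = scal c \<otimes> scal d"
    by (simp add: scal_times(1)) (simp add: scal_def V.smult_assoc)
qed (auto simp: scal_def V.smult_l_distr V.smult_one V.smult_closed)

lemma ground_simps [simp]:
  "carrier (ground M) = carrier M" "\<zero>\<^bsub>ground M\<^esub> = \<zero>\<^bsub>M\<^esub>" "add (ground M) = add M"
  "c \<odot>\<^bsub>ground M\<^esub> x = scal c \<odot>\<^bsub>M\<^esub> x"
  by (simp_all add: ground_def)

lemma left_module_ground: "left_module A M \<Longrightarrow> left_module K (ground M)"
  unfolding ground_def
  by (rule left_module_restrict_scalars) (auto intro: K.ring_axioms scal_ring_hom)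

text \<open>Multiples of the unit are central in \<open>A\<close>; this is what makes homomorphisms
  and actions over \<open>A\<close> linear over \<open>K\<close>.\<close>

lemma scal_commute:
  assumes "left_module A M" "c \<in> carrier K" "a \<in> carrier A" "x \<in> carrier M"
  shows "a \<odot>\<^bsub>M\<^esub> (scal c \<odot>\<^bsub>M\<^esub> x) = scal c \<odot>\<^bsub>M\<^esub> (a \<odot>\<^bsub>M\<^esub> x)"
    "(c \<odot> a) \<odot>\<^bsub>M\<^esub> x = scal c \<odot>\<^bsub>M\<^esub> (a \<odot>\<^bsub>M\<^esub> x)"
proof -
  interpret left_module A M by fact
  show "a \<odot>\<^bsub>M\<^esub> (scal c \<odot>\<^bsub>M\<^esub> x) = scal c \<odot>\<^bsub>M\<^esub> (a \<odot>\<^bsub>M\<^esub> x)"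
    using assms by (simp add: scal_times flip: smult_assoc)
  show "(c \<odot> a) \<odot>\<^bsub>M\<^esub> x = scal c \<odot>\<^bsub>M\<^esub> (a \<odot>\<^bsub>M\<^esub> x)"
    using assms by (simp add: scal_times flip: smult_assoc)
qed

lemma left_module_hom_space:
  assumes "left_module A M" "left_module A N"
  shows "left_module K (hom_space A M N)"
proof -
  interpret M: left_module A M by fact
  interpret N: left_module A N by fact
  interpret G: left_module K "ground N" by (rule left_module_ground[OF assms(2)])
  note D = mhomD[of _ A M N]
  have sm: "c \<odot>\<^bsub>hom_space A M N\<^esub> f = (\<lambda>x\<in>carrier M. scal c \<odot>\<^bsub>N\<^esub> f x)" for c f
    by (simp add: scal_def)
  have cl: "c \<odot>\<^bsub>hom_space A M N\<^esub> f \<in> mhom A M N" if "c \<in> carrier K" "f \<in> mhom A M N" for c f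
    unfolding sm using D[OF that(2)] that(1) scal_commute(1)[OF assms(2)]
    by (intro mhomI) (auto simp: M.smult_closed N.smult_closed N.smult_r_distr)
  show ?thesis
  proof (rule left_moduleI[OF K.ring_axioms abelian_group_hom_space[OF assms]])
    show "\<one>\<^bsub>K\<^esub> \<odot>\<^bsub>hom_space A M N\<^esub> f = f" if "f \<in> carrier (hom_space A M N)" for f
      using that D(1,2)[of f] G.smult_one
      by (auto simp: sm simp del: hom_space_simps(4) intro!: extensionalityI[of _ "carrier M"])
    show "c \<odot>\<^bsub>hom_space A M N\<^esub> f \<in> carrier (hom_space A M N)"
      if "c \<in> carrier K" "f \<in> carrier (hom_space A M N)" for c f
      using cl that by simp
  qed (use D(2) G.smult_l_distr G.smult_r_distr G.smult_assoc in
      \<open>auto simp: sm simp del: hom_space_simps(4) intro!: restrict_ext\<close>)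
qed

lemma fin_dim_A: "fin_dim K A"
  by (rule fin_dim_if_finitely_generated) (auto intro: K.field_axioms vector_space A_finitely_generated)

text \<open>Products of \<open>K\<close>-generators of \<open>A\<close> with
  \<open>A\<close>-generators of \<open>M\<close> generate \<open>M\<close> over \<open>K\<close>: a
  subspace containing them contains \<open>A s\<close> for every generator \<open>s\<close>, and
  then all of \<open>M\<close>.\<close>

lemma fin_dim_ground:
  assumes "fg_module A M"
  shows "fin_dim K (ground M)"
proof (rule fin_dim_if_finitely_generated[OF K.field_axioms])
  interpret left_module A M using assms by (simp add: fg_module_def)
  show G: "left_module K (ground M)" by (rule left_module_ground[OF left_module_axioms])
  interpret G: left_module K "ground M" by (rule G)
  obtain S where S: "finite S" "S \<subseteq> carrier M"
    "\<And>U. submodule U A M \<Longrightarrow> S \<subseteq> U \<Longrightarrow> U = carrier M"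
    using finitely_generatedE[of A M] assms unfolding fg_module_def by metis
  obtain T where T: "finite T" "T \<subseteq> carrier A"
    "\<And>U. submodule U K A \<Longrightarrow> T \<subseteq> U \<Longrightarrow> U = carrier A"
    by (rule finitely_generatedE[OF A_finitely_generated vector_space], rule that)
  let ?S = "(\<lambda>(a, s). a \<odot>\<^bsub>M\<^esub> s) ` (T \<times> S)"
  show "finitely_generated K (ground M)"
  proof (rule finitely_generatedI[OF G, of ?S])
    fix U assume U: "submodule U K (ground M)" "?S \<subseteq> U"
    note D = G.submodule_D[OF U(1), simplified]
    have 1: "a \<odot>\<^bsub>M\<^esub> s \<in> U" if "a \<in> carrier A" "s \<in> S" for a s
    proof -
      have s: "s \<in> carrier M" using that S(2) by auto
      have "{a \<in> carrier A. a \<odot>\<^bsub>M\<^esub> s \<in> U} = carrier A"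
      proof (rule T(3))
        show "submodule {a \<in> carrier A. a \<odot>\<^bsub>M\<^esub> s \<in> U} K A"
          by (rule V.submodule_I)
            (use D s in \<open>auto simp: smult_l_null smult_l_distr V.smult_closed scal_commute(2)[OF left_module_axioms]\<close>)
        show "T \<subseteq> {a \<in> carrier A. a \<odot>\<^bsub>M\<^esub> s \<in> U}" using U(2) T(2) that(2) by auto
      qed
      then show ?thesis using that(1) by auto
    qed
    have "{x \<in> carrier M. \<forall>a\<in>carrier A. a \<odot>\<^bsub>M\<^esub> x \<in> U} = carrier M"
    proof (rule S(3))
      show "submodule {x \<in> carrier M. \<forall>a\<in>carrier A. a \<odot>\<^bsub>M\<^esub> x \<in> U} A M"
        by (rule submodule_I)
          (use D in \<open>auto simp: smult_r_null smult_r_distr smult_closed simp flip: smult_assoc\<close>)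
      show "S \<subseteq> {x \<in> carrier M. \<forall>a\<in>carrier A. a \<odot>\<^bsub>M\<^esub> x \<in> U}" using 1 S(2) by auto
    qed
    then have "\<one> \<odot>\<^bsub>M\<^esub> x \<in> U" if "x \<in> carrier M" for x using that by blast
    then show "U = carrier (ground M)" using D(1) by (auto simp: smult_one)
  qed (use S T in \<open>auto simp: smult_closed subset_iff\<close>)
qed

text \<open>Every \<open>A\<close>-submodule is a \<open>K\<close>-subspace, so generators over
  \<open>K\<close> also generate over \<open>A\<close>.\<close>

lemma finitely_generated_ground:
  assumes "left_module A M" "fin_dim K (ground M)"
  shows "fg_module A M"
proof -
  interpret left_module A M by fact
  have G: "left_module K (ground M)" by (rule left_module_ground[OF assms(1)])
  obtain S where S: "finite S" "S \<subseteq> carrier M"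
    "\<And>U. submodule U K (ground M) \<Longrightarrow> S \<subseteq> U \<Longrightarrow> U = carrier M"
    using finitely_generatedE[OF finitely_generated_if_fin_dim[OF assms(2)] G] by (metis ground_simps(1))
  have "U = carrier M" if "submodule U A M" "S \<subseteq> U" for U
    using submodule_D[OF that(1)]
    by (intro S(3) that(2) left_module.submodule_I[OF G]) auto
  then have "finitely_generated A M" using S by (intro finitely_generatedI[OF assms(1), of S]) auto
  then show ?thesis using assms(1) by (simp add: fg_module_def)
qed

text \<open>A homomorphism is determined by its values on a finite generating set of
  \<open>M\<close>, and these values lie in a finite-dimensional space.\<close>

lemma fin_dim_hom_space:
  assumes "fg_module A M" "fg_module A N"
  shows "fin_dim K (hom_space A M N)"
proof -
  interpret M: left_module A M using assms(1) by (simp add: fg_module_def)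
  interpret N: left_module A N using assms(2) by (simp add: fg_module_def)
  obtain S where S: "finite S" "S \<subseteq> carrier M"
    "\<And>U. submodule U A M \<Longrightarrow> S \<subseteq> U \<Longrightarrow> U = carrier M"
    using finitely_generatedE[of A M] assms unfolding fg_module_def by metis
  show ?thesis
  proof (rule fin_dim_functions[OF K.field_axioms _ fin_dim_ground[OF assms(2)] S(1)])
    show "left_module K (hom_space A M N)"
      by (rule left_module_hom_space) (rule M.left_module_axioms N.left_module_axioms)+
    fix f assume f: "f \<in> carrier (hom_space A M N)" and *: "\<forall>t\<in>S. f t = \<zero>\<^bsub>ground N\<^esub>"
    then have fm: "f \<in> mhom A M N" by simp
    have "{x \<in> carrier M. f x = \<zero>\<^bsub>N\<^esub>} = carrier M"
    proof (rule S(3))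
      show "submodule {x \<in> carrier M. f x = \<zero>\<^bsub>N\<^esub>} A M"
        by (rule M.submodule_I)
          (use mhomD[OF fm] mhom_hom(1)[OF fm M.left_module_axioms N.left_module_axioms] in
            \<open>auto simp: M.smult_closed N.smult_r_null\<close>)
    qed (use * S in auto)
    then show "f = \<zero>\<^bsub>hom_space A M N\<^esub>"
      using mhomD(1)[OF fm] by (auto simp: zero_map_def intro!: extensionalityI[of _ "carrier M"])
  qed (use S mhomD(2)[of _ A M N] in \<open>auto simp: scal_def\<close>)
qed

text \<open>The definition of injectivity tests only modules carried by functions from
  \<open>nat\<close> to the field. Coordinates with respect to finitely many separating functionals
  move any finitely generated module there.\<close>

lemma fg_module_transport:
  fixes X :: "('a, 'x) module"
  assumes "fg_module A X"
  obtains X' :: "('a, nat \<Rightarrow> 'k) module" and i where "fg_module A X'" "i \<in> mhom A X X'"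
    "bij_betw i (carrier X) (carrier X')"
proof -
  interpret X: left_module A X using assms by (simp add: fg_module_def)
  have G: "left_module K (ground X)" by (rule left_module_ground[OF X.left_module_axioms])
  obtain C where C: "finite C" "C \<subseteq> functionals K (ground X)"
    "\<And>x. x \<in> carrier X \<Longrightarrow> \<forall>c\<in>C. c x = \<zero>\<^bsub>K\<^esub> \<Longrightarrow> x = \<zero>\<^bsub>X\<^esub>"
    using fin_dim_separated[OF K.field_axioms fin_dim_ground[OF assms]] by (metis ground_simps(1,2))
  obtain cs where cs: "set cs = C" using finite_list[OF C(1)] by auto
  \<comment> \<open>The coordinate vector of \<open>x\<close>, padded by a fixed value beyond the
    length of the list, so that equality of vectors is equality of coordinates.\<close>
  define j where "j = (\<lambda>x (n::nat). if n < length cs then (cs ! n) x else undefined)"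
  have inj: "inj_on j (carrier X)"
  proof (rule inj_onI)
    fix x y assume x: "x \<in> carrier X" and y: "y \<in> carrier X" and j: "j x = j y"
    have "x \<ominus>\<^bsub>ground X\<^esub> y = \<zero>\<^bsub>X\<^esub>"
    proof (rule C(3))
      show "\<forall>c\<in>C. c (x \<ominus>\<^bsub>ground X\<^esub> y) = \<zero>\<^bsub>K\<^esub>"
      proof
        fix c assume c: "c \<in> C"
        then obtain n where n: "n < length cs" "cs ! n = c" using cs by (auto simp: in_set_conv_nth)
        then have "c x = c y" using fun_cong[OF j, of n] by (simp add: j_def)
        moreover have cf: "c \<in> functionals K (ground X)" using c C(2) by auto
        ultimately show "c (x \<ominus>\<^bsub>ground X\<^esub> y) = \<zero>\<^bsub>K\<^esub>"
          using functional_hom(3)[OF cf G] functionalD(2)[OF cf] x y by (simp add: a_minus_def K.r_neg)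
      qed
      interpret G: left_module K "ground X" by (rule G)
      show "x \<ominus>\<^bsub>ground X\<^esub> y \<in> carrier X" using G.M.minus_closed[of x y] x y by simp
    qed
    then show "x = y"
      using abelian_group.minus_eq_zero_iff[of "ground X" x y] G x y by (simp add: left_module_def)
  qed
  define l where "l = inv_into (carrier X) j"
  have l: "l (j x) = x" if "x \<in> carrier X" for x using inj that by (simp add: l_def)
  define X' :: "('a, nat \<Rightarrow> 'k) module" where
    "X' = module_record (j ` carrier X) (j \<zero>\<^bsub>X\<^esub>) (\<lambda>u v. j (l u \<oplus>\<^bsub>X\<^esub> l v)) (\<lambda>r u. j (r \<odot>\<^bsub>X\<^esub> l u))"
  have X': "left_module A X'"
  proof (rule left_moduleI[OF ring_axioms])
    show "abelian_group X'"
    proof (rule abelian_groupI)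
      show "\<exists>y\<in>carrier X'. y \<oplus>\<^bsub>X'\<^esub> x = \<zero>\<^bsub>X'\<^esub>" if x: "x \<in> carrier X'" for x
      proof -
        obtain y where "y \<in> carrier X" "x = j y" using x by (auto simp: X'_def)
        then show ?thesis
          by (intro bexI[of _ "j (\<ominus>\<^bsub>X\<^esub> y)"]) (auto simp: X'_def l X.M.l_neg)
      qed
    qed (auto simp: X'_def l X.M.a_ac)
  qed (auto simp: X'_def l X.smult_closed X.smult_l_distr X.smult_r_distr X.smult_assoc X.smult_one)
  have i: "restrict j (carrier X) \<in> mhom A X X'"
    by (rule mhomI) (auto simp: X'_def l X.smult_closed)
  have "bij_betw (restrict j (carrier X)) (carrier X) (carrier X')"
    using inj by (auto simp: X'_def bij_betw_def inj_on_def)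
  moreover have "fg_module A X'"
    using finitely_generated_image[OF X.left_module_axioms X' _ i] assms X'
    by (auto simp: fg_module_def X'_def)
  ultimately show ?thesis using that i by blast
qed

text \<open>The extension property is freed from the fixed element type: the extension problem is
  carried to isomorphic copies of \<open>X\<close> and \<open>Y\<close>, solved there and carried
  back.\<close>

lemma injective_extend:
  fixes X :: "('a, 'x) module" and Y :: "('a, 'y) module"
  assumes "injective A I" "fg_module A X" "fg_module A Y" "g \<in> mhom A X Y" "inj_on g (carrier X)"
    and "f \<in> mhom A X I"
  obtains h where "h \<in> mhom A Y I" "\<And>x. x \<in> carrier X \<Longrightarrow> h (g x) = f x"
proof -
  have lm: "left_module A X" "left_module A Y" using assms by (simp_all add: fg_module_def)
  obtain X' :: "('a, nat \<Rightarrow> 'k) module" and i where X': "fg_module A X'" "i \<in> mhom A X X'"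
    "bij_betw i (carrier X) (carrier X')" by (rule fg_module_transport[OF assms(2)])
  obtain Y' :: "('a, nat \<Rightarrow> 'k) module" and j where Y': "fg_module A Y'" "j \<in> mhom A Y Y'"
    "bij_betw j (carrier Y) (carrier Y')" by (rule fg_module_transport[OF assms(3)])
  have lm': "left_module A X'" using X' by (simp add: fg_module_def)
  interpret X: left_module A X by fact
  interpret X': left_module A X' by fact
  define i' where "i' = (\<lambda>y\<in>carrier X'. inv_into (carrier X) i y)"
  have i': "i' (i x) = x" if "x \<in> carrier X" for x
    using X'(3) mhomD(2)[OF X'(2) that] that by (simp add: i'_def bij_betw_def)
  have X'_eq: "carrier X' = i ` carrier X" using X'(3) by (simp add: bij_betw_def)
  have i'm: "i' \<in> mhom A X' X"
  proof (rule mhomI)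
    show "i' y \<in> carrier X" if "y \<in> carrier X'" for y using that i' by (auto simp: X'_eq)
    show "i' (y \<oplus>\<^bsub>X'\<^esub> z) = i' y \<oplus>\<^bsub>X\<^esub> i' z" if "y \<in> carrier X'" "z \<in> carrier X'" for y z
      using that by (auto simp: X'_eq i' simp flip: mhomD(3)[OF X'(2)])
    show "i' (r \<odot>\<^bsub>X'\<^esub> y) = r \<odot>\<^bsub>X\<^esub> i' y" if "r \<in> carrier A" "y \<in> carrier X'" for r y
      using that by (auto simp: X'_eq i' X.smult_closed simp flip: mhomD(4)[OF X'(2)])
  qed (simp add: i'_def)
  define g' where "g' = compose (carrier X') (compose (carrier X) j g) i'"
  have g': "g' \<in> mhom A X' Y'"
    unfolding g'_def by (rule mhom_comp[OF lm' i'm mhom_comp[OF lm(1) assms(4) Y'(2)]])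
  have g'i: "g' (i x) = j (g x)" if "x \<in> carrier X" for x
    using that mhomD(2)[OF X'(2) that] i' by (simp add: g'_def compose_eq)
  have "inj_on g' (carrier X')"
  proof (rule inj_onI)
    fix y z assume "y \<in> carrier X'" "z \<in> carrier X'" "g' y = g' z"
    then obtain u v where "y = i u" "z = i v" and uv: "u \<in> carrier X" "v \<in> carrier X" "j (g u) = j (g v)"
      by (auto simp: X'_eq g'i)
    then show "y = z"
      using inj_onD[OF bij_betw_imp_inj_on[OF Y'(3)], of "g u" "g v"] mhomD(2)[OF assms(4)]
        inj_onD[OF assms(5), of u v] by auto
  qed
  moreover have "compose (carrier X') f i' \<in> mhom A X' I" by (rule mhom_comp[OF lm' i'm assms(6)])
  ultimately obtain h where h: "h \<in> mhom A Y' I" "compose (carrier X') h g' = compose (carrier X') f i'"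
    using assms(1) X'(1) Y'(1) g' unfolding injective_def by blast
  show ?thesis
  proof (rule that)
    show "compose (carrier Y) h j \<in> mhom A Y I" by (rule mhom_comp[OF lm(2) Y'(2) h(1)])
    fix x assume x: "x \<in> carrier X"
    show "compose (carrier Y) h j (g x) = f x"
      using fun_cong[OF h(2), of "i x"] mhomD(2)[OF assms(4) x] mhomD(2)[OF X'(2) x] x
      by (simp add: compose_eq g'i i')
  qed
qed

section \<open>The dual module \<open>DA\<close> and its endomorphisms\<close>

abbreviation "DA \<equiv> dual_algebra K A"

lemma ground_a_inv: "\<ominus>\<^bsub>ground M\<^esub> x = \<ominus>\<^bsub>M\<^esub> x"
  by (simp add: a_inv_def m_inv_def)

lemma left_module_DA: "left_module A DA"
proof (rule left_moduleI[OF ring_axioms])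
  interpret D: left_module K "dual_space K A"
    by (rule left_module_dual_space) (auto intro: K.cring_axioms vector_space)
  show "abelian_group DA"
    by (rule abelian_group_cong[OF D.M.abelian_group_axioms]) (auto simp: fun_eq_iff)
  show "a \<odot>\<^bsub>DA\<^esub> f \<in> carrier DA" if "a \<in> carrier A" "f \<in> carrier DA" for a f
  proof -
    have f: "f \<in> functionals K A" using that by simp
    show ?thesis
      using that(1) functionalD[OF f]
      by (auto intro!: functionalI simp: l_distr smult_times V.smult_closed)
  qed
  show "\<one> \<odot>\<^bsub>DA\<^esub> f = f" if "f \<in> carrier DA" for f
    using that functionalD(1)[of f] by (auto intro!: extensionalityI[of _ "carrier A"])
  show "(a \<oplus> b) \<odot>\<^bsub>DA\<^esub> f = a \<odot>\<^bsub>DA\<^esub> f \<oplus>\<^bsub>DA\<^esub> b \<odot>\<^bsub>DA\<^esub> f"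
    if "a \<in> carrier A" "b \<in> carrier A" "f \<in> carrier DA" for a b f
    using that functionalD(3)[of f K A] by (auto simp: r_distr intro!: restrict_ext)
qed (auto simp: m_assoc intro!: restrict_ext)

lemma DA_val: "f \<in> functionals K A \<Longrightarrow> x \<in> carrier A \<Longrightarrow> f x \<in> carrier K"
  by (rule functionalD(2))

text \<open>One direction of the natural isomorphism between \<open>DM\<close> and
  \<open>Hom_A(M, DA)\<close>. The other direction is evaluation at \<open>\<one>\<close>, treated
  next.\<close>

lemma dual_hom_of_functional:
  assumes "left_module A M" "\<omega> \<in> functionals K (ground M)"
  shows "(\<lambda>m\<in>carrier M. \<lambda>a\<in>carrier A. \<omega> (a \<odot>\<^bsub>M\<^esub> m)) \<in> mhom A M DA"
proof -
  interpret M: left_module A M by fact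
  note \<omega> = functionalD[OF assms(2), simplified]
  show ?thesis
  proof (rule mhomI)
    fix m assume m: "m \<in> carrier M"
    show "(\<lambda>m\<in>carrier M. \<lambda>a\<in>carrier A. \<omega> (a \<odot>\<^bsub>M\<^esub> m)) m \<in> carrier DA"
      using m \<omega> by (auto intro!: functionalI
          simp: M.smult_closed M.smult_l_distr V.smult_closed scal_commute(2)[OF assms(1)])
  qed (use \<omega> in \<open>auto simp: M.smult_closed M.smult_r_distr M.smult_assoc intro!: restrict_ext\<close>)
qed

lemma functional_of_dual_hom:
  assumes "left_module A M" "q \<in> mhom A M DA"
  shows "(\<lambda>m\<in>carrier M. q m \<one>) \<in> functionals K (ground M)"
    "\<And>m a. m \<in> carrier M \<Longrightarrow> a \<in> carrier A \<Longrightarrow> q m a = q (a \<odot>\<^bsub>M\<^esub> m) \<one>"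
proof -
  interpret M: left_module A M by fact
  note q = mhomD[OF assms(2)]
  have qv: "q m \<in> functionals K A" if "m \<in> carrier M" for m using q(2)[OF that] by simp
  show *: "q m a = q (a \<odot>\<^bsub>M\<^esub> m) \<one>" if "m \<in> carrier M" "a \<in> carrier A" for m a
    using that by (simp add: q(4))
  show "(\<lambda>m\<in>carrier M. q m \<one>) \<in> functionals K (ground M)"
  proof (rule functionalI)
    fix c m assume c: "c \<in> carrier K" and "m \<in> carrier (ground M)"
    then have m: "m \<in> carrier M" by simp
    have "q (scal c \<odot>\<^bsub>M\<^esub> m) \<one> = q m (c \<odot> \<one>)"
      using *[OF m scal_closed[OF c]] by (simp add: scal_def)
    also have "\<dots> = c \<otimes>\<^bsub>K\<^esub> q m \<one>" using functionalD(4)[OF qv[OF m] c one_closed] .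
    finally show "(\<lambda>m\<in>carrier M. q m \<one>) (c \<odot>\<^bsub>ground M\<^esub> m) = c \<otimes>\<^bsub>K\<^esub> (\<lambda>m\<in>carrier M. q m \<one>) m"
      using m c by (simp add: M.smult_closed)
  qed (use q qv in \<open>auto simp: DA_val\<close>)
qed

text \<open>The right action of \<open>A\<close> on \<open>DA\<close>, the function that
  \<open>corner_to_base\<close> uses, here cut down to the carrier so that it is an element of
  \<open>mhom\<close>.\<close>

definition "rmult a = (\<lambda>\<xi>\<in>carrier DA. \<lambda>x\<in>carrier A. \<xi> (a \<otimes> x))"

lemma rmult_val:
  assumes "a \<in> carrier A" "\<xi> \<in> functionals K A"
  shows "(\<lambda>x\<in>carrier A. \<xi> (a \<otimes> x)) \<in> functionals K A"
  using functionalD[OF assms(2)] assms(1)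
  by (auto intro!: functionalI simp: r_distr times_smult V.smult_closed)

lemma rmult_hom:
  assumes "a \<in> carrier A" shows "rmult a \<in> mhom A DA DA"
proof (rule mhomI)
  interpret D: left_module A DA by (rule left_module_DA)
  note cl = D.M.a_closed D.smult_closed
  show "rmult a (f \<oplus>\<^bsub>DA\<^esub> g) = rmult a f \<oplus>\<^bsub>DA\<^esub> rmult a g" if "f \<in> carrier DA" "g \<in> carrier DA" for f g
    using cl(1)[OF that] that assms by (auto simp: rmult_def intro!: restrict_ext)
  show "rmult a (b \<odot>\<^bsub>DA\<^esub> f) = b \<odot>\<^bsub>DA\<^esub> rmult a f" if "b \<in> carrier A" "f \<in> carrier DA" for b f
    using cl(2)[OF that] that assms by (auto simp: rmult_def m_assoc intro!: restrict_ext)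
qed (use assms rmult_val in \<open>auto simp: rmult_def\<close>)

text \<open>The assignment \<open>\<xi> -> \<phi> \<xi> \<one>\<close> is an element of the bidual
  of \<open>A\<close>, hence evaluation at some \<open>a\<close>. Linearity over \<open>A\<close>
  recovers all values: \<open>\<phi> \<xi> x = \<phi> (x \<xi>) \<one> = (x \<xi>) a = \<xi> (a
  x)\<close>.\<close>

lemma DA_endomorphism:
  assumes "\<phi> \<in> mhom A DA DA"
  obtains a where "a \<in> carrier A" "\<phi> = rmult a"
proof -
  interpret D: left_module A DA by (rule left_module_DA)
  note \<phi> = mhomD[OF assms]
  note f = functional_of_dual_hom[OF left_module_DA assms]
  \<comment> \<open>The scalars of \<open>K\<close> act on \<open>DA\<close> in two ways, through
    the unit of \<open>A\<close> and by multiplying values; functionals are linear, so both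
    agree.\<close>
  have sm: "scal c \<odot>\<^bsub>DA\<^esub> \<xi> = c \<odot>\<^bsub>dual_space K A\<^esub> \<xi>" if "c \<in> carrier K" "\<xi> \<in> functionals K A" for c \<xi>
    using that functionalD(4)[OF that(2)] by (auto simp: scal_times intro!: restrict_ext)
  have \<Phi>: "(\<lambda>\<xi>\<in>carrier DA. \<phi> \<xi> \<one>) \<in> functionals K (dual_space K A)"
  proof (rule functionalI)
    fix c \<xi> assume c: "c \<in> carrier K" and "\<xi> \<in> carrier (dual_space K A)"
    then have \<xi>: "\<xi> \<in> functionals K A" by simp
    show "(\<lambda>\<xi>\<in>carrier DA. \<phi> \<xi> \<one>) (c \<odot>\<^bsub>dual_space K A\<^esub> \<xi>)
        = c \<otimes>\<^bsub>K\<^esub> (\<lambda>\<xi>\<in>carrier DA. \<phi> \<xi> \<one>) \<xi>"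
      unfolding sm[OF c \<xi>, symmetric]
      using functionalD(4)[OF f(1) c, of \<xi>] \<xi> by (simp only: ground_simps dual_algebra_simps(1))
  next
    fix \<xi> \<zeta> assume "\<xi> \<in> carrier (dual_space K A)" "\<zeta> \<in> carrier (dual_space K A)"
    then show "(\<lambda>\<xi>\<in>carrier DA. \<phi> \<xi> \<one>) (\<xi> \<oplus>\<^bsub>dual_space K A\<^esub> \<zeta>)
        = (\<lambda>\<xi>\<in>carrier DA. \<phi> \<xi> \<one>) \<xi> \<oplus>\<^bsub>K\<^esub> (\<lambda>\<xi>\<in>carrier DA. \<phi> \<xi> \<one>) \<zeta>"
      using functionalD(3)[OF f(1), of \<xi> \<zeta>] by simp
  qed (use functionalD(2)[OF f(1)] in auto)
  obtain a where a: "a \<in> carrier A"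
    "\<And>\<xi>. \<xi> \<in> functionals K A \<Longrightarrow> (\<lambda>\<xi>\<in>carrier DA. \<phi> \<xi> \<one>) \<xi> = \<xi> a"
    by (rule bidual_evaluation[OF K.field_axioms fin_dim_A \<Phi>], rule that)
  have "\<phi> \<xi> = rmult a \<xi>" if "\<xi> \<in> carrier DA" for \<xi>
  proof (rule extensionalityI[of _ "carrier A"])
    show "\<phi> \<xi> \<in> extensional (carrier A)" using \<phi>(2)[OF that] functionalD(1)[of "\<phi> \<xi>"] by simp
    show "rmult a \<xi> \<in> extensional (carrier A)" using that by (simp add: rmult_def)
    fix x assume x: "x \<in> carrier A"
    have "\<phi> \<xi> x = \<phi> (x \<odot>\<^bsub>DA\<^esub> \<xi>) \<one>" by (rule f(2)[OF that x])
    also have "\<dots> = (x \<odot>\<^bsub>DA\<^esub> \<xi>) a"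
      using a(2)[of "x \<odot>\<^bsub>DA\<^esub> \<xi>"] D.smult_closed[OF x that] by simp
    also have "\<dots> = rmult a \<xi> x" using x that a(1) by (simp add: rmult_def)
    finally show "\<phi> \<xi> x = rmult a \<xi> x" .
  qed
  then have "\<phi> = rmult a" using \<phi>(1) by (intro extensionalityI[of _ "carrier DA"]) (auto simp: rmult_def)
  then show ?thesis using that a(1) by blast
qed

text \<open>Evaluation at \<open>\<one>\<close> gives \<open>\<xi> a = \<xi> b\<close> for all
  functionals, and these separate the points of \<open>A\<close>.\<close>

lemma rmult_inj:
  assumes "a \<in> carrier A" "b \<in> carrier A" "\<And>\<xi>. \<xi> \<in> carrier DA \<Longrightarrow> rmult a \<xi> = rmult b \<xi>"
  shows "a = b"
proof (rule functional_eqI[OF K.field_axioms vector_space assms(1,2)])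
  fix c assume c: "c \<in> functionals K A"
  then show "c a = c b" using fun_cong[OF assms(3)[of c], of \<one>] assms(1,2) by (simp add: rmult_def)
qed

lemma fg_module_DA: "fg_module A DA"
proof (rule finitely_generated_ground[OF left_module_DA])
  have G: "left_module K (ground DA)" by (rule left_module_ground[OF left_module_DA])
  have reg: "left_module K (regular K)" by (rule left_module_regular[OF K.ring_axioms])
  obtain T where T: "finite T" "T \<subseteq> carrier A"
    "\<And>U. submodule U K A \<Longrightarrow> T \<subseteq> U \<Longrightarrow> U = carrier A"
    by (rule finitely_generatedE[OF A_finitely_generated vector_space], rule that)
  have fdK: "fin_dim K (regular K)"
  proof (rule fin_dim_if_separated[OF K.field_axioms reg, of "{\<lambda>x\<in>carrier K. x}"])
    show "{\<lambda>x\<in>carrier K. x} \<subseteq> functionals K (regular K)"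
      using mhom_id[OF reg] by simp
  qed auto
  show "fin_dim K (ground DA)"
  proof (rule fin_dim_functions[OF K.field_axioms G fdK T(1)])
    fix f t assume "f \<in> carrier (ground DA)" "t \<in> T"
    then have ft: "f \<in> functionals K A" "t \<in> carrier A" using T by auto
    then show "f t \<in> carrier (regular K)" by (simp add: DA_val)
    show "(r \<odot>\<^bsub>ground DA\<^esub> f) t = r \<odot>\<^bsub>regular K\<^esub> f t" if "r \<in> carrier K" for r
      using ft that functionalD(4)[OF ft(1)] by (simp add: scal_times)
  next
    fix f assume "f \<in> carrier (ground DA)" and 0: "\<forall>t\<in>T. f t = \<zero>\<^bsub>regular K\<^esub>"
    then have f: "f \<in> functionals K A" by simp
    have "{x \<in> carrier A. f x = \<zero>\<^bsub>K\<^esub>} = carrier A"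
    proof (rule T(3))
      show "submodule {x \<in> carrier A. f x = \<zero>\<^bsub>K\<^esub>} K A"
        by (rule V.submodule_I)
          (use functionalD[OF f] functional_hom(1)[OF f vector_space] in \<open>auto simp: V.smult_closed\<close>)
    qed (use T 0 in auto)
    then show "f = \<zero>\<^bsub>ground DA\<^esub>"
      using functionalD(1)[OF f] by (auto intro!: extensionalityI[of _ "carrier A"])
  qed (use T in auto)
qed

section \<open>Coinduced modules \<open>Hom_K(A, M)\<close> and maps into an injective
  module\<close>

definition "coind M = module_record (mhom K A (ground M)) (\<lambda>a\<in>carrier A. \<zero>\<^bsub>M\<^esub>)
   (\<lambda>f g. \<lambda>a\<in>carrier A. f a \<oplus>\<^bsub>M\<^esub> g a) (\<lambda>b f. \<lambda>a\<in>carrier A. f (a \<otimes> b))"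

lemma coind_simps [simp]:
  "carrier (coind M) = mhom K A (ground M)" "\<zero>\<^bsub>coind M\<^esub> = (\<lambda>a\<in>carrier A. \<zero>\<^bsub>M\<^esub>)"
  "f \<oplus>\<^bsub>coind M\<^esub> g = (\<lambda>a\<in>carrier A. f a \<oplus>\<^bsub>M\<^esub> g a)"
  "b \<odot>\<^bsub>coind M\<^esub> f = (\<lambda>a\<in>carrier A. f (a \<otimes> b))"
  by (simp_all add: coind_def)

text \<open>Finite-dimensionality over \<open>K\<close> suffices, and a linear map on
  \<open>A\<close> is determined by its values on finitely many generators of
  \<open>A\<close>.\<close>

lemma fg_module_coind:
  assumes "fg_module A M"
  shows "fg_module A (coind M)"
proof -
  interpret M: left_module A M using assms by (simp add: fg_module_def)
  have G: "left_module K (ground M)" by (rule left_module_ground[OF M.left_module_axioms])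
  note D = mhomD[of _ K A "ground M", simplified]
  have C: "left_module A (coind M)"
  proof (rule left_moduleI[OF ring_axioms])
    show "abelian_group (coind M)"
    proof (rule abelian_group_pointwise[OF M.M.abelian_group_axioms, of _ "carrier A"])
      show "carrier (coind M) \<subseteq> carrier A \<rightarrow>\<^sub>E carrier M" by (auto simp: mhom_def)
      show "\<zero>\<^bsub>coind M\<^esub> \<in> carrier (coind M)"
        using mhom_zero_map[OF vector_space G] by (simp add: zero_map_def)
      show "f \<oplus>\<^bsub>coind M\<^esub> g \<in> carrier (coind M)" if "f \<in> carrier (coind M)" "g \<in> carrier (coind M)" for f g
        using mhom_add[OF vector_space G] that by simp
      show "(\<lambda>a\<in>carrier A. \<ominus>\<^bsub>M\<^esub> f a) \<in> carrier (coind M)" if "f \<in> carrier (coind M)" for f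
        using mhom_minus[OF vector_space G] that by (simp add: ground_a_inv)
    qed auto
    show "b \<odot>\<^bsub>coind M\<^esub> f \<in> carrier (coind M)" if "b \<in> carrier A" "f \<in> carrier (coind M)" for b f
      using that D[of f] by (auto intro!: mhomI simp: l_distr smult_times V.smult_closed)
    show "(a \<oplus> b) \<odot>\<^bsub>coind M\<^esub> f = a \<odot>\<^bsub>coind M\<^esub> f \<oplus>\<^bsub>coind M\<^esub> b \<odot>\<^bsub>coind M\<^esub> f"
      if "a \<in> carrier A" "b \<in> carrier A" "f \<in> carrier (coind M)" for a b f
      using that D(3)[of f] by (auto simp: r_distr intro!: restrict_ext)
    show "\<one> \<odot>\<^bsub>coind M\<^esub> f = f" if "f \<in> carrier (coind M)" for f
      using that D(1)[of f] by (auto intro!: extensionalityI[of _ "carrier A"])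
  qed (auto simp: m_assoc intro!: restrict_ext)
  obtain T where T: "finite T" "T \<subseteq> carrier A"
    "\<And>U. submodule U K A \<Longrightarrow> T \<subseteq> U \<Longrightarrow> U = carrier A"
    by (rule finitely_generatedE[OF A_finitely_generated vector_space], rule that)
  show ?thesis
  proof (rule finitely_generated_ground[OF C])
    show "fin_dim K (ground (coind M))"
    proof (rule fin_dim_functions[OF K.field_axioms left_module_ground[OF C] fin_dim_ground[OF assms] T(1)])
      fix f t assume "f \<in> carrier (ground (coind M))" "t \<in> T"
      then have ft: "f \<in> mhom K A (ground M)" "t \<in> carrier A" using T by auto
      then show "f t \<in> carrier (ground M)" using D(2) by simp
      show "(r \<odot>\<^bsub>ground (coind M)\<^esub> f) t = r \<odot>\<^bsub>ground M\<^esub> f t" if "r \<in> carrier K" for r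
        using ft that D(4)[OF ft(1)] by (simp add: scal_times)
    next
      fix f assume "f \<in> carrier (ground (coind M))" and 0: "\<forall>t\<in>T. f t = \<zero>\<^bsub>ground M\<^esub>"
      then have f: "f \<in> mhom K A (ground M)" by simp
      have "{x \<in> carrier A. f x = \<zero>\<^bsub>M\<^esub>} = carrier A"
      proof (rule T(3))
        show "submodule {x \<in> carrier A. f x = \<zero>\<^bsub>M\<^esub>} K A"
          by (rule V.submodule_I)
            (use D[OF f] mhom_hom(1)[OF f vector_space G] in \<open>auto simp: V.smult_closed M.smult_r_null\<close>)
      qed (use T 0 in auto)
      then show "f = \<zero>\<^bsub>ground (coind M)\<^esub>"
        using D(1)[OF f] by (auto intro!: extensionalityI[of _ "carrier A"])
    qed (use T in auto)
  qed
qed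

text \<open>An injective module \<open>I\<close> is a direct summand of the module of \<open>K\<close>-linear maps from
  \<open>A\<close> to \<open>I\<close>, which is a finite sum of copies of \<open>DA\<close>.\<close>

lemma injective_hom_induct:
  assumes I: "injective A I" and M: "left_module A M" and h: "h \<in> mhom A M I"
    and zero: "P (zero_map M I)"
    and add: "\<And>f g. \<lbrakk>f \<in> mhom A M I; g \<in> mhom A M I; P f; P g\<rbrakk> \<Longrightarrow> P (\<lambda>x\<in>carrier M. f x \<oplus>\<^bsub>I\<^esub> g x)"
    and comp: "\<And>u v. \<lbrakk>u \<in> mhom A DA I; v \<in> mhom A M DA\<rbrakk> \<Longrightarrow> P (compose (carrier M) u v)"
  shows "P h"
proof -
  have fgI: "fg_module A I" using I by (simp add: injective_def)
  interpret I: left_module A I using fgI by (simp add: fg_module_def)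
  interpret M: left_module A M by fact
  have G: "left_module K (ground I)" by (rule left_module_ground[OF I.left_module_axioms])
  have fgC: "fg_module A (coind I)" by (rule fg_module_coind[OF fgI])
  interpret C: left_module A "coind I" using fgC by (simp add: fg_module_def)
  interpret D: left_module A DA by (rule left_module_DA)
  note hd = mhomD[OF h]
  have co: "(\<lambda>a\<in>carrier A. a \<odot>\<^bsub>I\<^esub> x) \<in> mhom K A (ground I)" if "x \<in> carrier I" for x
    using that by (auto intro!: mhomI simp: I.smult_closed I.smult_l_distr V.smult_closed
        scal_commute(2)[OF I.left_module_axioms])
  have g: "(\<lambda>x\<in>carrier I. \<lambda>a\<in>carrier A. a \<odot>\<^bsub>I\<^esub> x) \<in> mhom A I (coind I)"
    by (rule mhomI) (auto simp: co I.smult_closed I.smult_r_distr I.smult_assoc intro!: restrict_ext)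
  have "inj_on (\<lambda>x\<in>carrier I. \<lambda>a\<in>carrier A. a \<odot>\<^bsub>I\<^esub> x) (carrier I)"
  proof (rule inj_onI)
    fix x y assume xy: "x \<in> carrier I" "y \<in> carrier I"
      and eq: "(\<lambda>x\<in>carrier I. \<lambda>a\<in>carrier A. a \<odot>\<^bsub>I\<^esub> x) x = (\<lambda>x\<in>carrier I. \<lambda>a\<in>carrier A. a \<odot>\<^bsub>I\<^esub> x) y"
    show "x = y"
      using fun_cong[OF eq, of \<one>] xy by (simp add: I.smult_one)
  qed
  \<comment> \<open>Injectivity extends the identity of \<open>I\<close> along the embedding that
    sends \<open>x\<close> to \<open>a -> a x\<close>, which gives a retraction from the coinduced
    module onto \<open>I\<close>.\<close>
  then obtain r where r: "r \<in> mhom A (coind I) I"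
    and ri: "\<And>x. x \<in> carrier I \<Longrightarrow> r ((\<lambda>x\<in>carrier I. \<lambda>a\<in>carrier A. a \<odot>\<^bsub>I\<^esub> x) x) = (\<lambda>x\<in>carrier I. x) x"
    using injective_extend[OF I fgI fgC g _ mhom_id[OF I.left_module_axioms]] by metis
  note rd = mhomD[OF r]
  \<comment> \<open>A \<open>K\<close>-linear endomorphism \<open>\<pi>\<close> of \<open>I\<close>
    is inserted between the embedding into the coinduced module and the retraction \<open>r\<close>.
    The identity gives back \<open>h\<close>, and the construction is additive in
    \<open>\<pi>\<close>, so the induction runs over finite rank maps \<open>\<pi>\<close>.\<close>
  define \<Theta> where "\<Theta> \<pi> = (\<lambda>m\<in>carrier M. r (\<lambda>a\<in>carrier A. \<pi> (a \<odot>\<^bsub>I\<^esub> h m)))" for \<pi>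
  have pf: "(\<lambda>a\<in>carrier A. \<pi> (a \<odot>\<^bsub>I\<^esub> x)) \<in> mhom K A (ground I)"
    if "\<pi> \<in> mhom K (ground I) (ground I)" "x \<in> carrier I" for \<pi> x
  proof -
    have "compose (carrier A) \<pi> (\<lambda>a\<in>carrier A. a \<odot>\<^bsub>I\<^esub> x) \<in> mhom K A (ground I)"
      by (rule mhom_comp[OF vector_space co[OF that(2)] that(1)])
    then show ?thesis by (simp add: compose_def cong: restrict_cong)
  qed
  have \<Theta>h: "\<Theta> \<pi> \<in> mhom A M I" if \<pi>: "\<pi> \<in> mhom K (ground I) (ground I)" for \<pi>
  proof (rule mhomI)
    note \<pi>d = mhomD[OF \<pi>, simplified]
    fix m n assume m: "m \<in> carrier M" and n: "n \<in> carrier M"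
    have "(\<lambda>a\<in>carrier A. \<pi> (a \<odot>\<^bsub>I\<^esub> h (m \<oplus>\<^bsub>M\<^esub> n)))
        = (\<lambda>a\<in>carrier A. \<pi> (a \<odot>\<^bsub>I\<^esub> h m)) \<oplus>\<^bsub>coind I\<^esub> (\<lambda>a\<in>carrier A. \<pi> (a \<odot>\<^bsub>I\<^esub> h n))"
      using m n hd(2,3) \<pi>d by (auto simp: I.smult_r_distr I.smult_closed intro!: restrict_ext)
    then show "\<Theta> \<pi> (m \<oplus>\<^bsub>M\<^esub> n) = \<Theta> \<pi> m \<oplus>\<^bsub>I\<^esub> \<Theta> \<pi> n"
      using m n pf[OF \<pi> hd(2)] by (simp add: \<Theta>_def rd(3) del: coind_simps(3))
  next
    note \<pi>d = mhomD[OF \<pi>, simplified]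
    fix b m assume b: "b \<in> carrier A" and m: "m \<in> carrier M"
    have "(\<lambda>a\<in>carrier A. \<pi> (a \<odot>\<^bsub>I\<^esub> h (b \<odot>\<^bsub>M\<^esub> m))) = b \<odot>\<^bsub>coind I\<^esub> (\<lambda>a\<in>carrier A. \<pi> (a \<odot>\<^bsub>I\<^esub> h m))"
      using b m hd(2,4) by (auto simp: I.smult_assoc intro!: restrict_ext)
    then show "\<Theta> \<pi> (b \<odot>\<^bsub>M\<^esub> m) = b \<odot>\<^bsub>I\<^esub> \<Theta> \<pi> m"
      using b m pf[OF \<pi> hd(2)] by (simp add: \<Theta>_def rd(4) M.smult_closed del: coind_simps(4))
  qed (use pf[OF \<pi> hd(2)] rd(2) in \<open>auto simp: \<Theta>_def\<close>)
  have "P (\<Theta> \<pi>)" if "\<pi> \<in> finite_rank K (ground I)" for \<pi>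
    using that
  proof induction
    case zero
    have "\<Theta> (zero_map (ground I) (ground I)) = zero_map M I"
      using mhom_hom(1)[OF r C.left_module_axioms I.left_module_axioms] hd(2)
      by (auto simp: \<Theta>_def zero_map_def I.smult_closed intro!: restrict_ext cong: restrict_cong)
    then show ?case using assms(4) by simp
  next
    case (add \<pi> c v)
    have v: "v \<in> carrier I" using add.hyps by simp
    have \<pi>: "\<pi> \<in> mhom K (ground I) (ground I)" by (rule finite_rank_mhom[OF add.hyps(1) G])
    \<comment> \<open>The rank one part \<open>c(-) v\<close> factors through \<open>DA\<close>:
      \<open>V\<close> sends \<open>m\<close> to the functional \<open>a -> c (a h(m))\<close>, and
      \<open>W\<close> below sends a functional \<open>\<omega>\<close> to the image under
      \<open>r\<close> of \<open>a -> \<omega>(a) v\<close>.\<close>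
    define V where "V = (\<lambda>m\<in>carrier M. \<lambda>a\<in>carrier A. c (a \<odot>\<^bsub>I\<^esub> h m))"
    have "compose (carrier M) (\<lambda>m\<in>carrier I. \<lambda>a\<in>carrier A. c (a \<odot>\<^bsub>I\<^esub> m)) h \<in> mhom A M DA"
      by (rule mhom_comp[OF M h dual_hom_of_functional[OF I.left_module_axioms add.hyps(2)]])
    also have "compose (carrier M) (\<lambda>m\<in>carrier I. \<lambda>a\<in>carrier A. c (a \<odot>\<^bsub>I\<^esub> m)) h = V"
      using hd(2) by (auto simp: V_def compose_def intro!: restrict_ext)
    finally have V: "V \<in> mhom A M DA" .
    have w: "(\<lambda>a\<in>carrier A. scal (\<omega> a) \<odot>\<^bsub>I\<^esub> v) \<in> mhom K A (ground I)" if "\<omega> \<in> functionals K A" for \<omega>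
    proof -
      interpret G: left_module K "ground I" by (rule G)
      show ?thesis
        using functionalD[OF that] v G.smult_closed[simplified] G.smult_l_distr[simplified] G.smult_assoc[simplified]
        by (intro mhomI) (auto simp: V.smult_closed)
    qed
    define W where "W = (\<lambda>\<omega>\<in>carrier DA. r (\<lambda>a\<in>carrier A. scal (\<omega> a) \<odot>\<^bsub>I\<^esub> v))"
    have W: "W \<in> mhom A DA I"
    proof (rule mhomI)
      interpret G: left_module K "ground I" by (rule G)
      fix \<omega> \<omega>' assume o: "\<omega> \<in> carrier DA" "\<omega>' \<in> carrier DA"
      then have "(\<lambda>a\<in>carrier A. scal ((\<omega> \<oplus>\<^bsub>DA\<^esub> \<omega>') a) \<odot>\<^bsub>I\<^esub> v)
        = (\<lambda>a\<in>carrier A. scal (\<omega> a) \<odot>\<^bsub>I\<^esub> v) \<oplus>\<^bsub>coind I\<^esub> (\<lambda>a\<in>carrier A. scal (\<omega>' a) \<odot>\<^bsub>I\<^esub> v)"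
        using G.smult_l_distr[simplified] v by (auto simp: DA_val intro!: restrict_ext)
      then show "W (\<omega> \<oplus>\<^bsub>DA\<^esub> \<omega>') = W \<omega> \<oplus>\<^bsub>I\<^esub> W \<omega>'"
        using o w D.M.a_closed[OF o] by (simp add: W_def rd(3) del: coind_simps(3) dual_algebra_simps(3))
    next
      fix b \<omega> assume b: "b \<in> carrier A" and o: "\<omega> \<in> carrier DA"
      then have "(\<lambda>a\<in>carrier A. scal ((b \<odot>\<^bsub>DA\<^esub> \<omega>) a) \<odot>\<^bsub>I\<^esub> v)
        = b \<odot>\<^bsub>coind I\<^esub> (\<lambda>a\<in>carrier A. scal (\<omega> a) \<odot>\<^bsub>I\<^esub> v)"
        by (auto intro!: restrict_ext)
      then show "W (b \<odot>\<^bsub>DA\<^esub> \<omega>) = b \<odot>\<^bsub>I\<^esub> W \<omega>"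
        using o b w D.smult_closed[OF b o] by (simp add: W_def rd(4) del: coind_simps(4) dual_algebra_simps(4))
    qed (use w rd(2) in \<open>auto simp: W_def\<close>)
    have eq: "\<Theta> (\<lambda>x\<in>carrier (ground I). \<pi> x \<oplus>\<^bsub>ground I\<^esub> c x \<odot>\<^bsub>ground I\<^esub> v)
        = (\<lambda>m\<in>carrier M. \<Theta> \<pi> m \<oplus>\<^bsub>I\<^esub> compose (carrier M) W V m)"
    proof (unfold \<Theta>_def, rule restrict_ext)
      fix m assume m: "m \<in> carrier M"
      have Vm: "V m \<in> functionals K A" using mhomD(2)[OF V m] by simp
      have "(\<lambda>a\<in>carrier A. (\<lambda>x\<in>carrier (ground I). \<pi> x \<oplus>\<^bsub>ground I\<^esub> c x \<odot>\<^bsub>ground I\<^esub> v) (a \<odot>\<^bsub>I\<^esub> h m))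
        = (\<lambda>a\<in>carrier A. \<pi> (a \<odot>\<^bsub>I\<^esub> h m)) \<oplus>\<^bsub>coind I\<^esub> (\<lambda>a\<in>carrier A. scal (V m a) \<odot>\<^bsub>I\<^esub> v)"
        using m hd(2) by (auto simp: V_def I.smult_closed intro!: restrict_ext)
      then show "r (\<lambda>a\<in>carrier A. (\<lambda>x\<in>carrier (ground I). \<pi> x \<oplus>\<^bsub>ground I\<^esub> c x \<odot>\<^bsub>ground I\<^esub> v) (a \<odot>\<^bsub>I\<^esub> h m))
        = (\<lambda>m\<in>carrier M. r (\<lambda>a\<in>carrier A. \<pi> (a \<odot>\<^bsub>I\<^esub> h m))) m \<oplus>\<^bsub>I\<^esub> compose (carrier M) W V m"
        using m pf[OF \<pi> hd(2)[OF m]] w[OF Vm] Vm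
        by (simp add: compose_eq W_def rd(3) del: coind_simps(3))
    qed
    show ?case
      unfolding eq by (rule assms(5)[OF \<Theta>h[OF \<pi>] mhom_comp[OF M V W] add.IH comp[OF W V]])
  qed
  from this[of "\<lambda>x\<in>carrier (ground I). x"] have "P (\<Theta> (\<lambda>x\<in>carrier I. x))"
    using fin_dim_ground[OF fgI] by (simp add: fin_dim_def)
  moreover have "\<Theta> (\<lambda>x\<in>carrier I. x) = h"
  proof (rule extensionalityI[of _ "carrier M"])
    fix m assume m: "m \<in> carrier M"
    have "(\<lambda>a\<in>carrier A. (\<lambda>x\<in>carrier I. x) (a \<odot>\<^bsub>I\<^esub> h m)) = (\<lambda>a\<in>carrier A. a \<odot>\<^bsub>I\<^esub> h m)"
      using hd(2)[OF m] by (auto simp: I.smult_closed intro!: restrict_ext)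
    then show "\<Theta> (\<lambda>x\<in>carrier I. x) m = h m"
      using ri[of "h m"] hd(2)[OF m] m by (simp add: \<Theta>_def)
  qed (use hd(1) in \<open>auto simp: \<Theta>_def\<close>)
  ultimately show ?thesis by simp
qed

end


section \<open>The kernel module of a complex with top term \<open>I \<oplus> DA\<close>\<close>

lemma direct_sum_simps [simp]:
  "carrier (direct_sum M N) = carrier M \<times> carrier N"
  "\<zero>\<^bsub>direct_sum M N\<^esub> = (\<zero>\<^bsub>M\<^esub>, \<zero>\<^bsub>N\<^esub>)"
  "p \<oplus>\<^bsub>direct_sum M N\<^esub> q = (fst p \<oplus>\<^bsub>M\<^esub> fst q, snd p \<oplus>\<^bsub>N\<^esub> snd q)"
  "r \<odot>\<^bsub>direct_sum M N\<^esub> p = (r \<odot>\<^bsub>M\<^esub> fst p, r \<odot>\<^bsub>N\<^esub> snd p)"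
  by (simp_all add: direct_sum_def)

lemma left_module_direct_sum:
  assumes "left_module R M" "left_module R N"
  shows "left_module R (direct_sum M N)"
proof -
  interpret M: left_module R M by fact
  interpret N: left_module R N by fact
  show ?thesis
  proof (rule left_moduleI[OF M.R.ring_axioms])
    show "abelian_group (direct_sum M N)"
    proof (rule abelian_groupI)
      show "\<exists>y\<in>carrier (direct_sum M N). y \<oplus>\<^bsub>direct_sum M N\<^esub> x = \<zero>\<^bsub>direct_sum M N\<^esub>"
        if "x \<in> carrier (direct_sum M N)" for x
        using that by (intro bexI[of _ "(\<ominus>\<^bsub>M\<^esub> fst x, \<ominus>\<^bsub>N\<^esub> snd x)"]) (auto simp: M.M.l_neg N.M.l_neg)
    qed (auto simp: M.M.a_ac N.M.a_ac)
  qed (auto simp: M.smult_closed N.smult_closed M.smult_l_distr N.smult_l_distr M.smult_r_distr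
      N.smult_r_distr M.smult_assoc N.smult_assoc M.smult_one N.smult_one)
qed

text \<open>This isolates what is used of \<open>E_complex\<close> around its last degree. There
  \<open>I\<close> is \<open>Q (k - 1)\<close>, and \<open>cdiff_snd\<close> holds since the stalk
  summand has zero differential.\<close>

locale kernel_setting = fin_dim_algebra K A + module_complex A X
  for K :: "'k ring" and A :: "('k, 'a) module" (structure)
    and X :: "('a, 'm \<times> ('a \<Rightarrow> 'k)) cochain_complex" +
  fixes k :: int and I :: "('a, 'm) module" and M :: "('a, 'n) module"
  assumes top: "cterm X k = direct_sum I DA"
    and above: "carrier (cterm X (k + 1)) = {\<zero>\<^bsub>cterm X (k + 1)\<^esub>}"
    and cdiff_snd: "p \<in> carrier (cterm X (k - 1)) \<Longrightarrow> snd (cdiff X (k - 1) p) = \<zero>\<^bsub>DA\<^esub>"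
    and inj_I: "injective A I" and fg_M: "fg_module A M"
begin

abbreviation "Y \<equiv> direct_sum I DA"
definition "U = cdiff X (k - 1) ` carrier (cterm X (k - 1))"
abbreviation "H \<equiv> hom_space A M Y"
abbreviation "N \<equiv> dual_hom_kernel K A X k M"

sublocale M: left_module A M using fg_M by (simp add: fg_module_def)
sublocale I: left_module A I using inj_I by (simp add: injective_def fg_module_def)
sublocale D: left_module A DA by (rule left_module_DA)

lemma fg_I: "fg_module A I" using inj_I by (simp add: injective_def)

lemma Y_module: "left_module A Y"
  by (rule left_module_direct_sum[OF I.left_module_axioms left_module_DA])

sublocale Y: left_module A Y by (rule Y_module)

lemma cdiff_Y: "cdiff X (k - 1) \<in> mhom A (cterm X (k - 1)) Y"
  using cdiff_hom'[of k] by (simp add: top)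

lemma U_submodule: "submodule U A Y"
proof -
  note d = mhomD[OF cdiff_Y] and T = cterm_module[of "k - 1"]
  interpret T: left_module A "cterm X (k - 1)" by (rule T)
  show ?thesis
  proof (rule Y.submodule_I)
    show "U \<subseteq> carrier Y" unfolding U_def by (rule image_subsetI, rule d(2))
    show "\<zero>\<^bsub>Y\<^esub> \<in> U" unfolding U_def
      by (rule image_eqI[of _ _ "\<zero>\<^bsub>cterm X (k - 1)\<^esub>"])
        (simp_all only: mhom_hom(1)[OF cdiff_Y T Y_module] T.M.zero_closed)
  next
    fix x y assume "x \<in> U" "y \<in> U"
    then obtain p q where "x = cdiff X (k - 1) p" "p \<in> carrier (cterm X (k - 1))"
      "y = cdiff X (k - 1) q" "q \<in> carrier (cterm X (k - 1))" by (auto simp: U_def)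
    then show "x \<oplus>\<^bsub>Y\<^esub> y \<in> U" unfolding U_def
      by (intro image_eqI[of _ _ "p \<oplus>\<^bsub>cterm X (k - 1)\<^esub> q"]) (simp_all only: d(3) T.M.a_closed)
  next
    fix a x assume a: "a \<in> carrier A" and "x \<in> U"
    then obtain p where "x = cdiff X (k - 1) p" "p \<in> carrier (cterm X (k - 1))" by (auto simp: U_def)
    then show "a \<odot>\<^bsub>Y\<^esub> x \<in> U" unfolding U_def using a
      by (intro image_eqI[of _ _ "a \<odot>\<^bsub>cterm X (k - 1)\<^esub> p"]) (simp_all only: d(4) T.smult_closed)
  qed
qed

lemmas U_D = Y.submodule_D[OF U_submodule]

lemma U_snd: "u \<in> U \<Longrightarrow> snd u = \<zero>\<^bsub>DA\<^esub>"
  using cdiff_snd by (auto simp: U_def)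

section \<open>The kernel module as a module over \<open>B\<close>\<close>

lemma H_module: "left_module K H"
  by (rule left_module_hom_space[OF M.left_module_axioms Y_module])

text \<open>Homomorphisms into \<open>U\<close> are those into \<open>Y\<close> with values in
  \<open>U\<close>, and composing with the inclusion leaves the function unchanged. So lying in the
  kernel of the dual map means vanishing on them.\<close>

lemma N_carrier:
  "\<xi> \<in> carrier N \<longleftrightarrow> \<xi> \<in> functionals K H \<and> (\<forall>h\<in>mhom A M Y. h ` carrier M \<subseteq> U \<longrightarrow> \<xi> h = \<zero>\<^bsub>K\<^esub>)"
proof -
  have eq: "mhom A M (Y\<lparr>carrier := U\<rparr>) = {h \<in> mhom A M Y. h ` carrier M \<subseteq> U}"
    using U_D(1) by (auto simp: mhom_def PiE_def Pi_def)
  have incl: "compose (carrier M) (\<lambda>x\<in>U. x) h = h" if "h \<in> mhom A M Y" "h ` carrier M \<subseteq> U" for h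
    using that mhomD(1)[OF that(1)] by (auto simp: compose_eq intro!: extensionalityI[of _ "carrier M"])
  have "dual_map (hom_space A M (Y\<lparr>carrier := U\<rparr>)) (\<lambda>h. compose (carrier M) (\<lambda>x\<in>U. x) h) \<xi> =
      \<zero>\<^bsub>dual_space K (hom_space A M (Y\<lparr>carrier := U\<rparr>))\<^esub> \<longleftrightarrow>
    (\<forall>h\<in>mhom A M Y. h ` carrier M \<subseteq> U \<longrightarrow> \<xi> h = \<zero>\<^bsub>K\<^esub>)" (is "?l = ?r \<longleftrightarrow> _")
  proof -
    have "?l = ?r \<longleftrightarrow> (\<forall>h\<in>mhom A M (Y\<lparr>carrier := U\<rparr>). ?l h = ?r h)"
      by (auto simp: dual_map_def intro!: extensionalityI[of _ "mhom A M (Y\<lparr>carrier := U\<rparr>)"])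
    also have "\<dots> \<longleftrightarrow> (\<forall>h\<in>mhom A M Y. h ` carrier M \<subseteq> U \<longrightarrow> \<xi> h = \<zero>\<^bsub>K\<^esub>)"
      by (auto simp: dual_map_def compose_eq eq incl)
    finally show ?thesis .
  qed
  then show ?thesis by (simp add: dual_hom_kernel_def Let_def top U_def[symmetric])
qed

lemma N_simps [simp]:
  "\<zero>\<^bsub>N\<^esub> = (\<lambda>h\<in>mhom A M Y. \<zero>\<^bsub>K\<^esub>)"
  "\<xi> \<oplus>\<^bsub>N\<^esub> \<zeta> = (\<lambda>h\<in>mhom A M Y. \<xi> h \<oplus>\<^bsub>K\<^esub> \<zeta> h)"
  by (simp_all add: dual_hom_kernel_def Let_def top)

lemma N_functional: "\<xi> \<in> carrier N \<Longrightarrow> \<xi> \<in> functionals K H"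
  by (simp add: N_carrier)

lemma N_vanish: "\<lbrakk>\<xi> \<in> carrier N; h \<in> mhom A M Y; \<And>m. m \<in> carrier M \<Longrightarrow> h m \<in> U\<rbrakk> \<Longrightarrow> \<xi> h = \<zero>\<^bsub>K\<^esub>"
  by (auto simp: N_carrier)

text \<open>Chain maps commute with the differential and so preserve its image
  \<open>U\<close>.\<close>

lemma chain_Y:
  assumes "f \<in> carrier C"
  shows "f k \<in> mhom A Y Y" "\<And>u. u \<in> U \<Longrightarrow> f k u \<in> U"
proof -
  show "f k \<in> mhom A Y Y" using chainD(1)[OF assms, of k] by (simp add: top)
  show "f k u \<in> U" if u: "u \<in> U" for u
  proof -
    obtain p where p: "u = cdiff X (k - 1) p" "p \<in> carrier (cterm X (k - 1))"
      using u unfolding U_def by (rule imageE)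
    have "f k u = cdiff X (k - 1) (f (k - 1) p)"
      using chainD(2)[OF assms p(2)] by (simp add: p(1))
    then show ?thesis unfolding U_def using chain_val[OF assms p(2)] by (rule image_eqI)
  qed
qed

text \<open>Of the two terms \<open>d s + s d\<close> the second vanishes because the term above
  degree \<open>k\<close> is zero, and the first has values in the image of
  \<open>d\<close>.\<close>

lemma null_homotopic_Y:
  assumes "n \<in> null_homotopic A X" "x \<in> carrier Y"
  shows "n k x \<in> U"
proof -
  obtain s where s: "homotopy n s" using assms by (auto simp: null_homotopic_iff)
  have x: "x \<in> carrier (cterm X k)" using assms by (simp add: top)
  have sh: "s k \<in> mhom A (cterm X k) (cterm X (k - 1))"
    "s (k + 1) \<in> mhom A (cterm X (k + 1)) (cterm X (k + 1 - 1))"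
    using s unfolding homotopy_def by blast+
  have "cdiff X k x = \<zero>\<^bsub>cterm X (k + 1)\<^esub>" using cdiff_simps(1)[OF x] above by auto
  then have "s (k + 1) (cdiff X k x) = \<zero>\<^bsub>Y\<^esub>"
    using mhom_hom(1)[OF sh(2) cterm_module cterm_module] by (simp add: top)
  moreover have "n k x = cdiff X (k - 1) (s k x) \<oplus>\<^bsub>Y\<^esub> s (k + 1) (cdiff X k x)"
    using s x unfolding homotopy_def top[symmetric] by blast
  moreover have "cdiff X (k - 1) (s k x) \<in> U" using mhomD(2)[OF sh(1) x] by (auto simp: U_def)
  ultimately show ?thesis using U_D(2,3) by metis
qed

lemma comp_H: "w \<in> mhom A Y Y \<Longrightarrow> h \<in> mhom A M Y \<Longrightarrow> compose (carrier M) w h \<in> mhom A M Y"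
  by (rule mhom_comp[OF M.left_module_axioms])

text \<open>The action is defined through an arbitrary representative. Two representatives differ by
  a null-homotopic \<open>n\<close>; as \<open>n\<close> maps \<open>Y\<close> into \<open>U\<close>
  in degree \<open>k\<close>, the contribution of its composite with \<open>h\<close> is killed by
  \<open>\<xi>\<close>.\<close>

lemma action:
  assumes "f \<in> carrier C" "\<xi> \<in> carrier N"
  shows "cls f \<odot>\<^bsub>N\<^esub> \<xi> = (\<lambda>h\<in>mhom A M Y. \<xi> (compose (carrier M) (f k) h))"
proof -
  define f' where "f' = (SOME f'. f' \<in> cls f)"
  have "f' \<in> cls f" unfolding f'_def by (rule someI[of "\<lambda>f'. f' \<in> cls f"], rule cls_mem(2)[OF assms(1)])
  then obtain n where n: "n \<in> null_homotopic A X" and f': "f' = n \<oplus>\<^bsub>C\<^esub> f"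
    using cls_mem(1)[OF assms(1)] by blast
  have nC: "n \<in> carrier C" using n by (simp add: null_homotopic_iff)
  have "\<xi> (compose (carrier M) (f' k) h) = \<xi> (compose (carrier M) (f k) h)" if h: "h \<in> mhom A M Y" for h
  proof -
    note hn = comp_H[OF chain_Y(1)[OF nC] h] and hf = comp_H[OF chain_Y(1)[OF assms(1)] h]
    have "compose (carrier M) (f' k) h = compose (carrier M) (n k) h \<oplus>\<^bsub>H\<^esub> compose (carrier M) (f k) h"
      using mhomD(2)[OF h] by (auto simp: f' compose_def top intro!: restrict_ext simp del: direct_sum_simps)
    then have "\<xi> (compose (carrier M) (f' k) h)
        = \<xi> (compose (carrier M) (n k) h) \<oplus>\<^bsub>K\<^esub> \<xi> (compose (carrier M) (f k) h)"
      using functionalD(3)[OF N_functional[OF assms(2)]] hn hf by (simp only: hom_space_simps(1))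
    moreover have "\<xi> (compose (carrier M) (n k) h) = \<zero>\<^bsub>K\<^esub>"
      using null_homotopic_Y[OF n mhomD(2)[OF h]] by (intro N_vanish[OF assms(2) hn]) (simp add: compose_eq)
    ultimately show ?thesis
      using functionalD(2)[OF N_functional[OF assms(2)]] hf by simp
  qed
  then show ?thesis
    by (auto simp: dual_hom_kernel_def Let_def top f'_def[symmetric] intro!: restrict_ext)
qed

text \<open>Acting on functionals by postcomposition in their argument reverses the order of
  composition; the opposite product of \<open>B\<close> restores it, so the result is a left
  module.\<close>

lemma left_module_N: "left_module B N"
proof (rule left_moduleI[OF ring_B])
  interpret H: left_module K H by (rule H_module)
  interpret DH: left_module K "dual_space K H"
    by (rule left_module_dual_space[OF K.cring_axioms H_module])
  note fd = functionalD[OF N_functional, simplified hom_space_simps(1)]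
  show "abelian_group N"
  proof (rule abelian_group_pointwise[OF K.abelian_group_axioms, of _ "mhom A M Y"])
    show "carrier N \<subseteq> mhom A M Y \<rightarrow>\<^sub>E carrier K"
      using fd(1,2) by (auto simp: PiE_def)
    show "\<xi> \<oplus>\<^bsub>N\<^esub> \<zeta> \<in> carrier N" if "\<xi> \<in> carrier N" "\<zeta> \<in> carrier N" for \<xi> \<zeta>
      using DH.M.a_closed[of \<xi> \<zeta>] that by (simp add: N_carrier)
    show "\<zero>\<^bsub>N\<^esub> \<in> carrier N" using DH.M.zero_closed by (simp add: N_carrier)
    show "(\<lambda>h\<in>mhom A M Y. \<ominus>\<^bsub>K\<^esub> \<xi> h) \<in> carrier N" if "\<xi> \<in> carrier N" for \<xi>
      using mhom_minus[OF H_module left_module_regular[OF K.ring_axioms] N_functional[OF that]] that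
      by (auto simp: N_carrier a_inv_def m_inv_def)
  qed auto
  show act_closed: "b \<odot>\<^bsub>N\<^esub> \<xi> \<in> carrier N" if b: "b \<in> carrier B" and \<xi>: "\<xi> \<in> carrier N" for b \<xi>
  proof -
    obtain f where f: "f \<in> carrier C" "b = cls f" using b unfolding carrier_B by auto
    note w = chain_Y(1)[OF f(1)] and fY = mhomD[OF chain_Y(1)[OF f(1)]]
    have "(\<lambda>h\<in>mhom A M Y. \<xi> (compose (carrier M) (f k) h)) \<in> functionals K H"
    proof (rule functionalI)
      fix h h' assume "h \<in> carrier H" "h' \<in> carrier H"
      then have h: "h \<in> mhom A M Y" "h' \<in> mhom A M Y" by auto
      have "compose (carrier M) (f k) (h \<oplus>\<^bsub>H\<^esub> h') = compose (carrier M) (f k) h \<oplus>\<^bsub>H\<^esub> compose (carrier M) (f k) h'"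
        unfolding compose_def hom_space_simps
        by (rule restrict_ext) (simp add: fY(3) mhomD(2)[OF h(1)] mhomD(2)[OF h(2)] del: direct_sum_simps)
      then show "(\<lambda>h\<in>mhom A M Y. \<xi> (compose (carrier M) (f k) h)) (h \<oplus>\<^bsub>H\<^esub> h')
        = (\<lambda>h\<in>mhom A M Y. \<xi> (compose (carrier M) (f k) h)) h \<oplus>\<^bsub>K\<^esub> (\<lambda>h\<in>mhom A M Y. \<xi> (compose (carrier M) (f k) h)) h'"
        using h H.M.a_closed[of h h'] comp_H[OF w h(1)] comp_H[OF w h(2)] fd(3)[OF \<xi>]
        by (simp del: hom_space_simps(3))
    next
      fix c h assume c: "c \<in> carrier K" and "h \<in> carrier H"
      then have h: "h \<in> mhom A M Y" by simp
      have "compose (carrier M) (f k) (c \<odot>\<^bsub>H\<^esub> h) = c \<odot>\<^bsub>H\<^esub> compose (carrier M) (f k) h"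
        unfolding compose_def hom_space_simps scal_def[symmetric]
        by (rule restrict_ext) (simp add: fY(4)[OF scal_closed[OF c]] mhomD(2)[OF h] del: direct_sum_simps)
      then show "(\<lambda>h\<in>mhom A M Y. \<xi> (compose (carrier M) (f k) h)) (c \<odot>\<^bsub>H\<^esub> h)
        = c \<otimes>\<^bsub>K\<^esub> (\<lambda>h\<in>mhom A M Y. \<xi> (compose (carrier M) (f k) h)) h"
        using h c H.smult_closed[of c h] comp_H[OF w h] fd(4)[OF \<xi>]
        by (simp del: hom_space_simps(4))
    qed (use fd(2)[OF \<xi>] comp_H[OF w] in auto)
    moreover have "\<xi> (compose (carrier M) (f k) h) = \<zero>\<^bsub>K\<^esub>"
      if "h \<in> mhom A M Y" "h ` carrier M \<subseteq> U" for h
    proof (rule N_vanish[OF \<xi> comp_H[OF w that(1)]])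
      fix m assume "m \<in> carrier M"
      moreover from this have "h m \<in> U" using that(2) by blast
      ultimately show "compose (carrier M) (f k) h m \<in> U"
        using chain_Y(2)[OF f(1)] by (simp add: compose_eq)
    qed
    ultimately show ?thesis by (simp add: f(2) action[OF f(1) \<xi>] N_carrier)
  qed
  show "(a \<oplus>\<^bsub>B\<^esub> b) \<odot>\<^bsub>N\<^esub> \<xi> = a \<odot>\<^bsub>N\<^esub> \<xi> \<oplus>\<^bsub>N\<^esub> b \<odot>\<^bsub>N\<^esub> \<xi>"
    if a: "a \<in> carrier B" and b: "b \<in> carrier B" and \<xi>: "\<xi> \<in> carrier N" for a b \<xi>
  proof -
    obtain f g where f: "f \<in> carrier C" "a = cls f" and g: "g \<in> carrier C" "b = cls g"
      using a b unfolding carrier_B by auto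
    have "\<xi> (compose (carrier M) ((f \<oplus>\<^bsub>C\<^esub> g) k) h)
        = \<xi> (compose (carrier M) (f k) h) \<oplus>\<^bsub>K\<^esub> \<xi> (compose (carrier M) (g k) h)" if h: "h \<in> mhom A M Y" for h
    proof -
      have "compose (carrier M) ((f \<oplus>\<^bsub>C\<^esub> g) k) h = compose (carrier M) (f k) h \<oplus>\<^bsub>H\<^esub> compose (carrier M) (g k) h"
        using mhomD(2)[OF h] by (auto simp: compose_def top intro!: restrict_ext simp del: direct_sum_simps)
      then show ?thesis
        using fd(3)[OF \<xi> comp_H[OF chain_Y(1)[OF f(1)] h] comp_H[OF chain_Y(1)[OF g(1)] h]] by simp
    qed
    then show ?thesis
      unfolding f(2) g(2) cls_hom(3)[OF f(1) g(1)] action[OF chain_add[OF f(1) g(1)] \<xi>]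
        action[OF f(1) \<xi>] action[OF g(1) \<xi>] N_simps
      by (intro restrict_ext) (simp del: chain_simps)
  qed
  show "a \<odot>\<^bsub>N\<^esub> (\<xi> \<oplus>\<^bsub>N\<^esub> \<zeta>) = a \<odot>\<^bsub>N\<^esub> \<xi> \<oplus>\<^bsub>N\<^esub> a \<odot>\<^bsub>N\<^esub> \<zeta>"
    if a: "a \<in> carrier B" and \<xi>: "\<xi> \<in> carrier N" "\<zeta> \<in> carrier N" for a \<xi> \<zeta>
  proof -
    obtain f where f: "f \<in> carrier C" "a = cls f" using a unfolding carrier_B by auto
    have "\<xi> \<oplus>\<^bsub>N\<^esub> \<zeta> \<in> carrier N" using DH.M.a_closed[of \<xi> \<zeta>] \<xi> by (simp add: N_carrier)
    from action[OF f(1) this] show ?thesis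
      unfolding f(2) action[OF f(1) \<xi>(1)] action[OF f(1) \<xi>(2)]
      using comp_H[OF chain_Y(1)[OF f(1)]] by (auto intro!: restrict_ext)
  qed
  show "(a \<otimes>\<^bsub>B\<^esub> b) \<odot>\<^bsub>N\<^esub> \<xi> = a \<odot>\<^bsub>N\<^esub> (b \<odot>\<^bsub>N\<^esub> \<xi>)"
    if a: "a \<in> carrier B" and b: "b \<in> carrier B" and \<xi>: "\<xi> \<in> carrier N" for a b \<xi>
  proof -
    obtain f g where f: "f \<in> carrier C" "a = cls f" and g: "g \<in> carrier C" "b = cls g"
      using a b unfolding carrier_B by auto
    have 1: "compose (carrier M) ((g \<otimes>\<^bsub>C\<^esub> f) k) h = compose (carrier M) (g k) (compose (carrier M) (f k) h)"
      if "h \<in> mhom A M Y" for h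
      using mhomD(2)[OF that] mhomD(2)[OF chain_Y(1)[OF f(1)]]
      by (auto simp: compose_def top intro!: restrict_ext simp del: direct_sum_simps)
    show ?thesis
      using action[OF f(1) act_closed[OF b \<xi>]] comp_H[OF chain_Y(1)[OF f(1)]] 1
      unfolding f(2) g(2) cls_hom(2)[OF f(1) g(1)] action[OF chain_mult[OF g(1) f(1)] \<xi>]
        action[OF g(1) \<xi>]
      by (auto intro!: restrict_ext simp del: chain_simps)
  qed
  show "\<one>\<^bsub>B\<^esub> \<odot>\<^bsub>N\<^esub> \<xi> = \<xi>" if \<xi>: "\<xi> \<in> carrier N" for \<xi>
  proof (rule extensionalityI[OF _ fd(1)[OF \<xi>]])
    show "\<one>\<^bsub>B\<^esub> \<odot>\<^bsub>N\<^esub> \<xi> \<in> extensional (mhom A M Y)"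
      unfolding cls_hom(4) action[OF chain_one \<xi>] by simp
    fix h assume h: "h \<in> mhom A M Y"
    have "compose (carrier M) (\<one>\<^bsub>C\<^esub> k) h = h"
      using mhomD(1,2)[OF h] by (auto simp: top compose_eq intro!: extensionalityI[of _ "carrier M"] simp del: direct_sum_simps)
    then show "(\<one>\<^bsub>B\<^esub> \<odot>\<^bsub>N\<^esub> \<xi>) h = \<xi> h"
      unfolding cls_hom(4) action[OF chain_one \<xi>] using h by simp
  qed
qed

section \<open>Chain maps concentrated in degree \<open>k\<close>\<close>

definition "concentrated w = (\<lambda>i. if i = k then w else zero_map (cterm X i) (cterm X i))"

lemma concentrated_k [simp]: "concentrated w k = w"
  by (simp add: concentrated_def)

text \<open>The square leaving degree \<open>k\<close> commutes since its target is zero, and the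
  one entering degree \<open>k\<close> since \<open>w\<close> kills the image of the
  differential.\<close>

lemma concentrated_chain:
  assumes w: "w \<in> mhom A Y Y" and 0: "\<And>u. u \<in> U \<Longrightarrow> w u = \<zero>\<^bsub>Y\<^esub>"
  shows "concentrated w \<in> carrier C"
  unfolding chain_iff
proof (intro conjI allI ballI)
  fix i
  show "concentrated w i \<in> mhom A (cterm X i) (cterm X i)"
    using w mhom_zero_map[OF cterm_module cterm_module] by (simp add: concentrated_def top)
  fix x assume x: "x \<in> carrier (cterm X i)"
  have d0: "cdiff X j \<zero>\<^bsub>cterm X j\<^esub> = \<zero>\<^bsub>cterm X (j + 1)\<^esub>" for j
    by (rule mhom_hom(1)[OF cdiff_hom cterm_module cterm_module])
  note dx = cdiff_simps(1)[OF x]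
  consider "i = k" | "i = k - 1" | "i \<noteq> k" "i + 1 \<noteq> k" by linarith
  then show "cdiff X i (concentrated w i x) = concentrated w (i + 1) (cdiff X i x)"
  proof cases
    case 1
    then have "w x \<in> carrier (cterm X i)" using mhomD(2)[OF w, of x] x by (simp only: top)
    then have "cdiff X i (w x) \<in> carrier (cterm X (i + 1))" by (rule cdiff_simps(1))
    then have "cdiff X i (w x) = \<zero>\<^bsub>cterm X (i + 1)\<^esub>" using above 1 by simp
    then show ?thesis using 1 dx by (simp add: concentrated_def zero_map_def)
  next
    case 2
    have "w (cdiff X i x) = \<zero>\<^bsub>Y\<^esub>"
    proof (rule 0)
      show "cdiff X i x \<in> U" unfolding U_def using x 2 by (intro image_eqI[of _ _ x]) simp_all
    qed
    then show ?thesis using 2 x d0[of i] by (simp add: concentrated_def zero_map_def top)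
  next
    case 3
    then show ?thesis using x dx d0[of i] by (simp add: concentrated_def zero_map_def)
  qed
qed

lemma concentrated_mult:
  assumes "f \<in> carrier C"
  shows "f \<otimes>\<^bsub>C\<^esub> concentrated w = concentrated (compose (carrier Y) (f k) w)"
    "concentrated w \<otimes>\<^bsub>C\<^esub> f = concentrated (compose (carrier Y) w (f k))"
proof -
  have "compose (carrier (cterm X i)) (f i) (zero_map (cterm X i) (cterm X i)) = zero_map (cterm X i) (cterm X i)" for i
    using mhom_hom(1)[OF chainD(1)[OF assms] cterm_module cterm_module]
    unfolding compose_def zero_map_def by (intro restrict_ext) simp
  then show "f \<otimes>\<^bsub>C\<^esub> concentrated w = concentrated (compose (carrier Y) (f k) w)"
    by (auto simp: concentrated_def top simp del: direct_sum_simps)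
  have "compose (carrier (cterm X i)) (zero_map (cterm X i) (cterm X i)) (f i) = zero_map (cterm X i) (cterm X i)" for i
    unfolding compose_def zero_map_def by (intro restrict_ext) (simp add: chain_val[OF assms])
  then show "concentrated w \<otimes>\<^bsub>C\<^esub> f = concentrated (compose (carrier Y) w (f k))"
    by (auto simp: concentrated_def top simp del: direct_sum_simps)
qed

lemma cls_concentrated:
  assumes "concentrated w \<in> carrier C" "f \<in> carrier C"
  shows "cls (concentrated w) \<otimes>\<^bsub>B\<^esub> cls f = cls (concentrated (compose (carrier Y) (f k) w))"
    "cls f \<otimes>\<^bsub>B\<^esub> cls (concentrated w) = cls (concentrated (compose (carrier Y) w (f k)))"
  by (simp_all only: cls_hom(2)[OF assms] cls_hom(2)[OF assms(2,1)] concentrated_mult[OF assms(2)])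

lemma concentrated_add: "concentrated v \<oplus>\<^bsub>C\<^esub> concentrated w = concentrated (\<lambda>y\<in>carrier Y. v y \<oplus>\<^bsub>Y\<^esub> w y)"
proof -
  have "(\<lambda>x\<in>carrier (cterm X i). zero_map (cterm X i) (cterm X i) x \<oplus>\<^bsub>cterm X i\<^esub> zero_map (cterm X i) (cterm X i) x)
      = zero_map (cterm X i) (cterm X i)" for i
  proof -
    interpret T: left_module A "cterm X i" by (rule cterm_module)
    show ?thesis by (simp add: zero_map_def cong: restrict_cong)
  qed
  then show ?thesis by (auto simp: concentrated_def top simp del: direct_sum_simps)
qed

text \<open>The three ways in which an endomorphism of \<open>Y\<close> may factor through the
  summand \<open>DA\<close>. Products in \<open>B\<close> are reversed: classes of chain maps of the
  form \<open>into_DA\<close> lie in \<open>Be\<close>, those of the form \<open>from_DA\<close> in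
  \<open>eB\<close>, and those of the form \<open>on_DA\<close> in \<open>eBe\<close>.\<close>

definition "into_DA q = (\<lambda>y\<in>carrier Y. (\<zero>\<^bsub>I\<^esub>, q y))"
definition "from_DA u = (\<lambda>y\<in>carrier Y. u (snd y))"
definition "on_DA h = (\<lambda>y\<in>carrier Y. (\<zero>\<^bsub>I\<^esub>, h (snd y)))"

lemma into_DA:
  assumes "q \<in> mhom A Y DA"
  shows "into_DA q \<in> mhom A Y Y"
proof (rule mhomI)
  note q = mhomD[OF assms]
  show "into_DA q (x \<oplus>\<^bsub>Y\<^esub> y) = into_DA q x \<oplus>\<^bsub>Y\<^esub> into_DA q y" if "x \<in> carrier Y" "y \<in> carrier Y" for x y
    using that q(3)[OF that] Y.M.a_closed[OF that] by (simp add: into_DA_def del: direct_sum_simps(1) dual_algebra_simps)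
  show "into_DA q (r \<odot>\<^bsub>Y\<^esub> x) = r \<odot>\<^bsub>Y\<^esub> into_DA q x" if "r \<in> carrier A" "x \<in> carrier Y" for r x
    using that q(4)[OF that] Y.smult_closed[OF that] I.smult_r_null[OF that(1)]
    by (simp add: into_DA_def del: direct_sum_simps(1) dual_algebra_simps)
qed (use mhomD(2)[OF assms] in \<open>auto simp: into_DA_def\<close>)

lemma snd_hom: "(\<lambda>y\<in>carrier Y. snd y) \<in> mhom A Y DA"
  using D.M.a_closed D.smult_closed I.smult_closed
  by (intro mhomI) (auto simp del: dual_algebra_simps)

lemma inr_hom: "(\<lambda>\<xi>\<in>carrier DA. (\<zero>\<^bsub>I\<^esub>, \<xi>)) \<in> mhom A DA Y"
  using D.M.a_closed D.smult_closed I.smult_r_null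
  by (intro mhomI) (auto simp del: dual_algebra_simps)

lemma inl_hom: "(\<lambda>x\<in>carrier I. (x, \<zero>\<^bsub>DA\<^esub>)) \<in> mhom A I Y"
  using I.M.a_closed I.smult_closed D.smult_r_null
  by (intro mhomI) (auto simp del: dual_algebra_simps)

lemma from_DA:
  assumes "u \<in> mhom A DA Y"
  shows "from_DA u \<in> mhom A Y Y"
proof -
  have "compose (carrier Y) u (\<lambda>y\<in>carrier Y. snd y) \<in> mhom A Y Y"
    by (rule mhom_comp[OF Y_module snd_hom assms])
  also have "compose (carrier Y) u (\<lambda>y\<in>carrier Y. snd y) = from_DA u"
    by (simp add: compose_def from_DA_def cong: restrict_cong)
  finally show ?thesis .
qed

lemma on_DA:
  assumes "h \<in> mhom A DA DA"
  shows "on_DA h \<in> mhom A Y Y"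
proof -
  have "into_DA (compose (carrier Y) h (\<lambda>y\<in>carrier Y. snd y)) \<in> mhom A Y Y"
    by (rule into_DA[OF mhom_comp[OF Y_module snd_hom assms]])
  also have "into_DA (compose (carrier Y) h (\<lambda>y\<in>carrier Y. snd y)) = on_DA h"
    by (simp add: compose_def into_DA_def on_DA_def cong: restrict_cong)
  finally show ?thesis .
qed

text \<open>Every map that starts with the projection to \<open>DA\<close> kills \<open>U\<close>,
  because elements of \<open>U\<close> have zero component there.\<close>

lemma from_DA_chain: "u \<in> mhom A DA Y \<Longrightarrow> concentrated (from_DA u) \<in> carrier C"
  using U_D(1) U_snd mhom_hom(1)[OF _ left_module_DA Y_module, of u]
  by (intro concentrated_chain from_DA) (auto simp: from_DA_def subset_iff simp del: direct_sum_simps dual_algebra_simps)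

lemma on_DA_chain:
  assumes "h \<in> mhom A DA DA"
  shows "concentrated (on_DA h) \<in> carrier C"
proof (rule concentrated_chain[OF on_DA[OF assms]])
  fix u assume u: "u \<in> U"
  then have "u \<in> carrier Y" using U_D(1) by blast
  then show "on_DA h u = \<zero>\<^bsub>Y\<^esub>"
    using mhom_hom(1)[OF assms left_module_DA left_module_DA] U_snd[OF u]
    by (simp add: on_DA_def del: direct_sum_simps(1) dual_algebra_simps)
qed

section \<open>The idempotent \<open>e\<close> and the identification of \<open>eBe\<close> with
  \<open>A\<close>\<close>

definition "\<epsilon> = on_DA (\<lambda>y. y)"
definition "e = cls (concentrated \<epsilon>)"
definition "\<rho> a = cls (concentrated (on_DA (rmult a)))"

text \<open>This reconciles the unrestricted functions in the definitions of the idempotent and of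
  \<open>corner_to_base\<close> with their extensional versions in \<open>mhom\<close>.\<close>

lemma on_DA_cong: "(\<And>\<xi>. \<xi> \<in> carrier DA \<Longrightarrow> h \<xi> = h' \<xi>) \<Longrightarrow> on_DA h = on_DA h'"
  unfolding on_DA_def by (intro restrict_ext) (auto simp del: dual_algebra_simps)

lemma \<epsilon>_chain: "concentrated \<epsilon> \<in> carrier C"
proof -
  have "\<epsilon> = on_DA (\<lambda>y\<in>carrier DA. y)" unfolding \<epsilon>_def by (rule on_DA_cong) simp
  then show ?thesis using on_DA_chain[OF mhom_id[OF left_module_DA]] by simp
qed

lemma e_B: "e \<in> carrier B"
  unfolding e_def by (rule cls_hom(1)[OF \<epsilon>_chain])

lemma on_DA_compose:
  assumes "\<And>\<xi>. \<xi> \<in> carrier DA \<Longrightarrow> h' \<xi> \<in> carrier DA"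
  shows "compose (carrier Y) (on_DA h) (on_DA h') = on_DA (\<lambda>\<xi>. h (h' \<xi>))"
  unfolding on_DA_def compose_def
proof (rule restrict_ext)
  fix y assume y: "y \<in> carrier Y"
  then have "h' (snd y) \<in> carrier DA" by (intro assms) (simp add: mem_Times_iff)
  then show "(\<lambda>y\<in>carrier Y. (\<zero>\<^bsub>I\<^esub>, h (snd y))) ((\<lambda>y\<in>carrier Y. (\<zero>\<^bsub>I\<^esub>, h' (snd y))) y) =
      (\<zero>\<^bsub>I\<^esub>, h (h' (snd y)))" using y by simp
qed

lemma ee: "e \<otimes>\<^bsub>B\<^esub> e = e"
  unfolding e_def cls_concentrated(1)[OF \<epsilon>_chain \<epsilon>_chain] concentrated_k
  unfolding \<epsilon>_def
  by (subst on_DA_compose) auto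

sublocale B: ring B by (rule ring_B)

sublocale idem: ring_idempotent B e
  by unfold_locales (rule e_B ee)+

lemma \<rho>_chain: "a \<in> carrier A \<Longrightarrow> concentrated (on_DA (rmult a)) \<in> carrier C"
  by (rule on_DA_chain[OF rmult_hom])

lemma rmult_DA: "a \<in> carrier A \<Longrightarrow> \<xi> \<in> carrier DA \<Longrightarrow> rmult a \<xi> \<in> carrier DA"
  by (rule mhomD(2)[OF rmult_hom])

lemma \<rho>_corner:
  assumes "a \<in> carrier A"
  shows "\<rho> a \<in> carrier (corner B e)"
proof -
  have "e \<otimes>\<^bsub>B\<^esub> \<rho> a = \<rho> a"
    unfolding e_def \<rho>_def cls_concentrated(1)[OF \<epsilon>_chain \<rho>_chain[OF assms]] concentrated_k
  unfolding \<epsilon>_def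
    by (subst on_DA_compose) auto
  moreover have "\<rho> a \<otimes>\<^bsub>B\<^esub> e = \<rho> a"
    unfolding e_def \<rho>_def cls_concentrated(2)[OF \<epsilon>_chain \<rho>_chain[OF assms]] concentrated_k
  unfolding \<epsilon>_def
    using rmult_DA[OF assms] by (subst on_DA_compose) auto
  moreover have "\<rho> a \<in> carrier B" unfolding \<rho>_def by (rule cls_hom(1)[OF \<rho>_chain[OF assms]])
  ultimately show ?thesis unfolding idem.carrier_corner by blast
qed

lemma rmult_times:
  assumes "a \<in> carrier A" "b \<in> carrier A" "\<xi> \<in> carrier DA"
  shows "rmult b (rmult a \<xi>) = rmult (a \<otimes> b) \<xi>"
  using assms rmult_val[of a \<xi>] by (auto simp: rmult_def m_assoc intro!: restrict_ext)

text \<open>Right multiplications on \<open>DA\<close> compose in reverse order, and so do products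
  in \<open>B\<close>; the two reversals cancel.\<close>

lemma \<rho>_ring_hom: "\<rho> \<in> ring_hom A (corner B e)"
proof (rule ring_hom_memI)
  fix a b assume a: "a \<in> carrier A" and b: "b \<in> carrier A"
  have "\<rho> a \<otimes>\<^bsub>B\<^esub> \<rho> b = cls (concentrated (on_DA (\<lambda>\<xi>. rmult b (rmult a \<xi>))))"
    unfolding \<rho>_def cls_concentrated(1)[OF \<rho>_chain[OF a] \<rho>_chain[OF b]] concentrated_k
    using rmult_DA[OF a] by (subst on_DA_compose) auto
  also have "on_DA (\<lambda>\<xi>. rmult b (rmult a \<xi>)) = on_DA (rmult (a \<otimes> b))"
    by (rule on_DA_cong) (rule rmult_times[OF a b])
  finally show "\<rho> (a \<otimes> b) = \<rho> a \<otimes>\<^bsub>corner B e\<^esub> \<rho> b" by (simp add: \<rho>_def)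
  have "(\<lambda>y\<in>carrier Y. on_DA (rmult a) y \<oplus>\<^bsub>Y\<^esub> on_DA (rmult b) y) = on_DA (rmult (a \<oplus> b))"
    using a b functionalD(3)[of _ K A]
    by (auto simp: on_DA_def rmult_def l_distr intro!: restrict_ext)
  then show "\<rho> (a \<oplus> b) = \<rho> a \<oplus>\<^bsub>corner B e\<^esub> \<rho> b"
    unfolding \<rho>_def corner_simps cls_hom(3)[OF \<rho>_chain[OF a] \<rho>_chain[OF b]] concentrated_add by simp
next
  have "on_DA (rmult \<one>) = \<epsilon>"
    unfolding \<epsilon>_def by (rule on_DA_cong)
      (use functionalD(1) in \<open>auto simp: rmult_def intro!: extensionalityI[of _ "carrier A"]\<close>)
  then show "\<rho> \<one> = \<one>\<^bsub>corner B e\<^esub>" by (simp add: \<rho>_def e_def)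
qed (rule \<rho>_corner)

text \<open>Homotopic endomorphisms differ in degree \<open>k\<close> by a map into
  \<open>U\<close>. Since \<open>U\<close> has no component in \<open>DA\<close>, the two right
  multiplications coincide on \<open>DA\<close>, and \<open>rmult_inj\<close> applies.\<close>

lemma \<rho>_inj: "inj_on \<rho> (carrier A)"
proof (rule inj_onI)
  fix a b assume a: "a \<in> carrier A" and b: "b \<in> carrier A" and eq: "\<rho> a = \<rho> b"
  have "concentrated (on_DA (rmult a)) \<in> cls (concentrated (on_DA (rmult b)))"
    using cls_mem(2)[OF \<rho>_chain[OF a]] eq by (simp add: \<rho>_def)
  then obtain n where n: "n \<in> null_homotopic A X"
    and an: "concentrated (on_DA (rmult a)) = n \<oplus>\<^bsub>C\<^esub> concentrated (on_DA (rmult b))"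
    using cls_mem(1)[OF \<rho>_chain[OF b]] by blast
  show "a = b"
  proof (rule rmult_inj[OF a b])
    fix \<xi> assume \<xi>: "\<xi> \<in> carrier DA"
    let ?y = "(\<zero>\<^bsub>I\<^esub>, \<xi>)"
    have y: "?y \<in> carrier Y" using \<xi> by simp
    have "on_DA (rmult a) ?y = n k ?y \<oplus>\<^bsub>Y\<^esub> on_DA (rmult b) ?y"
      using fun_cong[OF fun_cong[OF an, of k], of ?y] y
      by (simp add: top del: direct_sum_simps)
    then have "rmult a \<xi> = \<zero>\<^bsub>DA\<^esub> \<oplus>\<^bsub>DA\<^esub> rmult b \<xi>"
      using y U_snd[OF null_homotopic_Y[OF n y]] by (simp add: on_DA_def del: dual_algebra_simps)
    then show "rmult a \<xi> = rmult b \<xi>" using rmult_DA[OF b \<xi>] by (simp del: dual_algebra_simps)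
  qed
qed

text \<open>An element \<open>x = e x e\<close> is represented by a chain map that starts with the
  projection to \<open>DA\<close> and ends with its inclusion in degree \<open>k\<close>. What
  remains is an endomorphism of \<open>DA\<close>, hence a right multiplication.\<close>

lemma \<rho>_surj: "\<rho> ` carrier A = carrier (corner B e)"
proof
  show "\<rho> ` carrier A \<subseteq> carrier (corner B e)" using \<rho>_corner by blast
  show "carrier (corner B e) \<subseteq> \<rho> ` carrier A"
  proof
    fix x assume "x \<in> carrier (corner B e)"
    then have x: "x \<in> carrier B" "e \<otimes>\<^bsub>B\<^esub> x = x" "x \<otimes>\<^bsub>B\<^esub> e = x" unfolding idem.carrier_corner by blast+
    obtain f where f: "f \<in> carrier C" "x = cls f" using x(1) unfolding carrier_B by auto
    note fY = chain_Y(1)[OF f(1)]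
    have ef: "concentrated (compose (carrier Y) \<epsilon> (f k)) \<in> carrier C"
      using chain_mult[OF \<epsilon>_chain f(1)] by (simp only: concentrated_mult(2)[OF f(1)])
    have "x = e \<otimes>\<^bsub>B\<^esub> (x \<otimes>\<^bsub>B\<^esub> e)" using x by (simp only:)
    also have "\<dots> = cls (concentrated (compose (carrier Y) (compose (carrier Y) \<epsilon> (f k)) \<epsilon>))"
      unfolding e_def f(2)
      by (simp only: cls_concentrated(2)[OF \<epsilon>_chain f(1)] cls_concentrated(1)[OF \<epsilon>_chain ef] concentrated_k)
    finally have xc: "x = cls (concentrated (compose (carrier Y) (compose (carrier Y) \<epsilon> (f k)) \<epsilon>))" .
    let ?\<phi> = "compose (carrier DA) (\<lambda>y\<in>carrier Y. snd y) (compose (carrier DA) (f k) (\<lambda>\<xi>\<in>carrier DA. (\<zero>\<^bsub>I\<^esub>, \<xi>)))"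
    have "?\<phi> \<in> mhom A DA DA"
      by (rule mhom_comp[OF left_module_DA mhom_comp[OF left_module_DA inr_hom fY] snd_hom])
    then obtain a where a: "a \<in> carrier A" "?\<phi> = rmult a" by (rule DA_endomorphism)
    have "compose (carrier Y) (compose (carrier Y) \<epsilon> (f k)) \<epsilon> = on_DA ?\<phi>"
      using mhomD(2)[OF fY]
      by (auto simp: \<epsilon>_def on_DA_def compose_def intro!: restrict_ext simp del: dual_algebra_simps)
    then have "x = \<rho> a" using xc a(2) by (simp add: \<rho>_def)
    then show "x \<in> \<rho> ` carrier A" using a(1) by blast
  qed
qed

definition "\<sigma> = inv_into (carrier A) \<rho>"

lemma \<sigma>_ring_hom: "\<sigma> \<in> ring_hom (corner B e) A"
proof -
  have "\<rho> \<in> ring_iso A (corner B e)"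
    using \<rho>_ring_hom \<rho>_inj \<rho>_surj by (simp add: ring_iso_def bij_betw_def del: corner_simps)
  from ring_iso_set_sym[OF ring_axioms this] show ?thesis
    by (simp only: \<sigma>_def ring_iso_def mem_Collect_eq)
qed

lemma \<rho>_\<sigma>: "x \<in> carrier (corner B e) \<Longrightarrow> \<rho> (\<sigma> x) = x \<and> \<sigma> x \<in> carrier A"
  unfolding \<sigma>_def \<rho>_surj[symmetric] by (simp add: f_inv_into_f inv_into_into)

text \<open>Through \<open>Hom_A(M, DA) = DM\<close>, given by evaluation at \<open>\<one>\<close>,
  this is the canonical map of \<open>M\<close> to its bidual, extended by zero on the component of
  \<open>h\<close> in \<open>I\<close>.\<close>

definition "\<psi> m = (\<lambda>h\<in>mhom A M Y. snd (h m) \<one>)"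

end

lemma fg_module_direct_sum:
  assumes "fg_module R M" "fg_module R N"
  shows "fg_module R (direct_sum M N)"
proof -
  interpret M: left_module R M using assms by (simp add: fg_module_def)
  interpret N: left_module R N using assms by (simp add: fg_module_def)
  have MN: "left_module R (direct_sum M N)"
    by (rule left_module_direct_sum) (rule M.left_module_axioms N.left_module_axioms)+
  interpret MN: left_module R "direct_sum M N" by (rule MN)
  obtain S where S: "finite S" "S \<subseteq> carrier M"
    "\<And>U. submodule U R M \<Longrightarrow> S \<subseteq> U \<Longrightarrow> U = carrier M"
    using finitely_generatedE[of R M] assms(1) unfolding fg_module_def by metis
  obtain T where T: "finite T" "T \<subseteq> carrier N"
    "\<And>U. submodule U R N \<Longrightarrow> T \<subseteq> U \<Longrightarrow> U = carrier N"
    using finitely_generatedE[of R N] assms(2) unfolding fg_module_def by metis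
  have "finitely_generated R (direct_sum M N)"
  proof (rule finitely_generatedI[OF MN, of "S \<times> {\<zero>\<^bsub>N\<^esub>} \<union> {\<zero>\<^bsub>M\<^esub>} \<times> T"])
    fix W assume W: "submodule W R (direct_sum M N)" "S \<times> {\<zero>\<^bsub>N\<^esub>} \<union> {\<zero>\<^bsub>M\<^esub>} \<times> T \<subseteq> W"
    note D = MN.submodule_D[OF W(1), simplified]
    have add: "(x \<oplus>\<^bsub>M\<^esub> x', y \<oplus>\<^bsub>N\<^esub> y') \<in> W" if "(x, y) \<in> W" "(x', y') \<in> W" for x x' y y'
      using D(3)[OF that] by simp
    have smult: "(a \<odot>\<^bsub>M\<^esub> x, a \<odot>\<^bsub>N\<^esub> y) \<in> W" if "a \<in> carrier R" "(x, y) \<in> W" for a x y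
      using D(4)[OF that] by simp
    have "{x \<in> carrier M. (x, \<zero>\<^bsub>N\<^esub>) \<in> W} = carrier M"
      by (rule S(3), rule M.submodule_I)
        (use W(2) S(2) D(2) add[of _ "\<zero>\<^bsub>N\<^esub>" _ "\<zero>\<^bsub>N\<^esub>"] smult[of _ _ "\<zero>\<^bsub>N\<^esub>"] in
          \<open>auto simp: M.smult_closed N.smult_r_null\<close>)
    moreover have "{y \<in> carrier N. (\<zero>\<^bsub>M\<^esub>, y) \<in> W} = carrier N"
      by (rule T(3), rule N.submodule_I)
        (use W(2) T(2) D(2) add[of "\<zero>\<^bsub>M\<^esub>" _ "\<zero>\<^bsub>M\<^esub>"] smult[of _ "\<zero>\<^bsub>M\<^esub>"] in
          \<open>auto simp: N.smult_closed M.smult_r_null\<close>)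
    ultimately have "(x, y) \<in> W" if "x \<in> carrier M" "y \<in> carrier N" for x y
      using add[of x "\<zero>\<^bsub>N\<^esub>" "\<zero>\<^bsub>M\<^esub>" y] that by auto
    then show "W = carrier (direct_sum M N)" using D(1) by auto
  qed (use S T in auto)
  then show ?thesis using MN by (simp add: fg_module_def)
qed

section \<open>The copy of \<open>M\<close> in the kernel module, generation and
  nondegeneracy\<close>

context kernel_setting
begin

lemma val_Y: "h \<in> mhom A M Y \<Longrightarrow> m \<in> carrier M \<Longrightarrow> snd (h m) \<in> carrier DA"
  using mhomD(2)[of h A M Y m] by (simp add: mem_Times_iff)

lemma val_snd_hom:
  assumes "h \<in> mhom A M Y"
  shows "(\<lambda>m\<in>carrier M. snd (h m)) \<in> mhom A M DA"
proof -
  have "compose (carrier M) (\<lambda>y\<in>carrier Y. snd y) h \<in> mhom A M DA"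
    by (rule mhom_comp[OF M.left_module_axioms assms snd_hom])
  also have "compose (carrier M) (\<lambda>y\<in>carrier Y. snd y) h = (\<lambda>m\<in>carrier M. snd (h m))"
    unfolding compose_def by (rule restrict_ext) (simp add: mhomD(2)[OF assms] del: direct_sum_simps)
  finally show ?thesis .
qed

lemma \<psi>_N:
  assumes m: "m \<in> carrier M" shows "\<psi> m \<in> carrier N"
proof -
  interpret H: left_module K H by (rule H_module)
  have fn: "snd (h m) \<in> functionals K A" if "h \<in> mhom A M Y" for h
    using val_Y[OF that m] by simp
  have "\<psi> m \<in> functionals K H"
  proof (rule functionalI)
    fix h h' assume h: "h \<in> carrier H" "h' \<in> carrier H"
    then show "\<psi> m (h \<oplus>\<^bsub>H\<^esub> h') = \<psi> m h \<oplus>\<^bsub>K\<^esub> \<psi> m h'"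
      using H.M.a_closed[OF h] m by (simp add: \<psi>_def)
  next
    fix c h assume c: "c \<in> carrier K" and h: "h \<in> carrier H"
    then have "snd (h m) (scal c) = c \<otimes>\<^bsub>K\<^esub> snd (h m) \<one>"
      using functionalD(4)[OF fn c one_closed] by (simp add: scal_def)
    then show "\<psi> m (c \<odot>\<^bsub>H\<^esub> h) = c \<otimes>\<^bsub>K\<^esub> \<psi> m h"
      using H.smult_closed[OF c h] m h c by (simp add: \<psi>_def flip: scal_def)
  qed (use fn DA_val in \<open>auto simp: \<psi>_def\<close>)
  moreover have "\<psi> m h = \<zero>\<^bsub>K\<^esub>" if "h \<in> mhom A M Y" "h ` carrier M \<subseteq> U" for h
  proof -
    have "h m \<in> U" using that(2) m by blast
    then show ?thesis using U_snd[of "h m"] that(1) by (simp add: \<psi>_def)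
  qed
  ultimately show ?thesis by (simp add: N_carrier)
qed

lemma \<psi>_add:
  assumes "m \<in> carrier M" "n \<in> carrier M"
  shows "\<psi> (m \<oplus>\<^bsub>M\<^esub> n) = \<psi> m \<oplus>\<^bsub>N\<^esub> \<psi> n"
  using assms unfolding N_simps \<psi>_def
  by (intro restrict_ext) (simp add: mhomD(3)[of _ A M Y])

text \<open>With \<open>q\<close> the component of \<open>h\<close> in \<open>DA\<close> and
  \<open>a = \<sigma> x\<close>, the right action gives \<open>(q(m) a)(\<one>) = q(m)(a)\<close>,
  while the left action gives \<open>q(a m)(\<one>) = (a q(m))(\<one>) = q(m)(a)\<close>.\<close>

lemma \<psi>_smult:
  assumes x: "x \<in> carrier (corner B e)" and m: "m \<in> carrier M"
  shows "\<psi> (\<sigma> x \<odot>\<^bsub>M\<^esub> m) = x \<odot>\<^bsub>N\<^esub> \<psi> m"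
proof -
  define a where "a = \<sigma> x"
  have a: "a \<in> carrier A" and xa: "x = cls (concentrated (on_DA (rmult a)))"
    using \<rho>_\<sigma>[OF x] by (auto simp: a_def \<rho>_def)
  show ?thesis
    unfolding a_def[symmetric]
    unfolding xa action[OF \<rho>_chain[OF a] \<psi>_N[OF m]] concentrated_k
    unfolding \<psi>_def[of "a \<odot>\<^bsub>M\<^esub> m"]
  proof (rule restrict_ext)
    fix h assume h: "h \<in> mhom A M Y"
    have "compose (carrier M) (on_DA (rmult a)) h \<in> mhom A M Y"
      by (rule comp_H[OF on_DA[OF rmult_hom[OF a]] h])
    then have "\<psi> m (compose (carrier M) (on_DA (rmult a)) h) = rmult a (snd (h m)) \<one>"
      using m mhomD(2)[OF h m] by (simp add: \<psi>_def compose_eq on_DA_def del: direct_sum_simps)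
    also have "\<dots> = snd (h m) a" using val_Y[OF h m] a by (simp add: rmult_def)
    also have "\<dots> = snd (h (a \<odot>\<^bsub>M\<^esub> m)) \<one>"
      using a m by (simp add: mhomD(4)[OF h])
    finally show "snd (h (a \<odot>\<^bsub>M\<^esub> m)) \<one> = \<psi> m (compose (carrier M) (on_DA (rmult a)) h)" ..
  qed
qed

text \<open>Every functional \<open>c\<close> on \<open>M\<close> is recovered from
  \<open>\<psi>\<close> by testing it on the homomorphism to \<open>DA\<close> that corresponds to
  \<open>c\<close>, and functionals separate points.\<close>

lemma \<psi>_inj: "inj_on \<psi> (carrier M)"
proof (rule inj_onI)
  fix m n assume mn: "m \<in> carrier M" "n \<in> carrier M" and eq: "\<psi> m = \<psi> n"
  show "m = n"
  proof (rule functional_eqI[OF K.field_axioms left_module_ground[OF M.left_module_axioms]])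
    fix c assume c: "c \<in> functionals K (ground M)"
    let ?h = "compose (carrier M) (\<lambda>\<xi>\<in>carrier DA. (\<zero>\<^bsub>I\<^esub>, \<xi>)) (\<lambda>m\<in>carrier M. \<lambda>a\<in>carrier A. c (a \<odot>\<^bsub>M\<^esub> m))"
    note q = dual_hom_of_functional[OF M.left_module_axioms c]
    have h: "?h \<in> mhom A M Y" by (rule mhom_comp[OF M.left_module_axioms q inr_hom])
    have "\<psi> x ?h = c x" if "x \<in> carrier M" for x
      using h mhomD(2)[OF q that] that by (simp add: \<psi>_def compose_eq M.smult_one)
    then show "c m = c n" using eq mn by metis
  qed (use mn in auto)
qed

lemma quotient_functional:
  assumes "y \<in> carrier Y" "y \<notin> U"
  obtains \<omega> where "\<omega> \<in> functionals K (ground Y)" "\<And>u. u \<in> U \<Longrightarrow> \<omega> u = \<zero>\<^bsub>K\<^esub>" "\<omega> y = \<one>\<^bsub>K\<^esub>"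
proof -
  have G: "left_module K (ground Y)" by (rule left_module_ground[OF Y_module])
  have "submodule U K (ground Y)"
    by (rule left_module.submodule_I[OF G]) (use U_D in \<open>simp_all del: direct_sum_simps\<close>)
  then show ?thesis
    using exists_functional[OF K.field_axioms G _ _ assms(2)] assms(1) that by (metis ground_simps(1))
qed

text \<open>By duality it suffices that a homomorphism \<open>w\<close> from \<open>M\<close> to \<open>Y\<close> has image in \<open>U\<close> as soon
  as \<open>\<omega> (w m) = 0\<close> for all \<open>m\<close> and all functionals \<open>\<omega>\<close> vanishing on \<open>U\<close>.\<close>

lemma \<psi>_generates:
  assumes W: "submodule W B N" and \<psi>W: "\<psi> ` carrier M \<subseteq> W"
  shows "W = carrier N"
proof -
  interpret N: left_module B N by (rule left_module_N)
  interpret H: left_module K H by (rule H_module)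
  interpret DH: left_module K "dual_space K H"
    by (rule left_module_dual_space[OF K.cring_axioms H_module])
  note WD = N.submodule_D[OF W]
  define ev where "ev \<omega> m = (\<lambda>h\<in>mhom A M Y. \<omega> (h m))" for \<omega> :: "'m \<times> ('a \<Rightarrow> 'k) \<Rightarrow> 'k" and m
  have ev_W: "ev \<omega> m \<in> W"
    if \<omega>: "\<omega> \<in> functionals K (ground Y)" "\<And>u. u \<in> U \<Longrightarrow> \<omega> u = \<zero>\<^bsub>K\<^esub>" and m: "m \<in> carrier M" for \<omega> m
  proof -
    \<comment> \<open>The homomorphism to \<open>DA\<close> that corresponds to
      \<open>\<omega>\<close>. It vanishes on \<open>U\<close>, and not only at
      \<open>\<one>\<close>, because \<open>U\<close> is closed under \<open>A\<close>; hence it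
      yields a chain map.\<close>
    define q where "q = (\<lambda>y\<in>carrier Y. \<lambda>a\<in>carrier A. \<omega> (a \<odot>\<^bsub>Y\<^esub> y))"
    have q: "q \<in> mhom A Y DA"
      unfolding q_def by (rule dual_hom_of_functional[OF Y_module \<omega>(1)])
    have ch: "concentrated (into_DA q) \<in> carrier C"
    proof (rule concentrated_chain[OF into_DA[OF q]])
      fix u assume u: "u \<in> U"
      then have uY: "u \<in> carrier Y" using U_D(1) by blast
      have "q u = \<zero>\<^bsub>DA\<^esub>"
        using uY U_D(4)[OF _ u] by (simp add: q_def \<omega>(2) del: direct_sum_simps cong: restrict_cong)
      then show "into_DA q u = \<zero>\<^bsub>Y\<^esub>"
        using uY by (simp add: into_DA_def del: direct_sum_simps(1) dual_algebra_simps)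
    qed
    have "cls (concentrated (into_DA q)) \<odot>\<^bsub>N\<^esub> \<psi> m = ev \<omega> m"
      unfolding action[OF ch \<psi>_N[OF m]] ev_def concentrated_k
    proof (rule restrict_ext)
      fix h assume h: "h \<in> mhom A M Y"
      have "compose (carrier M) (into_DA q) h \<in> mhom A M Y"
        by (rule comp_H[OF into_DA[OF q] h])
      then have "\<psi> m (compose (carrier M) (into_DA q) h) = q (h m) \<one>"
        using m mhomD(2)[OF h m] by (simp add: \<psi>_def compose_eq into_DA_def del: direct_sum_simps)
      also have "\<dots> = \<omega> (h m)"
        using Y.smult_one[OF mhomD(2)[OF h m]] mhomD(2)[OF h m] by (simp add: q_def del: direct_sum_simps)
      finally show "\<psi> m (compose (carrier M) (into_DA q) h) = \<omega> (h m)" .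
    qed
    then show ?thesis
      using WD(4)[OF cls_hom(1)[OF ch]] \<psi>W m by (metis image_subset_iff)
  qed
  \<comment> \<open>\<open>W\<close> is known to be closed under \<open>B\<close>, whereas
    separation by functionals needs a subspace over \<open>K\<close>. \<open>S\<close> is the
    largest \<open>K\<close>-subspace contained in \<open>W\<close>.\<close>
  define S where "S = {\<xi> \<in> carrier (dual_space K H). \<forall>c\<in>carrier K. c \<odot>\<^bsub>dual_space K H\<^esub> \<xi> \<in> W}"
  have W_add: "\<xi> \<oplus>\<^bsub>dual_space K H\<^esub> \<zeta> \<in> W" if "\<xi> \<in> W" "\<zeta> \<in> W" for \<xi> \<zeta>
    using WD(3)[OF that] by simp
  have S: "submodule S K (dual_space K H)"
  proof (rule DH.submodule_I)
    show "\<zero>\<^bsub>dual_space K H\<^esub> \<in> S"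
      using WD(2) DH.M.zero_closed by (simp add: S_def DH.smult_r_null del: dual_space_simps) simp
  next
    fix \<xi> \<zeta> assume *: "\<xi> \<in> S" "\<zeta> \<in> S"
    then show "\<xi> \<oplus>\<^bsub>dual_space K H\<^esub> \<zeta> \<in> S"
      using W_add by (auto simp: S_def DH.smult_r_distr simp del: dual_space_simps)
  next
    fix c \<xi> assume *: "c \<in> carrier K" "\<xi> \<in> S"
    then show "c \<odot>\<^bsub>dual_space K H\<^esub> \<xi> \<in> S"
      by (auto simp: S_def DH.smult_closed simp flip: DH.smult_assoc simp del: dual_space_simps)
  qed (auto simp: S_def)
  have "carrier N \<subseteq> W"
  proof
    fix \<xi> assume \<xi>: "\<xi> \<in> carrier N"
    have \<xi>D: "\<xi> \<in> carrier (dual_space K H)" using N_functional[OF \<xi>] by simp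
    have "\<xi> \<in> S"
    proof (rule ccontr)
      assume "\<xi> \<notin> S"
      \<comment> \<open>A functional on the dual of \<open>H\<close> that separates
        \<open>\<xi>\<close> from \<open>S\<close>. As \<open>H\<close> is finite-dimensional, it is
        evaluation at some homomorphism \<open>w\<close>, and the contradiction comes from showing
        that \<open>w\<close> maps into \<open>U\<close>.\<close>
      then obtain \<Phi> where \<Phi>: "\<Phi> \<in> functionals K (dual_space K H)"
        "\<And>\<zeta>. \<zeta> \<in> S \<Longrightarrow> \<Phi> \<zeta> = \<zero>\<^bsub>K\<^esub>" "\<Phi> \<xi> = \<one>\<^bsub>K\<^esub>"
        using exists_functional[OF K.field_axioms DH.left_module_axioms S \<xi>D] by blast
      have fgY: "fg_module A Y" by (rule fg_module_direct_sum[OF fg_I fg_module_DA])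
      obtain w where w: "w \<in> carrier H" "\<And>\<zeta>. \<zeta> \<in> functionals K H \<Longrightarrow> \<Phi> \<zeta> = \<zeta> w"
        by (rule bidual_evaluation[OF K.field_axioms fin_dim_hom_space[OF fg_M fgY] \<Phi>(1)], rule that)
      have wm: "w \<in> mhom A M Y" using w(1) by simp
      have "w m \<in> U" if m: "m \<in> carrier M" for m
      proof (rule ccontr)
        assume wU: "w m \<notin> U"
        obtain \<omega> where \<omega>: "\<omega> \<in> functionals K (ground Y)" "\<And>u. u \<in> U \<Longrightarrow> \<omega> u = \<zero>\<^bsub>K\<^esub>" "\<omega> (w m) = \<one>\<^bsub>K\<^esub>"
          by (rule quotient_functional[OF mhomD(2)[OF wm m] wU], rule that)
        interpret DY: left_module K "dual_space K (ground Y)"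
          by (rule left_module_dual_space[OF K.cring_axioms left_module_ground[OF Y_module]])
        have evN: "ev \<omega> m \<in> carrier N" using ev_W[OF \<omega>(1,2) m] WD(1) by blast
        \<comment> \<open>Multiples of \<open>\<omega>\<close> also vanish on \<open>U\<close>, so
          the multiples of the functional \<open>ev \<omega> m\<close> lie in \<open>W\<close>,
          which puts it into \<open>S\<close>.\<close>
        have "c \<odot>\<^bsub>dual_space K H\<^esub> ev \<omega> m \<in> W" if c: "c \<in> carrier K" for c
        proof -
          have "c \<odot>\<^bsub>dual_space K (ground Y)\<^esub> \<omega> \<in> functionals K (ground Y)"
            using DY.smult_closed[OF c, of \<omega>] \<omega>(1) by simp
          moreover have "(c \<odot>\<^bsub>dual_space K (ground Y)\<^esub> \<omega>) u = \<zero>\<^bsub>K\<^esub>" if "u \<in> U" for u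
            using that U_D(1) c by (auto simp: \<omega>(2))
          ultimately have "ev (c \<odot>\<^bsub>dual_space K (ground Y)\<^esub> \<omega>) m \<in> W" using m by (rule ev_W)
          also have "ev (c \<odot>\<^bsub>dual_space K (ground Y)\<^esub> \<omega>) m = c \<odot>\<^bsub>dual_space K H\<^esub> ev \<omega> m"
            unfolding ev_def dual_space_simps hom_space_simps(1) ground_simps(1)
            by (rule restrict_ext) (simp add: mhomD(2)[OF _ m] del: direct_sum_simps)
          finally show ?thesis .
        qed
        then have "ev \<omega> m \<in> S" using N_functional[OF evN] by (simp add: S_def del: dual_space_simps(4))
        then have "ev \<omega> m w = \<zero>\<^bsub>K\<^esub>" using \<Phi>(2) w(2)[OF N_functional[OF evN]] by simp
        then show False using \<omega>(3) wm by (simp add: ev_def)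
      qed
      then have "\<xi> w = \<zero>\<^bsub>K\<^esub>" by (rule N_vanish[OF \<xi> wm])
      then show False using \<Phi>(3) w(2)[OF N_functional[OF \<xi>]] by simp
    qed
    then have "\<one>\<^bsub>K\<^esub> \<odot>\<^bsub>dual_space K H\<^esub> \<xi> \<in> W" by (simp add: S_def del: dual_space_simps)
    then show "\<xi> \<in> W" using DH.smult_one[OF \<xi>D] by (simp only:)
  qed
  then show ?thesis using WD(1) by blast
qed

lemma N_nondegenerate:
  assumes \<xi>: "\<xi> \<in> carrier N" and 0: "\<And>x. x \<in> carrier (right_ideal_module B e) \<Longrightarrow> x \<odot>\<^bsub>N\<^esub> \<xi> = \<zero>\<^bsub>N\<^esub>"
  shows "\<xi> = \<zero>\<^bsub>N\<^esub>"
proof (rule extensionalityI[of _ "mhom A M Y"])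
  interpret H: left_module K H by (rule H_module)
  note fd = functionalD[OF N_functional[OF \<xi>], simplified hom_space_simps(1)]
  show "\<xi> \<in> extensional (mhom A M Y)" by (rule fd(1))
  have comp: "\<xi> (compose (carrier M) u v) = \<zero>\<^bsub>K\<^esub>" if u: "u \<in> mhom A DA Y" and v: "v \<in> mhom A M DA" for u v
  proof -
    note ch = from_DA_chain[OF u]
    \<comment> \<open>Left multiplication by \<open>e\<close> in the opposite ring is precomposition
      with the projection to \<open>DA\<close>, which does not change a map starting with that
      projection.\<close>
    have "e \<otimes>\<^bsub>B\<^esub> cls (concentrated (from_DA u)) = cls (concentrated (from_DA u))"
    proof -
      have "compose (carrier Y) (from_DA u) \<epsilon> = from_DA u"
        unfolding compose_def from_DA_def \<epsilon>_def on_DA_def by (rule restrict_ext) auto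
      then show ?thesis
        unfolding e_def cls_concentrated(1)[OF \<epsilon>_chain ch] concentrated_k by simp
    qed
    then have "cls (concentrated (from_DA u)) \<in> carrier (right_ideal_module B e)"
      unfolding idem.carrier_right_ideal using cls_hom(1)[OF ch] by blast
    from 0[OF this] have z: "(\<lambda>h\<in>mhom A M Y. \<xi> (compose (carrier M) (from_DA u) h)) = \<zero>\<^bsub>N\<^esub>"
      unfolding action[OF ch \<xi>] concentrated_k .
    \<comment> \<open>The test homomorphism is \<open>v\<close> followed by the inclusion of
      \<open>DA\<close> into \<open>Y\<close>, so that applying \<open>from_DA u\<close> to it gives
      exactly \<open>u\<close> after \<open>v\<close>.\<close>
    let ?h = "compose (carrier M) (\<lambda>\<xi>\<in>carrier DA. (\<zero>\<^bsub>I\<^esub>, \<xi>)) v"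
    have h: "?h \<in> mhom A M Y" by (rule mhom_comp[OF M.left_module_axioms v inr_hom])
    have "compose (carrier M) (from_DA u) ?h = compose (carrier M) u v"
      unfolding compose_def from_DA_def
      by (rule restrict_ext) (use mhomD(2)[OF v] in simp)
    then show ?thesis using fun_cong[OF z, of ?h] h by simp
  qed
  define P where "P f \<longleftrightarrow> \<xi> (compose (carrier M) (\<lambda>x\<in>carrier I. (x, \<zero>\<^bsub>DA\<^esub>)) f) = \<zero>\<^bsub>K\<^esub>" for f
  have inl: "compose (carrier M) (\<lambda>x\<in>carrier I. (x, \<zero>\<^bsub>DA\<^esub>)) f \<in> mhom A M Y" if "f \<in> mhom A M I" for f
    by (rule mhom_comp[OF M.left_module_axioms that inl_hom])
  fix h assume h: "h \<in> mhom A M Y"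
  \<comment> \<open>\<open>h\<close> is the sum of its components in \<open>I\<close> and
    \<open>DA\<close>. The second visibly factors through \<open>DA\<close>; the first is a sum of
    such maps by \<open>injective_hom_induct\<close>.\<close>
  define h1 where "h1 = (\<lambda>m\<in>carrier M. fst (h m))"
  have h1: "h1 \<in> mhom A M I"
    using mhomD[OF h] by (intro mhomI) (auto simp: h1_def mem_Times_iff M.smult_closed)
  have "P h1"
  proof (rule injective_hom_induct[OF inj_I M.left_module_axioms h1])
    have "compose (carrier M) (\<lambda>x\<in>carrier I. (x, \<zero>\<^bsub>DA\<^esub>)) (zero_map M I) = \<zero>\<^bsub>H\<^esub>"
      by (simp add: compose_def zero_map_def cong: restrict_cong)
    then show "P (zero_map M I)"
      using functional_hom(1)[OF N_functional[OF \<xi>] H_module] by (simp add: P_def)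
  next
    fix f g assume f: "f \<in> mhom A M I" and g: "g \<in> mhom A M I" and Pf: "P f" and Pg: "P g"
    have "compose (carrier M) (\<lambda>x\<in>carrier I. (x, \<zero>\<^bsub>DA\<^esub>)) (\<lambda>x\<in>carrier M. f x \<oplus>\<^bsub>I\<^esub> g x)
      = compose (carrier M) (\<lambda>x\<in>carrier I. (x, \<zero>\<^bsub>DA\<^esub>)) f \<oplus>\<^bsub>H\<^esub> compose (carrier M) (\<lambda>x\<in>carrier I. (x, \<zero>\<^bsub>DA\<^esub>)) g"
      unfolding compose_def hom_space_simps
      by (rule restrict_ext) (simp add: mhomD(2)[OF f] mhomD(2)[OF g] del: dual_algebra_simps)
    then show "P (\<lambda>x\<in>carrier M. f x \<oplus>\<^bsub>I\<^esub> g x)"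
      using fd(3)[OF inl[OF f] inl[OF g]] Pf Pg by (simp add: P_def del: hom_space_simps dual_algebra_simps)
  next
    fix u v assume u: "u \<in> mhom A DA I" and v: "v \<in> mhom A M DA"
    have "compose (carrier DA) (\<lambda>x\<in>carrier I. (x, \<zero>\<^bsub>DA\<^esub>)) u \<in> mhom A DA Y"
      by (rule mhom_comp[OF left_module_DA u inl_hom])
    moreover have "v \<in> carrier M \<rightarrow> carrier DA" using mhomD(2)[OF v] by blast
    ultimately show "P (compose (carrier M) u v)"
      using comp[OF _ v] by (simp only: P_def compose_assoc)
  qed
  have h2: "\<xi> (compose (carrier M) (\<lambda>\<xi>\<in>carrier DA. (\<zero>\<^bsub>I\<^esub>, \<xi>)) (\<lambda>m\<in>carrier M. snd (h m))) = \<zero>\<^bsub>K\<^esub>"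
    by (rule comp[OF inr_hom val_snd_hom[OF h]])
  have h2m: "compose (carrier M) (\<lambda>\<xi>\<in>carrier DA. (\<zero>\<^bsub>I\<^esub>, \<xi>)) (\<lambda>m\<in>carrier M. snd (h m)) \<in> mhom A M Y"
    by (rule mhom_comp[OF M.left_module_axioms val_snd_hom[OF h] inr_hom])
  have "h = compose (carrier M) (\<lambda>x\<in>carrier I. (x, \<zero>\<^bsub>DA\<^esub>)) h1 \<oplus>\<^bsub>H\<^esub>
      compose (carrier M) (\<lambda>\<xi>\<in>carrier DA. (\<zero>\<^bsub>I\<^esub>, \<xi>)) (\<lambda>m\<in>carrier M. snd (h m))"
  proof (rule extensionalityI[OF mhomD(1)[OF h]])
    fix m assume m: "m \<in> carrier M"
    show "h m = (compose (carrier M) (\<lambda>x\<in>carrier I. (x, \<zero>\<^bsub>DA\<^esub>)) h1 \<oplus>\<^bsub>H\<^esub>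
        compose (carrier M) (\<lambda>\<xi>\<in>carrier DA. (\<zero>\<^bsub>I\<^esub>, \<xi>)) (\<lambda>m\<in>carrier M. snd (h m))) m"
      using m mhomD(2)[OF h1 m] val_Y[OF h m]
      by (simp add: compose_eq del: dual_algebra_simps) (simp add: h1_def prod_eq_iff del: dual_algebra_simps)
  qed simp
  then have "\<xi> h = \<xi> (compose (carrier M) (\<lambda>x\<in>carrier I. (x, \<zero>\<^bsub>DA\<^esub>)) h1) \<oplus>\<^bsub>K\<^esub>
      \<xi> (compose (carrier M) (\<lambda>\<xi>\<in>carrier DA. (\<zero>\<^bsub>I\<^esub>, \<xi>)) (\<lambda>m\<in>carrier M. snd (h m)))"
    using fd(3)[OF inl[OF h1] h2m] by metis
  then show "\<xi> h = \<zero>\<^bsub>N\<^esub> h" using h \<open>P h1\<close> h2 by (simp add: P_def)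
qed simp

text \<open>The criterion is applied over a ring \<open>B'\<close> isomorphic to \<open>B\<close>,
  with all actions pulled back along \<open>\<phi>\<close>. This covers both assertions of the
  theorem: \<open>\<phi>\<close> is the identity for the first, and the given isomorphism from the
  endomorphism algebra of the shifted module for the second.\<close>

lemma intermediate_extension_transport:
  fixes B' :: "('k, 'c) module"
  assumes B': "ring B'" and \<phi>: "\<phi> \<in> ring_hom B' B" and bij: "bij_betw \<phi> (carrier B') (carrier B)"
    and e': "e' \<in> carrier B'" "\<phi> e' = e"
  shows "mod_iso B' (intermediate_extension B' e' (restrict_scalars (\<lambda>b. \<sigma> (\<phi> b)) M)) (restrict_scalars \<phi> N)"
proof -
  interpret B': ring B' by fact
  note \<phi>D = ring_hom_memE[OF \<phi>]
  \<comment> \<open>\<open>\<phi>\<close> is injective and multiplicative and sends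
    \<open>e'\<close> to the idempotent \<open>e\<close>, so \<open>e'\<close> is idempotent as
    well.\<close>
  have e'e': "e' \<otimes>\<^bsub>B'\<^esub> e' = e'"
    using bij_betw_imp_inj_on[OF bij] e' ee \<phi>D(2)[OF e'(1) e'(1)] by (metis B'.m_closed inj_onD)
  interpret i': ring_idempotent B' e'
    by unfold_locales (rule e' e'e')+
  have corner: "\<phi> x \<in> carrier (corner B e)" if "x \<in> carrier (corner B' e')" for x
    using that \<phi>D(1)[of x] \<phi>D(2)[of e' x] \<phi>D(2)[of x e'] e'
    unfolding i'.carrier_corner idem.carrier_corner by (metis)
  have hom: "(\<lambda>b. \<sigma> (\<phi> b)) \<in> ring_hom (corner B' e') A"
  proof (rule ring_hom_memI)
    note \<sigma>D = ring_hom_memE[OF \<sigma>_ring_hom]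
    fix x y assume x: "x \<in> carrier (corner B' e')" and y: "y \<in> carrier (corner B' e')"
    then have xy: "x \<in> carrier B'" "y \<in> carrier B'" unfolding i'.carrier_corner by blast+
    show "\<sigma> (\<phi> (x \<otimes>\<^bsub>corner B' e'\<^esub> y)) = \<sigma> (\<phi> x) \<otimes> \<sigma> (\<phi> y)"
      using \<sigma>D(2)[OF corner[OF x] corner[OF y]] \<phi>D(2)[OF xy] by (simp only: corner_simps)
    show "\<sigma> (\<phi> (x \<oplus>\<^bsub>corner B' e'\<^esub> y)) = \<sigma> (\<phi> x) \<oplus> \<sigma> (\<phi> y)"
      using \<sigma>D(3)[OF corner[OF x] corner[OF y]] \<phi>D(3)[OF xy] by (simp only: corner_simps)
  next
    show "\<sigma> (\<phi> \<one>\<^bsub>corner B' e'\<^esub>) = \<one>"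
      using ring_hom_memE(4)[OF \<sigma>_ring_hom] e'(2) by (simp only: corner_simps)
  qed (rule ring_hom_memE(1)[OF \<sigma>_ring_hom corner])
  interpret c': corner_module B' e' "restrict_scalars (\<lambda>b. \<sigma> (\<phi> b)) M"
    by (intro corner_module.intro i'.ring_idempotent_axioms
        left_module_restrict_scalars[OF M.left_module_axioms i'.ring_corner hom])
  interpret N: left_module B N by (rule left_module_N)
  have N': "left_module B' (restrict_scalars \<phi> N)"
    by (rule left_module_restrict_scalars[OF left_module_N B' \<phi>])
  interpret N': left_module B' "restrict_scalars \<phi> N" by (rule N')
  have surj: "\<exists>b'\<in>carrier B'. \<phi> b' = b" if "b \<in> carrier B" for b
    using bij that unfolding bij_betw_def by (metis imageE)
  show ?thesis
  proof (rule c'.intermediate_extension_iso[OF N', of \<psi>])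
    fix W assume W: "submodule W B' (restrict_scalars \<phi> N)" "\<psi> ` carrier (restrict_scalars (\<lambda>b. \<sigma> (\<phi> b)) M) \<subseteq> W"
    note WD = N'.submodule_D[OF W(1), unfolded restrict_scalars_simps]
    have "submodule W B N"
    proof (rule N.submodule_I)
      fix b n assume "b \<in> carrier B" "n \<in> W"
      then show "b \<odot>\<^bsub>N\<^esub> n \<in> W" using WD(4) surj by blast
    qed (use WD in blast)+
    then have "W = carrier N" using W(2) by (intro \<psi>_generates) auto
    then show "W = carrier (restrict_scalars \<phi> N)" by simp
  next
    fix n assume n: "n \<in> carrier (restrict_scalars \<phi> N)"
      and 0: "\<And>x. x \<in> carrier (right_ideal_module B' e') \<Longrightarrow> x \<odot>\<^bsub>restrict_scalars \<phi> N\<^esub> n = \<zero>\<^bsub>restrict_scalars \<phi> N\<^esub>"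
    show "n = \<zero>\<^bsub>restrict_scalars \<phi> N\<^esub>"
      unfolding restrict_scalars_simps
    proof (rule N_nondegenerate)
      fix x assume "x \<in> carrier (right_ideal_module B e)"
      then have x: "x \<in> carrier B" "e \<otimes>\<^bsub>B\<^esub> x = x" unfolding idem.carrier_right_ideal by blast+
      obtain x' where x': "x' \<in> carrier B'" "\<phi> x' = x" using surj x(1) by blast
      have "\<phi> (e' \<otimes>\<^bsub>B'\<^esub> x') = \<phi> x'" using \<phi>D(2)[OF e'(1) x'(1)] x x' e'(2) by (simp only:)
      then have "e' \<otimes>\<^bsub>B'\<^esub> x' = x'"
        using bij_betw_imp_inj_on[OF bij] e'(1) x'(1) by (metis B'.m_closed inj_onD)
      then have "x' \<in> carrier (right_ideal_module B' e')" using x' unfolding i'.carrier_right_ideal by blast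
      from 0[OF this] show "x \<odot>\<^bsub>N\<^esub> n = \<zero>\<^bsub>N\<^esub>" by (simp only: restrict_scalars_simps x'(2))
    qed (use n in simp)
  next
    fix r m assume "r \<in> carrier (corner B' e')" "m \<in> carrier (restrict_scalars (\<lambda>b. \<sigma> (\<phi> b)) M)"
    then show "\<psi> (r \<odot>\<^bsub>restrict_scalars (\<lambda>b. \<sigma> (\<phi> b)) M\<^esub> m) = r \<odot>\<^bsub>restrict_scalars \<phi> N\<^esub> \<psi> m"
      using \<psi>_smult[OF corner] by (simp only: restrict_scalars_simps)
  qed (use \<psi>_N \<psi>_add \<psi>_inj in \<open>simp_all only: restrict_scalars_simps\<close>)
qed

end

section \<open>Specialization to the complex \<open>E_complex\<close> and the shifted module\<close>

lemma left_module_zero_module: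
  assumes "left_module R M"
  shows "left_module R (zero_module M)"
proof -
  interpret left_module R M by fact
  have "submodule {\<zero>\<^bsub>M\<^esub>} R M" by (rule submodule_I) (auto simp: smult_r_null)
  then show ?thesis unfolding zero_module_def by (rule left_module_submodule)
qed

lemma zero_module_simps [simp]:
  "carrier (zero_module M) = {\<zero>\<^bsub>M\<^esub>}" "\<zero>\<^bsub>zero_module M\<^esub> = \<zero>\<^bsub>M\<^esub>"
  by (simp_all add: zero_module_def)

lemma mhom_direct_sum:
  assumes "left_module R M" "left_module R M'" "f \<in> mhom R M N" "g \<in> mhom R M' N'"
  shows "(\<lambda>p\<in>carrier (direct_sum M M'). (f (fst p), g (snd p))) \<in> mhom R (direct_sum M M') (direct_sum N N')"
proof -
  interpret M: left_module R M by fact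
  interpret M': left_module R M' by fact
  show ?thesis
    by (rule mhomI)
      (use mhomD[OF assms(3)] mhomD[OF assms(4)] in \<open>auto simp: M.smult_closed M'.smult_closed\<close>)
qed

text \<open>Since \<open>U\<close> and \<open>V\<close> meet only in zero, the component in
  \<open>U\<close> is unique and the definite description is meaningful. This places the
  distinguished idempotent of the second assertion in the endomorphism algebra of
  \<open>T\<close>.\<close>

lemma summand_projection:
  assumes "left_module R M" "internal_sum R M U V"
  shows "summand_projection M U V \<in> mhom R M M"
proof -
  interpret left_module R M by fact
  have U: "submodule U R M" and V: "submodule V R M" and UV: "U \<inter> V = {\<zero>\<^bsub>M\<^esub>}"
    and sum: "U <+>\<^bsub>M\<^esub> V = carrier M" using assms(2) by (auto simp: internal_sum_def)
  note UD = submodule_D[OF U] and VD = submodule_D[OF V]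
  define p where "p = summand_projection M U V"
  have uniq: "u = u'" if uv: "u \<in> U" "v \<in> V" "u' \<in> U" "v' \<in> V" "u \<oplus>\<^bsub>M\<^esub> v = u' \<oplus>\<^bsub>M\<^esub> v'" for u v u' v'
  proof -
    have c: "u \<in> carrier M" "v \<in> carrier M" "u' \<in> carrier M" "v' \<in> carrier M" using uv UD(1) VD(1) by auto
    have "u \<ominus>\<^bsub>M\<^esub> u' = (u \<oplus>\<^bsub>M\<^esub> v) \<ominus>\<^bsub>M\<^esub> v \<ominus>\<^bsub>M\<^esub> u'"
      using c by (simp add: a_minus_def M.a_assoc M.r_neg)
    also have "\<dots> = (u' \<oplus>\<^bsub>M\<^esub> v') \<ominus>\<^bsub>M\<^esub> v \<ominus>\<^bsub>M\<^esub> u'" using uv(5) by simp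
    also have "\<dots> = v' \<ominus>\<^bsub>M\<^esub> v"
    proof -
      have "(u' \<oplus>\<^bsub>M\<^esub> v') \<ominus>\<^bsub>M\<^esub> v \<ominus>\<^bsub>M\<^esub> u' = (v' \<ominus>\<^bsub>M\<^esub> v) \<oplus>\<^bsub>M\<^esub> (u' \<oplus>\<^bsub>M\<^esub> \<ominus>\<^bsub>M\<^esub> u')"
        using c by (simp add: a_minus_def M.a_ac)
      then show ?thesis using c by (simp add: M.r_neg)
    qed
    finally have "u \<ominus>\<^bsub>M\<^esub> u' \<in> U \<inter> V" using UD(6)[OF uv(1,3)] VD(6)[OF uv(4,2)] by simp
    then have "u \<ominus>\<^bsub>M\<^esub> u' = \<zero>\<^bsub>M\<^esub>" using UV by auto
    then show ?thesis using c by (simp add: M.minus_eq_zero_iff)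
  qed
  have pI: "p x = u" if "x \<in> carrier M" "u \<in> U" "v \<in> V" "x = u \<oplus>\<^bsub>M\<^esub> v" for x u v
    unfolding p_def summand_projection_def using that uniq by (auto intro!: the_equality)
  have ex: "\<exists>u\<in>U. \<exists>v\<in>V. x = u \<oplus>\<^bsub>M\<^esub> v" if "x \<in> carrier M" for x
  proof -
    have "x \<in> U <+>\<^bsub>M\<^esub> V" using that sum by simp
    then show ?thesis unfolding set_add_def set_mult_def by auto
  qed
  have "p \<in> mhom R M M"
  proof (rule mhomI)
    show "p \<in> extensional (carrier M)" by (simp add: p_def summand_projection_def)
    show "p x \<in> carrier M" if x: "x \<in> carrier M" for x
    proof -
      obtain u v where "u \<in> U" "v \<in> V" "x = u \<oplus>\<^bsub>M\<^esub> v" using ex[OF x] by blast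
      then show ?thesis using pI[OF x] UD(1) by auto
    qed
  next
    fix x y assume xy: "x \<in> carrier M" "y \<in> carrier M"
    obtain u v u' v' where x: "u \<in> U" "v \<in> V" "x = u \<oplus>\<^bsub>M\<^esub> v" and y: "u' \<in> U" "v' \<in> V" "y = u' \<oplus>\<^bsub>M\<^esub> v'"
      using ex[OF xy(1)] ex[OF xy(2)] by blast
    have c: "u \<in> carrier M" "v \<in> carrier M" "u' \<in> carrier M" "v' \<in> carrier M" using x y UD(1) VD(1) by auto
    have "x \<oplus>\<^bsub>M\<^esub> y = (u \<oplus>\<^bsub>M\<^esub> u') \<oplus>\<^bsub>M\<^esub> (v \<oplus>\<^bsub>M\<^esub> v')" using c x y by (simp add: M.a_ac)
    from pI[OF M.a_closed[OF xy] UD(3)[OF x(1) y(1)] VD(3)[OF x(2) y(2)] this]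
    show "p (x \<oplus>\<^bsub>M\<^esub> y) = p x \<oplus>\<^bsub>M\<^esub> p y"
      unfolding pI[OF xy(1) x] pI[OF xy(2) y] .
  next
    fix r x assume r: "r \<in> carrier R" and xM: "x \<in> carrier M"
    obtain u v where x: "u \<in> U" "v \<in> V" "x = u \<oplus>\<^bsub>M\<^esub> v" using ex[OF xM] by blast
    have c: "u \<in> carrier M" "v \<in> carrier M" using x UD(1) VD(1) by auto
    have "r \<odot>\<^bsub>M\<^esub> x = r \<odot>\<^bsub>M\<^esub> u \<oplus>\<^bsub>M\<^esub> r \<odot>\<^bsub>M\<^esub> v" using c x r by (simp add: smult_r_distr)
    from pI[OF smult_closed[OF r xM] UD(4)[OF r x(1)] VD(4)[OF r x(2)] this]
    show "p (r \<odot>\<^bsub>M\<^esub> x) = r \<odot>\<^bsub>M\<^esub> p x"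
      unfolding pI[OF xM x] .
  qed
  then show ?thesis by (simp add: p_def)
qed

lemma fin_dim_algebra_if_fd_algebra:
  assumes "fd_algebra K A"
  shows "fin_dim_algebra K A"
proof -
  have K: "field K" and A: "ring A" and KA: "module K A" and fg: "finitely_generated K A"
    using assms by (auto simp: fd_algebra_def)
  interpret K: field K by (rule K)
  interpret KA: module K A by (rule KA)
  have "left_module K A"
    by (rule left_moduleI[OF K.ring_axioms KA.M.abelian_group_axioms])
      (auto simp: KA.smult_l_distr KA.smult_r_distr KA.smult_assoc1)
  then show ?thesis
    using assms K A fg by (simp add: fin_dim_algebra_def fin_dim_algebra_axioms_def fd_algebra_def)
qed

text \<open>In degree \<open>k\<close> the resolution contributes \<open>Q (k - 1)\<close>, because
  \<open>E\<close> itself occupies degree zero; in degree \<open>k + 1\<close> both summands are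
  zero modules.\<close>

lemma kernel_setting_E_complex:
  fixes K :: "'k ring" and A :: "('k, 'a) module" and E :: "('a, 'm) module" and M :: "('a, 'n) module"
  assumes A: "fd_algebra K A" and E: "fg_module A E" and k: "1 \<le> k"
    and res: "coresolution A E Q \<eta> d" and inj: "\<And>i. injective A (Q i)" and M: "fg_module A M"
  shows "kernel_setting K A (E_complex K A k E Q \<eta> d) (int k) (Q (k - 1)) M"
proof -
  interpret fin_dim_algebra K A by (rule fin_dim_algebra_if_fd_algebra[OF A])
  have \<eta>: "\<eta> \<in> mhom A E (Q 0)" and d: "\<And>i. d i \<in> mhom A (Q i) (Q (Suc i))"
    using res by (auto simp: coresolution_def)
  have mE: "left_module A E" and mQ: "\<And>i. left_module A (Q i)"
    using E inj by (auto simp: fg_module_def injective_def)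
  let ?R = "resolution_complex k E Q \<eta> d" and ?S = "stalk_complex (int k) DA"
  have R_term: "cterm ?R i = (if i = 0 then E else if 1 \<le> i \<and> i \<le> int k then Q (nat (i - 1)) else zero_module E)" for i
    by (simp add: resolution_complex_def Let_def)
  have S_term: "cterm ?S i = (if i = int k then DA else zero_module DA)" for i
    by (simp add: stalk_complex_def Let_def)
  have mR: "left_module A (cterm ?R i)" for i
    using mE mQ left_module_zero_module[OF mE] by (simp add: R_term)
  have mS: "left_module A (cterm ?S i)" for i
    using left_module_DA left_module_zero_module[OF left_module_DA] by (simp add: S_term)
  have dR: "cdiff ?R i \<in> mhom A (cterm ?R i) (cterm ?R (i + 1))" for i
  proof -
    have eq: "cdiff ?R i = (if i = 0 \<and> 0 < k then \<eta> else if 1 \<le> i \<and> i < int k then d (nat (i - 1))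
        else zero_map (cterm ?R i) (cterm ?R (i + 1)))"
      by (simp add: resolution_complex_def Let_def)
    consider "i = 0" | "1 \<le> i" "i < int k" | "i < 0 \<or> i \<ge> int k" by linarith
    then show ?thesis
    proof cases
      case 1
      then show ?thesis unfolding eq using k \<eta> by (simp add: R_term)
    next
      case 2
      \<comment> \<open>Degree \<open>i\<close> carries \<open>Q\<close> with index
        \<open>i - 1\<close>, so \<open>d\<close> with index \<open>i - 1\<close> goes from degree
        \<open>i\<close> to degree \<open>i + 1\<close>.\<close>
      then have "nat i = Suc (nat (i - 1))" by linarith
      then show ?thesis unfolding eq using 2 d[of "nat (i - 1)"] by (simp add: R_term)
    next
      case 3
      then have "cdiff ?R i = zero_map (cterm ?R i) (cterm ?R (i + 1))" using k by (auto simp: eq)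
      then show ?thesis using mhom_zero_map[OF mR mR] by simp
    qed
  qed
  have S_diff: "cdiff ?S i = zero_map (cterm ?S i) (cterm ?S (i + 1))" for i
    by (simp add: stalk_complex_def Let_def)
  have dS: "cdiff ?S i \<in> mhom A (cterm ?S i) (cterm ?S (i + 1))" for i
    unfolding S_diff by (rule mhom_zero_map[OF mS mS])
  have X_term: "cterm (E_complex K A k E Q \<eta> d) i = direct_sum (cterm ?R i) (cterm ?S i)" for i
    by (simp add: E_complex_def complex_sum_def)
  have X_diff: "cdiff (E_complex K A k E Q \<eta> d) i =
      (\<lambda>p\<in>carrier (direct_sum (cterm ?R i) (cterm ?S i)). (cdiff ?R i (fst p), cdiff ?S i (snd p)))" for i
    by (simp add: E_complex_def complex_sum_def)
  have "module_complex A (E_complex K A k E Q \<eta> d)"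
  proof (intro module_complex.intro module_complex_axioms.intro ring_axioms)
    fix i
    show "left_module A (cterm (E_complex K A k E Q \<eta> d) i)"
      unfolding X_term by (rule left_module_direct_sum[OF mR mS])
    show "cdiff (E_complex K A k E Q \<eta> d) i
        \<in> mhom A (cterm (E_complex K A k E Q \<eta> d) i) (cterm (E_complex K A k E Q \<eta> d) (i + 1))"
      unfolding X_term X_diff by (rule mhom_direct_sum[OF mR mS dR dS])
  qed
  moreover have "cterm (E_complex K A k E Q \<eta> d) (int k) = direct_sum (Q (k - 1)) DA"
  proof -
    have "nat (int k - 1) = k - 1" by simp
    then show ?thesis using k by (simp add: X_term R_term S_term)
  qed
  moreover have "carrier (cterm (E_complex K A k E Q \<eta> d) (int k + 1)) =
      {\<zero>\<^bsub>cterm (E_complex K A k E Q \<eta> d) (int k + 1)\<^esub>}"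
    by (auto simp: X_term R_term S_term)
  moreover have "snd (cdiff (E_complex K A k E Q \<eta> d) (int k - 1) p) = \<zero>\<^bsub>DA\<^esub>"
    if "p \<in> carrier (cterm (E_complex K A k E Q \<eta> d) (int k - 1))" for p
    using that unfolding X_term X_diff
    by (auto simp: S_diff S_term zero_map_def simp del: dual_algebra_simps)
  ultimately show ?thesis
    by (intro kernel_setting.intro kernel_setting_axioms.intro fin_dim_algebra_axioms inj M)
qed

text \<open>Outside degree \<open>k\<close> the second component takes only the value zero, which
  \<open>h\<close> fixes, so the family that defines the class is the zero map there.\<close>

lemma dual_summand_class_eq:
  assumes ks: "kernel_setting K A (E_complex K A k E Q \<eta> d) (int k) (Q (k - 1)) M" and k: "1 \<le> k"
    and h: "h \<zero>\<^bsub>dual_algebra K A\<^esub> = \<zero>\<^bsub>dual_algebra K A\<^esub>"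
  shows "dual_summand_class K A k E Q \<eta> d h = homotopy_class A (E_complex K A k E Q \<eta> d)
     (kernel_setting.concentrated (E_complex K A k E Q \<eta> d) (int k)
       (kernel_setting.on_DA K A (Q (k - 1)) h))"
proof -
  interpret kernel_setting K A "E_complex K A k E Q \<eta> d" "int k" "Q (k - 1)" M by (rule ks)
  have "(\<lambda>i. \<lambda>p\<in>carrier (cterm (E_complex K A k E Q \<eta> d) i).
          (\<zero>\<^bsub>cterm (resolution_complex k E Q \<eta> d) i\<^esub>, h (snd p))) = concentrated (on_DA h)"
  proof
    fix i
    have t: "cterm (E_complex K A k E Q \<eta> d) i = direct_sum (cterm (resolution_complex k E Q \<eta> d) i)
      (if i = int k then DA else zero_module DA)"
      by (simp add: E_complex_def complex_sum_def stalk_complex_def Let_def)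
    show "(\<lambda>p\<in>carrier (cterm (E_complex K A k E Q \<eta> d) i).
          (\<zero>\<^bsub>cterm (resolution_complex k E Q \<eta> d) i\<^esub>, h (snd p))) = concentrated (on_DA h) i"
    proof (cases "i = int k")
      case True
      have "nat (int k - 1) = k - 1" by simp
      then have "\<zero>\<^bsub>cterm (resolution_complex k E Q \<eta> d) i\<^esub> = \<zero>\<^bsub>Q (k - 1)\<^esub>"
        using k True by (simp add: resolution_complex_def Let_def)
      then show ?thesis using True by (simp add: on_DA_def top del: One_nat_def)
    next
      case False
      then show ?thesis
        using h unfolding concentrated_def t zero_map_def
        by (simp, intro restrict_ext) (auto simp del: dual_algebra_simps)
    qed
  qed
  then show ?thesis by (simp add: dual_summand_class_def)
qed

theorem theorem4p12:
  fixes K :: "'k ring" and A :: "('k, 'a) module" and E :: "('a, 'm) module"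
    and \<Gamma> :: "('k, 'g) module" and k :: nat
    and Q :: "nat \<Rightarrow> ('a, 'm) module" and \<eta> :: "'m \<Rightarrow> 'm" and d :: "nat \<Rightarrow> 'm \<Rightarrow> 'm"
    and M :: "('a, 'n) module"
  assumes "fd_algebra K A" and "basic_module A (regular A)"
    and "fg_module A E" and "basic_module A E" and "generating_cogenerating K A E"
    and "fd_algebra K \<Gamma>" and "algebra_isos K \<Gamma> (opposite (end_algebra A E)) \<noteq> {}"
    and "1 \<le> k" and "domdim_ge \<Gamma> k"
    and "minimal_injective_resolution A E Q \<eta> d"
    and "fg_module A M"
  shows
    \<comment> \<open>with the shifted algebra identified with the opposite endomorphism algebra of the complex\<close>
    "mod_iso (kb_shifted_algebra K A k E Q \<eta> d)
       (intermediate_extension (kb_shifted_algebra K A k E Q \<eta> d) (kb_shifted_idempotent K A k E Q \<eta> d)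
          (restrict_scalars (corner_to_base K A k E Q \<eta> d) M))
       (dual_hom_kernel K A (E_complex K A k E Q \<eta> d) (int k) M)
     \<and>
     \<comment> \<open>with the shifted algebra as endomorphism algebra of the shifted module\<close>
     (\<forall>W (T :: ('g, 't) module) U V \<phi>.
        maximal_proj_inj_summand \<Gamma> W \<and> shifted_module \<Gamma> k W T U V \<and>
        \<phi> \<in> algebra_isos K (opposite (end_algebra \<Gamma> T)) (kb_shifted_algebra K A k E Q \<eta> d) \<and>
        \<phi> (summand_projection T U V) = kb_shifted_idempotent K A k E Q \<eta> d \<longrightarrow>
        mod_iso (opposite (end_algebra \<Gamma> T))
          (intermediate_extension (opposite (end_algebra \<Gamma> T)) (summand_projection T U V)
             (restrict_scalars (\<lambda>b. corner_to_base K A k E Q \<eta> d (\<phi> b)) M))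
          (restrict_scalars \<phi> (dual_hom_kernel K A (E_complex K A k E Q \<eta> d) (int k) M)))"
proof -
  have res: "coresolution A E Q \<eta> d" and inj: "\<And>i. injective A (Q i)"
    using assms(10) by (auto simp: minimal_injective_resolution_def)
  have ks: "kernel_setting K A (E_complex K A k E Q \<eta> d) (int k) (Q (k - 1)) M"
    by (rule kernel_setting_E_complex[OF assms(1,3,8) res inj assms(11)])
  interpret kernel_setting K A "E_complex K A k E Q \<eta> d" "int k" "Q (k - 1)" M by (rule ks)
  have B_eq: "kb_shifted_algebra K A k E Q \<eta> d = B" by (simp add: kb_shifted_algebra_def)
  have e_eq: "kb_shifted_idempotent K A k E Q \<eta> d = e"
    unfolding kb_shifted_idempotent_def e_def \<epsilon>_def by (rule dual_summand_class_eq[OF ks assms(8)]) simp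
  have \<rho>_eq: "dual_summand_class K A k E Q \<eta> d (\<lambda>\<xi>. \<lambda>x\<in>carrier A. \<xi> (a \<otimes>\<^bsub>A\<^esub> x)) = \<rho> a"
    if "a \<in> carrier A" for a
  proof -
    have "dual_summand_class K A k E Q \<eta> d (\<lambda>\<xi>. \<lambda>x\<in>carrier A. \<xi> (a \<otimes>\<^bsub>A\<^esub> x))
      = cls (concentrated (on_DA (\<lambda>\<xi>. \<lambda>x\<in>carrier A. \<xi> (a \<otimes>\<^bsub>A\<^esub> x))))"
      by (rule dual_summand_class_eq[OF ks assms(8)]) (use that in \<open>auto intro!: restrict_ext\<close>)
    also have "on_DA (\<lambda>\<xi>. \<lambda>x\<in>carrier A. \<xi> (a \<otimes>\<^bsub>A\<^esub> x)) = on_DA (rmult a)"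
      by (rule on_DA_cong) (simp add: rmult_def)
    finally show ?thesis unfolding \<rho>_def .
  qed
  \<comment> \<open>\<open>inv_into\<close> looks only at arguments in the carrier of
    \<open>A\<close>, and there \<open>\<rho>_eq\<close> shows that the two functions being inverted
    agree.\<close>
  have \<sigma>_eq: "corner_to_base K A k E Q \<eta> d = \<sigma>"
    unfolding corner_to_base_def \<sigma>_def inv_into_def by (auto simp: fun_eq_iff \<rho>_eq cong: conj_cong)
  have N_id: "restrict_scalars (\<lambda>b. b) N = N"
    by (simp add: restrict_scalars_def dual_hom_kernel_def Let_def)
  \<comment> \<open>Transport along the identity of \<open>B\<close>.\<close>
  have 1: "mod_iso B (intermediate_extension B e (restrict_scalars \<sigma> M)) N"
    using intermediate_extension_transport[OF ring_B, of "\<lambda>b. b" e] e_B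
    by (simp add: N_id ring_hom_def bij_betw_def)
  have 2: "mod_iso (opposite (end_algebra \<Gamma> T))
          (intermediate_extension (opposite (end_algebra \<Gamma> T)) (summand_projection T U V)
             (restrict_scalars (\<lambda>b. \<sigma> (\<phi> b)) M)) (restrict_scalars \<phi> N)"
    if T: "shifted_module \<Gamma> k W T U V" and \<phi>: "\<phi> \<in> algebra_isos K (opposite (end_algebra \<Gamma> T)) B"
      and pe: "\<phi> (summand_projection T U V) = e" for W and T :: "('g, 't) module" and U V \<phi>
  proof (rule intermediate_extension_transport[where \<phi> = \<phi>, OF _ _ _ _ pe])
    have mT: "left_module \<Gamma> T" and UV: "internal_sum \<Gamma> T U V"
      using T by (auto simp: shifted_module_def special_tilting_def tilting_def fg_module_def)
    show "ring (opposite (end_algebra \<Gamma> T))" by (rule ring_opposite[OF ring_end_algebra[OF mT]])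
    show "\<phi> \<in> ring_hom (opposite (end_algebra \<Gamma> T)) B"
      "bij_betw \<phi> (carrier (opposite (end_algebra \<Gamma> T))) (carrier B)"
      using \<phi> unfolding algebra_isos_def ring_iso_def by blast+
    show "summand_projection T U V \<in> carrier (opposite (end_algebra \<Gamma> T))"
      using summand_projection[OF mT UV] by simp
  qed
  show ?thesis
    unfolding B_eq e_eq \<sigma>_eq using 1 2 by blast
qed

end
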